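(* Let $M\subset\mathbb{C}^N$ be a real analytic, generic CR submanifold which is of finite type at $p_0\in M$. Let $f=u+iv$ ($u=\operatorname{Re}f$, $v=\operatorname{Im}f$) be a continuous CR function defined in a neighborhood of $p_0$ in $M$ with $v$ real analytic. Then $f$ can be holomorphically extended to a full neighborhood of $p_0$ in $\mathbb{C}^N$, i.e. there is a holomorphic function on a neighborhood of $p_0$ in $\mathbb{C}^N$ that agrees with $f$ on $M$ near $p_0$. (Equivalently, $u$ is also real analytic in a neighborhood of $p_0$ in $M$.)
   Context: A real analytic real submanifold $M\subset\mathbb{C}^N$ of codimension $d$ is a set which near each of its points $p_0$ has the form $M\cap U=\{Z\in U:\rho(Z,\overline Z)=0\}$, with $U$ a neighborhood of $p_0$ and $\rho=(\rho_1,\dots,\rho_d)$ real analytic and $\mathbb{R}^d$-valued on $U$ with $d\rho_1,\dots,d\rho_d$ linearly independent in $U$. $M$ is generic if $\partial\rho_1,\dots,\partial\rho_d$ are $\mathbb{C}$-linearly independent at every $p\in M$ (a generic submanifold is CR). A CR vector field on $M$ is a section of $T^{0,1}\mathbb{C}^N\cap(\mathbb{C}\otimes TM)$. A continuous CR function is a continuous complex-valued function annihilated, in the sense of distributions, by all smooth CR vector fields. $M$ is of finite type at $p_0$ if the Lie algebra generated by the smooth CR vector fields near $p_0$ and their complex conjugates spans $\mathbb{C}\otimes T_{p_0}M$ at $p_0$. *)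

theory Defs
  imports "HOL-Analysis.Analysis"
begin

section \<open>Smooth, real analytic and holomorphic functions\<close>

fun C_k_on :: "nat \<Rightarrow> 'a::euclidean_space set \<Rightarrow> ('a \<Rightarrow> 'b::real_normed_vector) \<Rightarrow> bool" where
  "C_k_on 0 U f \<longleftrightarrow> continuous_on U f"
| "C_k_on (Suc k) U f \<longleftrightarrow>
     (\<forall>x\<in>U. f differentiable (at x)) \<and> (\<forall>v. C_k_on k U (\<lambda>x. frechet_derivative f (at x) v))"

definition smooth_on :: "'a::euclidean_space set \<Rightarrow> ('a \<Rightarrow> 'b::real_normed_vector) \<Rightarrow> bool" where
  "smooth_on U f \<longleftrightarrow> open U \<and> (\<forall>k. C_k_on k U f)"

text \<open>Multi-indices are functions from the standard basis to the naturals, made extensional so that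
  each multi-index is counted once; unconditional convergence is the convergence of power series
  in several variables.\<close>

definition real_analytic_on :: "'a::euclidean_space set \<Rightarrow> ('a \<Rightarrow> real) \<Rightarrow> bool" where
  "real_analytic_on U g \<longleftrightarrow> open U \<and>
     (\<forall>p\<in>U. \<exists>r>0. \<exists>c :: ('a \<Rightarrow> nat) \<Rightarrow> real. \<forall>x\<in>ball p r.
        ((\<lambda>\<alpha>. c \<alpha> * (\<Prod>b\<in>Basis. ((x - p) \<bullet> b) ^ \<alpha> b)) has_sum g x) (Basis \<rightarrow>\<^sub>E UNIV))"

definition holomorphic_on_Cn :: "(complex ^ 'n) set \<Rightarrow> (complex ^ 'n \<Rightarrow> complex) \<Rightarrow> bool" where
  "holomorphic_on_Cn U F \<longleftrightarrow> open U \<and>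
     (\<forall>Z\<in>U. \<exists>F'. (F has_derivative F') (at Z) \<and> (\<forall>c X. F' (c *s X) = c * F' X))"


section \<open>Real analytic generic submanifolds of complex Euclidean space\<close>

definition local_defining_functions ::
  "nat \<Rightarrow> (complex ^ 'n) set \<Rightarrow> (complex ^ 'n) set \<Rightarrow> (nat \<Rightarrow> complex ^ 'n \<Rightarrow> real) \<Rightarrow> bool" where
  "local_defining_functions d M U \<rho> \<longleftrightarrow> open U \<and>
     (\<forall>j<d. real_analytic_on U (\<rho> j)) \<and>
     M \<inter> U = {Z\<in>U. \<forall>j<d. \<rho> j Z = 0} \<and>
     (\<forall>Z\<in>U. \<forall>c :: nat \<Rightarrow> real.
        (\<forall>X. (\<Sum>j<d. c j * frechet_derivative (\<rho> j) (at Z) X) = 0) \<longrightarrow> (\<forall>j<d. c j = 0))"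

definition real_analytic_submanifold :: "nat \<Rightarrow> (complex ^ 'n) set \<Rightarrow> bool" where
  "real_analytic_submanifold d M \<longleftrightarrow>
     (\<forall>p\<in>M. \<exists>U \<rho>. p \<in> U \<and> local_defining_functions d M U \<rho>)"

text \<open>The vector of coefficients \<open>\<partial>g/\<partial>Z\<^sub>k = (\<partial>g/\<partial>x\<^sub>k - \<i> \<partial>g/\<partial>y\<^sub>k)/2\<close> of the (1,0)-form \<open>\<partial>g\<close> at \<open>Z\<close>.\<close>

definition del :: "(complex ^ 'n \<Rightarrow> real) \<Rightarrow> complex ^ 'n \<Rightarrow> complex ^ 'n" where
  "del g Z = (\<chi> k. (of_real (frechet_derivative g (at Z) (axis k 1))
                    - \<i> * of_real (frechet_derivative g (at Z) (axis k \<i>))) / 2)"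

definition generic :: "nat \<Rightarrow> (complex ^ 'n) set \<Rightarrow> bool" where
  "generic d M \<longleftrightarrow>
     (\<forall>p\<in>M. \<exists>U \<rho>. p \<in> U \<and> local_defining_functions d M U \<rho> \<and>
        (\<forall>q\<in>M \<inter> U. \<forall>c :: nat \<Rightarrow> complex.
           (\<Sum>j<d. c j *s del (\<rho> j) q) = 0 \<longrightarrow> (\<forall>j<d. c j = 0)))"

definition real_analytic_along ::
  "(complex ^ 'n) set \<Rightarrow> (complex ^ 'n) set \<Rightarrow> (complex ^ 'n \<Rightarrow> real) \<Rightarrow> bool" where
  "real_analytic_along M W g \<longleftrightarrow>
     (\<forall>p\<in>M \<inter> W. \<exists>U G. p \<in> U \<and> U \<subseteq> W \<and> real_analytic_on U G \<and> (\<forall>q\<in>M \<inter> U. G q = g q))"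


section \<open>Complex tangent vectors and vector fields\<close>

text \<open>A complex tangent vector \<open>X + \<i>Y\<close> in the complexification of \<open>T\<^sub>p\<close> of complex Euclidean space
  is represented by the pair \<open>(X, Y)\<close> of its real and imaginary parts; the \<open>\<i>\<close> of the
  complexification must not be confused with the complex structure \<open>X \<mapsto> \<i> *s X\<close>.\<close>

type_synonym 'n ctan = "(complex ^ 'n) \<times> (complex ^ 'n)"

definition ctan_scale :: "complex \<Rightarrow> 'n ctan \<Rightarrow> 'n::finite ctan" where
  "ctan_scale c L = (Re c *\<^sub>R fst L - Im c *\<^sub>R snd L, Im c *\<^sub>R fst L + Re c *\<^sub>R snd L)"

definition ctan_cnj :: "'n ctan \<Rightarrow> 'n::finite ctan" where
  "ctan_cnj L = (fst L, - snd L)"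

definition tangent_space :: "(complex ^ 'n) set \<Rightarrow> complex ^ 'n \<Rightarrow> (complex ^ 'n) set" where
  "tangent_space M p = {X. \<exists>\<gamma> e. e > 0 \<and> smooth_on {-e<..<e::real} \<gamma> \<and> \<gamma> ` {-e<..<e} \<subseteq> M \<and>
                             \<gamma> 0 = p \<and> (\<gamma> has_vector_derivative X) (at 0)}"

definition complexified_tangent_space :: "(complex ^ 'n) set \<Rightarrow> complex ^ 'n \<Rightarrow> 'n::finite ctan set" where
  "complexified_tangent_space M p = tangent_space M p \<times> tangent_space M p"

text \<open>The span of the \<open>\<partial>/\<partial>Z\<^sub>k\<close>-bar, that is the \<open>(-\<i>)\<close>-eigenspace of the complex structure:
  the vectors \<open>X + \<i> J X\<close>, where \<open>J X = \<i> *s X\<close>.\<close>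

definition T01 :: "'n::finite ctan set" where
  "T01 = {(X, \<i> *s X) | X. True}"

text \<open>Smooth vector fields on \<open>M \<inter> U\<close> are given by smooth ambient extensions to \<open>U\<close>; only the values
  on \<open>M\<close> matter.\<close>

definition cr_vector_field ::
  "(complex ^ 'n) set \<Rightarrow> (complex ^ 'n) set \<Rightarrow> (complex ^ 'n \<Rightarrow> 'n::finite ctan) \<Rightarrow> bool" where
  "cr_vector_field M U L \<longleftrightarrow> smooth_on U L \<and>
     (\<forall>p\<in>M \<inter> U. L p \<in> T01 \<inter> complexified_tangent_space M p)"

definition ctan_deriv ::
  "(complex ^ 'n \<Rightarrow> 'n ctan) \<Rightarrow> complex ^ 'n \<Rightarrow> 'n ctan \<Rightarrow> 'n::finite ctan" where
  "ctan_deriv K p V = frechet_derivative K (at p) (fst V)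
                      + ctan_scale \<i> (frechet_derivative K (at p) (snd V))"

text \<open>For fields tangent to \<open>M\<close> along \<open>M\<close>, the restriction of the ambient bracket to \<open>M\<close> is the
  bracket on \<open>M\<close>; it does not depend on the ambient extensions.\<close>

definition lie_bracket ::
  "(complex ^ 'n \<Rightarrow> 'n ctan) \<Rightarrow> (complex ^ 'n \<Rightarrow> 'n ctan) \<Rightarrow> complex ^ 'n \<Rightarrow> 'n::finite ctan" where
  "lie_bracket L K p = ctan_deriv K p (L p) - ctan_deriv L p (K p)"

inductive_set cr_lie_algebra ::
  "(complex ^ 'n) set \<Rightarrow> (complex ^ 'n) set \<Rightarrow> (complex ^ 'n \<Rightarrow> 'n::finite ctan) set"
  for M U where
  cr: "cr_vector_field M U L \<Longrightarrow> L \<in> cr_lie_algebra M U"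
| cr_cnj: "cr_vector_field M U L \<Longrightarrow> (\<lambda>p. ctan_cnj (L p)) \<in> cr_lie_algebra M U"
| add: "L \<in> cr_lie_algebra M U \<Longrightarrow> K \<in> cr_lie_algebra M U \<Longrightarrow>
          (\<lambda>p. L p + K p) \<in> cr_lie_algebra M U"
| scale: "L \<in> cr_lie_algebra M U \<Longrightarrow> (\<lambda>p. ctan_scale c (L p)) \<in> cr_lie_algebra M U"
| bracket: "L \<in> cr_lie_algebra M U \<Longrightarrow> K \<in> cr_lie_algebra M U \<Longrightarrow>
          lie_bracket L K \<in> cr_lie_algebra M U"

definition finite_type_at :: "(complex ^ 'n) set \<Rightarrow> complex ^ 'n \<Rightarrow> bool" where
  "finite_type_at M p \<longleftrightarrow>
     (\<exists>U. open U \<and> p \<in> U \<and> {L p | L. L \<in> cr_lie_algebra M U} = complexified_tangent_space M p)"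


section \<open>Continuous CR functions\<close>

definition local_parametrization ::
  "(complex ^ 'n) set \<Rightarrow> (real ^ 'm) set \<Rightarrow> (real ^ 'm \<Rightarrow> complex ^ 'n) \<Rightarrow> bool" where
  "local_parametrization S V \<phi> \<longleftrightarrow> smooth_on V \<phi> \<and>
     (\<forall>t\<in>V. inj (frechet_derivative \<phi> (at t))) \<and>
     openin (top_of_set S) (\<phi> ` V) \<and> (\<exists>\<psi>. homeomorphism V (\<phi> ` V) \<phi> \<psi>)"

text \<open>The complex-linear extension of the differential of \<open>\<phi>\<close> at \<open>t\<close>; complex tangent vectors
  \<open>\<Sum>\<^sub>j a\<^sub>j \<partial>/\<partial>t\<^sub>j\<close> of the parameter space are given by their coefficients.\<close>

definition cpush :: "(real ^ 'm \<Rightarrow> complex ^ 'n) \<Rightarrow> real ^ 'm \<Rightarrow> complex ^ 'm \<Rightarrow> 'n::finite ctan" where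
  "cpush \<phi> t a = (frechet_derivative \<phi> (at t) (\<chi> j. Re (a $ j)),
                   frechet_derivative \<phi> (at t) (\<chi> j. Im (a $ j)))"

definition test_function :: "(real ^ 'm) set \<Rightarrow> (real ^ 'm \<Rightarrow> complex) \<Rightarrow> bool" where
  "test_function V \<theta> \<longleftrightarrow> smooth_on UNIV \<theta> \<and> (\<exists>K. compact K \<and> K \<subseteq> V \<and> (\<forall>t. t \<notin> K \<longrightarrow> \<theta> t = 0))"

text \<open>\<open>L f = 0\<close> on \<open>M \<inter> U\<close> in the sense of distributions. In local coordinates
  \<open>L = \<Sum>\<^sub>j a\<^sub>j \<partial>/\<partial>t\<^sub>j\<close>, and the distribution \<open>L f\<close> maps \<open>\<theta>\<close> to
  \<open>- \<integral> f \<Sum>\<^sub>j \<partial>(a\<^sub>j \<theta>)/\<partial>t\<^sub>j\<close>. The coefficients \<open>a\<close> are determined by \<open>L\<close> and \<open>\<phi>\<close> and are smooth when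
  \<open>L\<close> is. The type argument carries the dimension of \<open>M\<close>, which has to be that of the parameter
  space.\<close>

definition weakly_annihilates ::
  "'m::finite itself \<Rightarrow> (complex ^ 'n) set \<Rightarrow> (complex ^ 'n) set \<Rightarrow>
     (complex ^ 'n \<Rightarrow> 'n ctan) \<Rightarrow> (complex ^ 'n \<Rightarrow> complex) \<Rightarrow> bool" where
  "weakly_annihilates _ M U L f \<longleftrightarrow>
     (\<forall>(V :: (real ^ 'm) set) \<phi> (a :: real ^ 'm \<Rightarrow> complex ^ 'm) \<theta>.
        local_parametrization (M \<inter> U) V \<phi> \<and> (\<forall>t\<in>V. cpush \<phi> t (a t) = L (\<phi> t)) \<and>
        test_function V \<theta> \<longrightarrow>
        (LINT t:V|lborel. f (\<phi> t) *
           (\<Sum>j\<in>UNIV. frechet_derivative (\<lambda>s. a s $ j * \<theta> s) (at t) (axis j 1))) = 0)"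

definition continuous_cr_function ::
  "'m::finite itself \<Rightarrow> (complex ^ 'n) set \<Rightarrow> (complex ^ 'n) set \<Rightarrow>
     (complex ^ 'n \<Rightarrow> complex) \<Rightarrow> bool" where
  "continuous_cr_function T M W f \<longleftrightarrow> continuous_on (M \<inter> W) f \<and>
     (\<forall>U L. U \<subseteq> W \<and> cr_vector_field M U L \<longrightarrow> weakly_annihilates T M U L f)"

end

theory Submission
  imports Defs "HOL-Complex_Analysis.Complex_Analysis"
begin

text \<open>Write \<open>f = u + iv\<close>. A CR vector field \<open>L\<close> satisfies \<open>L u = - \<i> L v\<close> in the sense of distributions,
  and if \<open>L\<close> is analytic then the right-hand side is an analytic function. Since \<open>u\<close> is real, its
  derivative along the conjugate of \<open>L\<close> is analytic as well. If \<open>u\<close> has analytic derivatives \<open>g\<close>, \<open>h\<close>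
  along analytic fields \<open>a\<close>, \<open>b\<close>, then it has the analytic derivative \<open>a h - b g\<close> along \<open>[a, b]\<close>
  (\<open>weak_deriv_bracket\<close>), and its derivatives along linear combinations with analytic coefficients are
  analytic too. So the fields along which \<open>u\<close> is analytic form a Lie algebra that contains the
  analytic CR fields and their conjugates. The Lie algebra in the definition of finite type is
  generated by all smooth CR fields, but these are combinations of finitely many analytic CR fields with
  smooth coefficients, and the smooth combinations of fields along which \<open>u\<close> is analytic are closed
  under brackets and take at every point only values of such fields. By finite type these values
  exhaust the complexified tangent space at \<open>p0\<close>, and Cramer's rule shows that \<open>u\<close> has analytic weak
  derivatives along the coordinate fields of a chart. A continuous function with a continuous weak gradient is
  differentiable, and it is recovered from an analytic gradient by integration along rays, so \<open>u\<close> is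
  analytic.

  It follows that \<open>f\<close> extends holomorphically to the complexification of \<open>M\<close>, which is parametrized by a
  holomorphic map \<open>\<Phi>\<close> (\<open>generic_chart\<close>). Let \<open>H\<close> be the composition of \<open>\<Phi>\<close> with the coordinates \<open>Z\<close> of the
  ambient space, continued holomorphically to its complexification. Genericity means that \<open>H\<close> is a
  submersion at the base point. The kernels of its differentials consist of the complexified CR
  vectors, so the extension of \<open>f\<close> is annihilated by them at the real points, where this is the CR
  equation, and then at all points, because a holomorphic function that vanishes at the real points is
  zero (\<open>holo_identity\<close>). Thus the extension is constant on the fibres of \<open>H\<close> and descends to a
  holomorphic function \<open>F\<close> near \<open>p0\<close> (\<open>holo_submersion\<close>). At the real points \<open>H\<close> is the chart of \<open>M\<close>, so
  \<open>F\<close> agrees with \<open>f\<close> on \<open>M\<close>.\<close>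

section \<open>Holomorphic maps between spaces with complex structures\<close>

abbreviation D :: "('a::real_normed_vector \<Rightarrow> 'b::real_normed_vector) \<Rightarrow> 'a \<Rightarrow> 'a \<Rightarrow> 'b" where
  "D f x \<equiv> frechet_derivative f (at x)"

text \<open>Holomorphy as complex linearity of the differential with respect to given complex structures \<open>I\<close> and
  \<open>J\<close>. The spaces that occur are \<open>complex\<close>, complex vectors, and the complexification \<open>E \<times> E\<close> of a real
  space \<open>E\<close>, which may itself consist of complex vectors.\<close>

definition holo ::
  "('a::real_normed_vector \<Rightarrow> 'a) \<Rightarrow> ('b::real_normed_vector \<Rightarrow> 'b) \<Rightarrow> 'a set \<Rightarrow> ('a \<Rightarrow> 'b) \<Rightarrow> bool" where
  "holo I J S f \<longleftrightarrow> (\<forall>x\<in>S. \<exists>f'. (f has_derivative f') (at x) \<and> (\<forall>v. f' (I v) = J (f' v)))"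

definition complex_structure :: "('a::real_normed_vector \<Rightarrow> 'a) \<Rightarrow> bool" where
  "complex_structure I \<longleftrightarrow> bounded_linear I \<and> (\<forall>x. I (I x) = - x)"

definition cscale :: "('a::real_normed_vector \<Rightarrow> 'a) \<Rightarrow> complex \<Rightarrow> 'a \<Rightarrow> 'a" where
  "cscale I w x = Re w *\<^sub>R x + Im w *\<^sub>R I x"

abbreviation jc :: "complex \<Rightarrow> complex" where "jc \<equiv> (*) \<i>"
abbreviation jv :: "complex ^ 'n \<Rightarrow> complex ^ 'n" where "jv \<equiv> (\<lambda>x. \<i> *s x)"

text \<open>In \<open>E \<times> E\<close> the pair \<open>(x, y)\<close> stands for \<open>x + \<i>y\<close>.\<close>

definition jp :: "'a::real_normed_vector \<times> 'a \<Rightarrow> 'a \<times> 'a" where "jp W = (- snd W, fst W)"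

lemma has_derivative_D: "(f has_derivative f') (at x) \<Longrightarrow> D f x = f'"
  by (metis frechet_derivative_at)

lemma holo_D: "holo I J S f \<Longrightarrow> x \<in> S \<Longrightarrow> (f has_derivative D f x) (at x)"
  by (metis holo_def has_derivative_D)

lemma holo_D_commute: "holo I J S f \<Longrightarrow> x \<in> S \<Longrightarrow> D f x (I v) = J (D f x v)"
  by (metis holo_def has_derivative_D)

lemma holoI: "(\<And>x. x \<in> S \<Longrightarrow> (f has_derivative f' x) (at x)) \<Longrightarrow>
    (\<And>x v. x \<in> S \<Longrightarrow> f' x (I v) = J (f' x v)) \<Longrightarrow> holo I J S f"
  unfolding holo_def by blast

lemma holo_bounded_linear: "holo I J S f \<Longrightarrow> x \<in> S \<Longrightarrow> bounded_linear (D f x)"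
  using holo_D has_derivative_bounded_linear by blast

lemma holo_linear: "holo I J S f \<Longrightarrow> x \<in> S \<Longrightarrow> linear (D f x)"
  using holo_bounded_linear bounded_linear.linear by blast

lemma holo_continuous: "holo I J S f \<Longrightarrow> continuous_on S f"
  by (meson continuous_at_imp_continuous_on has_derivative_continuous holo_D)

lemma holo_subset: "holo I J S f \<Longrightarrow> T \<subseteq> S \<Longrightarrow> holo I J T f"
  unfolding holo_def by blast

lemma holo_compose:
  assumes f: "holo I J S f" and g: "holo J K T g" and sub: "f ` S \<subseteq> T"
  shows "holo I K S (\<lambda>x. g (f x))"
proof (rule holoI[where f'="\<lambda>x v. D g (f x) (D f x v)"])
  fix x v assume x: "x \<in> S"
  then have fx: "f x \<in> T" using sub by blast
  show "((\<lambda>x. g (f x)) has_derivative (\<lambda>v. D g (f x) (D f x v))) (at x)"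
    by (rule has_derivative_compose[OF holo_D[OF f x] holo_D[OF g fx]])
  show "D g (f x) (D f x (I v)) = K (D g (f x) (D f x v))"
    by (simp only: holo_D_commute[OF f x] holo_D_commute[OF g fx])
qed

lemma D_compose:
  assumes "holo J K T g" "(f has_derivative f') (at x)" "f x \<in> T"
  shows "D (\<lambda>x. g (f x)) x v = D g (f x) (f' v)"
  using has_derivative_D[OF has_derivative_compose[OF assms(2) holo_D[OF assms(1,3)]]] by simp

lemma holo_transform: "holo I J S f \<Longrightarrow> open S \<Longrightarrow> (\<And>x. x \<in> S \<Longrightarrow> f x = g x) \<Longrightarrow> holo I J S g"
  unfolding holo_def by (metis has_derivative_transform_within_open)

lemma D_cong:
  assumes "open S" "x \<in> S" "\<And>y. y \<in> S \<Longrightarrow> f y = g y"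
  shows "D f x = D g x"
proof -
  have "(f has_derivative f') (at x) \<longleftrightarrow> (g has_derivative f') (at x)" for f'
    using has_derivative_transform_within_open[of f f' x UNIV S g]
      has_derivative_transform_within_open[of g f' x UNIV S f] assms by auto
  then show ?thesis by (simp add: frechet_derivative_def)
qed

lemma complex_structure_jc [simp]: "complex_structure jc"
  by (auto simp: complex_structure_def bounded_linear_mult_right)

lemma jv_scaleR: "\<i> *s (r *\<^sub>R x) = r *\<^sub>R (\<i> *s (x :: complex ^ 'n))"
  by (simp add: vec_eq_iff)

lemma complex_structure_jv [simp]: "complex_structure (jv :: complex ^ 'n \<Rightarrow> complex ^ 'n)"
proof -
  have "linear (jv :: complex ^ 'n \<Rightarrow> complex ^ 'n)"
    by (intro linearI) (auto simp: vec_eq_iff algebra_simps)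
  then show ?thesis
    by (auto simp: complex_structure_def linear_conv_bounded_linear vec_eq_iff)
qed

lemma complex_structure_jp [simp]: "complex_structure (jp :: 'a::real_normed_vector \<times> 'a \<Rightarrow> _)"
proof -
  have "bounded_linear (\<lambda>W :: 'a \<times> 'a. (- snd W, fst W))"
    by (intro bounded_linear_Pair bounded_linear_minus bounded_linear_fst bounded_linear_snd)
  then show ?thesis
    by (simp add: complex_structure_def jp_def[abs_def])
qed

lemma complex_structure_linear: "complex_structure I \<Longrightarrow> linear I"
  unfolding complex_structure_def using bounded_linear.linear by blast

lemma complex_structure_sq: "complex_structure I \<Longrightarrow> I (I x) = - x"
  unfolding complex_structure_def by blast

lemma cscale_jc [simp]: "cscale jc w z = w * z"
  by (simp add: cscale_def complex_eq_iff)

lemma cscale_jv [simp]: "cscale jv w z = w *s z"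
  by (simp add: cscale_def vec_eq_iff complex_eq_iff)

lemma cscale_commute:
  assumes "linear f" "\<And>v. f (I v) = J (f v)"
  shows "f (cscale I w v) = cscale J w (f v)"
  using assms by (simp add: cscale_def linear_add linear_scale)

lemma cscale_mult:
  assumes "complex_structure I" shows "cscale I (a * b) x = cscale I a (cscale I b x)"
  using complex_structure_linear[OF assms] complex_structure_sq[OF assms]
  by (simp add: cscale_def linear_add linear_scale algebra_simps)

lemma cscale_i [simp]: "cscale I \<i> x = I x" by (simp add: cscale_def)

lemma bounded_bilinear_cscale:
  assumes "complex_structure I" shows "bounded_bilinear (cscale I)"
proof -
  have I: "bounded_linear I" using assms by (simp add: complex_structure_def)
  have 1: "bounded_bilinear (\<lambda>w x. Re w *\<^sub>R x)" "bounded_bilinear (\<lambda>w x. Im w *\<^sub>R I x)"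
    using bounded_bilinear.comp[OF bounded_bilinear_scaleR bounded_linear_Re bounded_linear_ident]
          bounded_bilinear.comp[OF bounded_bilinear_scaleR bounded_linear_Im I] by auto
  obtain K where K: "\<And>a b. norm (Re a *\<^sub>R b) \<le> norm a * norm (b::'a) * K"
    using bounded_bilinear.bounded[OF 1(1)] by blast
  obtain L where L: "\<And>a b. norm (Im a *\<^sub>R I b) \<le> norm a * norm (b::'a) * L"
    using bounded_bilinear.bounded[OF 1(2)] by blast
  show ?thesis
  proof
    show "\<exists>K. \<forall>a b. norm (cscale I a b) \<le> norm a * norm b * K"
      by (rule exI[of _ "K+L"])
         (auto simp: cscale_def distrib_left intro!: order.trans[OF norm_triangle_ineq] add_mono K L)
  qed (use bounded_linear.linear[OF I] in \<open>auto simp: cscale_def linear_add linear_scale algebra_simps\<close>)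
qed

lemma holo_cscale_line:
  assumes "complex_structure I"
  shows "((\<lambda>w. x + cscale I w v) has_derivative (\<lambda>w. cscale I w v)) (at w)"
  using has_derivative_add[OF has_derivative_const[of x]
      bounded_linear_imp_has_derivative[OF bounded_bilinear.bounded_linear_left[OF bounded_bilinear_cscale[OF assms]]]]
  by simp

lemma line_has_field_derivative:
  assumes I: "complex_structure I" and f: "holo I jc S f" and x: "x + cscale I w v \<in> S"
  shows "((\<lambda>w. f (x + cscale I w v)) has_field_derivative D f (x + cscale I w v) v) (at w)"
proof -
  have "((\<lambda>w. f (x + cscale I w v)) has_derivative (\<lambda>h. D f (x + cscale I w v) (cscale I h v))) (at w)"
    using has_derivative_compose[OF holo_cscale_line[OF I] holo_D[OF f x]] .
  moreover have "(\<lambda>h. D f (x + cscale I w v) (cscale I h v)) = (*) (D f (x + cscale I w v) v)"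
    using cscale_commute[OF holo_linear[OF f x], of I jc] holo_D_commute[OF f x]
    by (simp add: fun_eq_iff mult.commute)
  ultimately show ?thesis unfolding has_field_derivative_def by metis
qed

lemma line_holomorphic:
  assumes I: "complex_structure I" and f: "holo I jc S f" and "\<And>w. w \<in> T \<Longrightarrow> x + cscale I w v \<in> S"
  shows "(\<lambda>w. f (x + cscale I w v)) holomorphic_on T"
  unfolding holomorphic_on_def field_differentiable_def
  by (intro ballI exI, rule has_field_derivative_at_within, rule line_has_field_derivative[OF I f assms(3)])

lemma line_disc_subset:
  assumes I: "complex_structure I" and "\<rho> > 0"
  obtains r where "r > 0" "\<And>w. norm w \<le> r \<Longrightarrow> norm (cscale I w v) < \<rho>"
proof -
  obtain K where K: "K > 0" "\<And>a b. norm (cscale I a b) \<le> norm a * norm b * K"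
    using bounded_bilinear.pos_bounded[OF bounded_bilinear_cscale[OF I]] by blast
  \<comment> \<open>the summand 1 keeps the denominator positive for v = 0\<close>
  define r where "r = \<rho> / (2 * (norm v * K + 1))"
  have pos: "norm v * K + 1 > 0" using K(1) by (simp add: add_nonneg_pos)
  show thesis
  proof
    show "r > 0" using pos assms by (simp add: r_def)
    fix w :: complex assume w: "norm w \<le> r"
    have "norm (cscale I w v) \<le> norm w * (norm v * K)" using K(2)[of w v] by (simp add: mult.assoc)
    also have "\<dots> \<le> r * (norm v * K + 1)"
      using w K(1) by (intro mult_mono) (auto intro: order.trans[OF norm_ge_zero])
    also have "\<dots> = \<rho> / 2"
    proof -
      have "\<rho> / (2 * y) * y = \<rho> / 2" if "y > 0" for y :: real using that by simp
      then show ?thesis unfolding r_def using pos by blast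
    qed
    finally show "norm (cscale I w v) < \<rho>" using assms by linarith
  qed
qed

text \<open>Cauchy's formula along the complex line through \<open>x\<close> in direction \<open>v\<close>. It expresses a derivative
  through values, and so carries continuity and holomorphy over to derivatives.\<close>

lemma derivative_Cauchy_integral:
  assumes I: "complex_structure I" and f: "holo I jc S f" and r: "r > 0"
    and sub: "\<And>w. norm w \<le> r \<Longrightarrow> x + cscale I w v \<in> S"
  shows "D f x v = integral {0..1} (\<lambda>t. f (x + cscale I (r * exp (2 * of_real pi * \<i> * of_real t)) v)
                                        / (r * exp (2 * of_real pi * \<i> * of_real t)))"
proof -
  let ?h = "\<lambda>w. f (x + cscale I w v)"
  let ?e = "\<lambda>t. r * exp (2 * of_real pi * \<i> * of_real t)"
  have hol: "?h holomorphic_on cball 0 r"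
    by (rule line_holomorphic[OF I f]) (use sub in auto)
  have x: "x + cscale I 0 v \<in> S" using sub[of 0] r by simp
  have "deriv ?h 0 = D f x v"
    using DERIV_imp_deriv[OF line_has_field_derivative[OF I f x]] by (simp add: cscale_def)
  moreover have "contour_integral (circlepath 0 r) (\<lambda>u. ?h u / (u - 0)^2) = (2 * pi * \<i>) * deriv ?h 0"
    by (rule Cauchy_contour_integral_circlepath_2)
       (use hol r in \<open>auto intro: holomorphic_on_imp_continuous_on holomorphic_on_subset\<close>)
  moreover have "contour_integral (circlepath 0 r) (\<lambda>u. ?h u / (u - 0)^2)
       = integral {0..1} (\<lambda>t. (2 * pi * \<i>) * (?h (?e t) / ?e t))"
    unfolding contour_integral_integral
  proof (rule integral_cong)
    fix t :: real assume t: "t \<in> {0..1}"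
    have "?e t \<noteq> 0" using r by simp
    moreover have "circlepath 0 r t = ?e t"
      by (simp add: circlepath)
    moreover have "vector_derivative (circlepath 0 r) (at t) = 2 * pi * \<i> * ?e t"
      by (simp add: vector_derivative_circlepath)
    ultimately show "?h (circlepath 0 r t) / (circlepath 0 r t - 0)\<^sup>2 *
          vector_derivative (circlepath 0 r) (at t) = (2 * pi * \<i>) * (?h (?e t) / ?e t)"
      by (simp add: field_simps power2_eq_square)
  qed
  moreover have "integral {0..1} (\<lambda>t. (2 * pi * \<i>) * (?h (?e t) / ?e t))
      = (2 * pi * \<i>) * integral {0..1} (\<lambda>t. ?h (?e t) / ?e t)"
    by (rule integral_mult_right)
  ultimately have "(2 * pi * \<i>) * D f x v = (2 * pi * \<i>) * integral {0..1} (\<lambda>t. ?h (?e t) / ?e t)"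
    by (simp only:)
  moreover have "2 * pi * \<i> \<noteq> 0" by simp
  ultimately show ?thesis using mult_left_cancel by blast
qed

lemma continuous_on_Cauchy_integrand:
  assumes I: "complex_structure I" and g: "continuous_on S g" and r: "r > 0"
    and sub: "\<And>x w. x \<in> U \<Longrightarrow> norm w \<le> r \<Longrightarrow> x + cscale I w v \<in> S"
  shows "continuous_on (U \<times> cbox 0 1)
     (\<lambda>(x, t). g (x + cscale I (r * exp (2 * of_real pi * \<i> * of_real t)) v)
          / (r * exp (2 * of_real pi * \<i> * of_real t)) :: complex)"
proof -
  have cscale: "continuous_on A (\<lambda>z. cscale I (h z) v)" if "continuous_on A h" for A and h :: "_ \<Rightarrow> complex"
    using bounded_linear.continuous_on[OF bounded_bilinear.bounded_linear_left[OF bounded_bilinear_cscale[OF I]] that] .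
  show ?thesis
    unfolding split_beta
    by (intro continuous_intros continuous_on_compose2[OF g] cscale)
       (use r sub in \<open>auto simp: norm_mult\<close>)
qed

text \<open>With a radius that is the same for all \<open>x\<close> near \<open>x0\<close>, the integral in Cauchy's formula can be
  differentiated in \<open>x\<close>.\<close>

lemma Cauchy_discs:
  assumes I: "complex_structure I" and S: "open S" and x0: "x0 \<in> S"
  obtains \<rho> r where "\<rho> > 0" "r > 0"
    "\<And>x w. x \<in> ball x0 \<rho> \<Longrightarrow> norm w \<le> r \<Longrightarrow> x + cscale I w v \<in> S"
proof -
  obtain e where e: "e > 0" "ball x0 e \<subseteq> S"
    using S x0 open_contains_ball by blast
  obtain r where r: "r > 0" "\<And>w. norm w \<le> r \<Longrightarrow> norm (cscale I w v) < e/2"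
    using line_disc_subset[OF I, of "e/2" v] e(1) half_gt_zero by blast
  have "x + cscale I w v \<in> S" if "x \<in> ball x0 (e/2)" "norm w \<le> r" for x w
  proof -
    have "dist x0 (x + cscale I w v) \<le> dist x0 x + dist x (x + cscale I w v)"
      by (rule dist_triangle)
    moreover have "dist x (x + cscale I w v) = norm (cscale I w v)" by (simp add: dist_norm)
    ultimately have "dist x0 (x + cscale I w v) < e" using that r(2)[of w] by simp
    with e show ?thesis by (simp add: subset_eq)
  qed
  with e r show thesis using that half_gt_zero by blast
qed

lemma holo_derivative_continuous:
  assumes I: "complex_structure I" and S: "open S" and f: "holo I jc S f"
  shows "continuous_on S (\<lambda>x. D f x v)"
proof (rule continuous_at_imp_continuous_on, rule ballI)
  fix x0 assume x0: "x0 \<in> S"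
  obtain \<rho> r where \<rho>: "\<rho> > 0" and r: "r > 0"
    and sub: "\<And>x w. x \<in> ball x0 \<rho> \<Longrightarrow> norm w \<le> r \<Longrightarrow> x + cscale I w v \<in> S"
    using Cauchy_discs[OF I S x0] by blast
  have "continuous_on (ball x0 \<rho>) (\<lambda>x. integral (cbox 0 1) (\<lambda>t. f (x + cscale I (r * exp (2 * of_real pi * \<i> * of_real t)) v)
                                        / (r * exp (2 * of_real pi * \<i> * of_real t))))"
    by (rule integral_continuous_on_param
         continuous_on_Cauchy_integrand[OF I holo_continuous[OF f] r sub])+
  then have "continuous_on (ball x0 \<rho>) (\<lambda>x. D f x v)"
  proof (rule continuous_on_eq)
    fix x assume x: "x \<in> ball x0 \<rho>"
    show "integral (cbox 0 1) (\<lambda>t. f (x + cscale I (r * exp (2 * of_real pi * \<i> * of_real t)) v)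
                                        / (r * exp (2 * of_real pi * \<i> * of_real t))) = D f x v"
      unfolding cbox_interval by (rule derivative_Cauchy_integral[OF I f r sub[OF x], symmetric])
  qed
  then show "continuous (at x0) (\<lambda>x. D f x v)"
    using \<rho> by (simp add: continuous_on_eq_continuous_at)
qed

text \<open>The integrand of Cauchy's formula is holomorphic in \<open>x\<close>; differentiation under the integral sign keeps
  the complex linearity of its differential.\<close>

theorem holo_derivative_scalar:
  fixes f :: "'a::euclidean_space \<Rightarrow> complex"
  assumes I: "complex_structure I" and S: "open S" and f: "holo I jc S f"
  shows "holo I jc S (\<lambda>x. D f x v)"
  unfolding holo_def
proof
  fix x0 assume x0: "x0 \<in> S"
  obtain \<rho> r where \<rho>: "\<rho> > 0" and r: "r > 0"
    and sub: "\<And>x w. x \<in> ball x0 \<rho> \<Longrightarrow> norm w \<le> r \<Longrightarrow> x + cscale I w v \<in> S"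
    using Cauchy_discs[OF I S x0] by blast
  define e where "e = (\<lambda>t. r * exp (2 * of_real pi * \<i> * of_real t))"
  have e: "norm (e t) = r" "e t \<noteq> 0" for t using r by (auto simp: e_def norm_mult)
  have esub: "x + cscale I (e t) v \<in> S" if "x \<in> ball x0 \<rho>" for x t
    using sub[OF that, of "e t"] e(1) by simp
  define g where "g = (\<lambda>x t. f (x + cscale I (e t) v) / e t)"
  define g' where "g' = (\<lambda>x t. Blinfun (\<lambda>h. D f (x + cscale I (e t) v) h / e t))"
  have bl: "bounded_linear (\<lambda>h. D f (x + cscale I (e t) v) h / e t)" if "x \<in> ball x0 \<rho>" for x t
    by (rule bounded_linear_compose[OF bounded_linear_divide holo_bounded_linear[OF f esub[OF that]]])
  have g': "blinfun_apply (g' x t) = (\<lambda>h. D f (x + cscale I (e t) v) h / e t)" if "x \<in> ball x0 \<rho>" for x t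
    using bl[OF that] by (simp add: g'_def bounded_linear_Blinfun_apply)
  have contg': "continuous_on (ball x0 \<rho> \<times> cbox 0 1) (\<lambda>(x, t). g' x t)"
  proof (rule continuous_on_blinfun_componentwise)
    fix b :: 'a assume "b \<in> Basis"
    have "continuous_on (ball x0 \<rho> \<times> cbox 0 1) (\<lambda>(x, t). D f (x + cscale I (e t) v) b / e t)"
      unfolding e_def
      by (rule continuous_on_Cauchy_integrand[OF I holo_derivative_continuous[OF I S f] r sub])
    then show "continuous_on (ball x0 \<rho> \<times> cbox 0 1) (\<lambda>z. (case z of (x, t) \<Rightarrow> g' x t) b)"
      by (rule continuous_on_eq) (auto simp: g')
  qed
  have "((\<lambda>x. integral (cbox 0 1) (g x)) has_derivative integral (cbox 0 1) (g' x0)) (at x0 within ball x0 \<rho>)"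
  proof (rule leibniz_rule)
    fix x and t :: real assume x: "x \<in> ball x0 \<rho>"
    have 1: "((\<lambda>x. x + cscale I (e t) v) has_derivative (\<lambda>h. h)) (at x within ball x0 \<rho>)"
      by (rule has_derivative_add_const[OF has_derivative_ident])
    have "((\<lambda>x. f (x + cscale I (e t) v)) has_derivative (\<lambda>h. D f (x + cscale I (e t) v) h)) (at x within ball x0 \<rho>)"
      using has_derivative_compose[OF 1 holo_D[OF f esub[OF x]]] .
    from bounded_linear.has_derivative[OF bounded_linear_divide this]
    show "((\<lambda>x. g x t) has_derivative blinfun_apply (g' x t)) (at x within ball x0 \<rho>)"
      unfolding g'[OF x] g_def .
  next
    have contg: "continuous_on (ball x0 \<rho> \<times> cbox 0 1) (\<lambda>(x, t). g x t)"
      unfolding g_def e_def by (rule continuous_on_Cauchy_integrand[OF I holo_continuous[OF f] r sub])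
    show "g x integrable_on cbox 0 1" if x: "x \<in> ball x0 \<rho>" for x
    proof (rule integrable_continuous)
      have "continuous_on (cbox 0 1) (\<lambda>t::real. (x, t))" by (intro continuous_intros)
      from continuous_on_compose2[OF contg this] x
      show "continuous_on (cbox 0 1) (g x)" by (auto simp: image_subset_iff)
    qed
  next
    show "continuous_on (ball x0 \<rho> \<times> cbox 0 1) (\<lambda>(x, t). g' x t)" by (rule contg')
  qed (use \<rho> in auto)
  then have 1: "((\<lambda>x. integral (cbox 0 1) (g x)) has_derivative integral (cbox 0 1) (g' x0)) (at x0)"
    using at_within_open[of x0 "ball x0 \<rho>"] \<rho> by (metis centre_in_ball open_ball)
  have d1: "((\<lambda>x. D f x v) has_derivative integral (cbox 0 1) (g' x0)) (at x0)"
  proof (rule has_derivative_transform_within_open[OF 1, of "ball x0 \<rho>"])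
    show "integral (cbox 0 1) (g x) = D f x v" if x: "x \<in> ball x0 \<rho>" for x
      unfolding g_def e_def cbox_interval
      by (rule derivative_Cauchy_integral[OF I f r sub[OF x], symmetric])
  qed (use \<rho> in auto)
  have d2: "integral (cbox 0 1) (g' x0) (I h) = jc (integral (cbox 0 1) (g' x0) h)" for h
  proof -
    have x0': "x0 \<in> ball x0 \<rho>" using \<rho> by simp
    have "continuous_on (cbox 0 1) (g' x0)"
    proof -
      have "continuous_on (cbox 0 1) (\<lambda>t::real. (x0, t))" by (intro continuous_intros)
      from continuous_on_compose2[OF contg' this] \<rho>
      show ?thesis by (auto simp: image_subset_iff)
    qed
    then have int: "g' x0 integrable_on cbox 0 1" by (rule integrable_continuous)
    have "integral (cbox 0 1) (g' x0) (I h) = integral (cbox 0 1) (\<lambda>t. g' x0 t (I h))"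
      by (rule blinfun_apply_integral[OF int])
    also have "\<dots> = integral (cbox 0 1) (\<lambda>t. \<i> * g' x0 t h)"
    proof (rule integral_cong)
      fix t
      show "g' x0 t (I h) = \<i> * g' x0 t h"
        unfolding g'[OF x0'] using holo_D_commute[OF f esub[OF x0'], of t h] by simp
    qed
    also have "\<dots> = \<i> * integral (cbox 0 1) (g' x0) h"
      by (simp add: blinfun_apply_integral[OF int, unfolded cbox_interval])
    finally show ?thesis .
  qed
  show "\<exists>f'. ((\<lambda>x. D f x v) has_derivative f') (at x0) \<and> (\<forall>v. f' (I v) = jc (f' v))"
    by (intro exI conjI allI, rule d1, rule d2)
qed

section \<open>Operations on holomorphic maps\<close>

lemma holo_const [intro]: "linear J \<Longrightarrow> holo I J S (\<lambda>_. c)"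
  by (rule holoI[where f'="\<lambda>_ _. 0"]) (auto simp: linear_0)

lemma holo_linear_map: "linear f \<Longrightarrow> (\<And>v. f (I v) = J (f v)) \<Longrightarrow> holo I J S (f :: 'a::euclidean_space \<Rightarrow> _)"
  by (rule holoI[where f'="\<lambda>_. f"]) (auto simp: linear_imp_has_derivative)

lemma holo_ident: "holo I I S (\<lambda>x. x)"
  by (rule holoI[where f'="\<lambda>_ v. v"]) auto

lemma holo_add:
  assumes "linear J" and f: "holo I J S f" and g: "holo I J S g"
  shows "holo I J S (\<lambda>x. f x + g x)"
proof (rule holoI[where f'="\<lambda>x v. D f x v + D g x v"])
  fix x v assume x: "x \<in> S"
  show "((\<lambda>x. f x + g x) has_derivative (\<lambda>v. D f x v + D g x v)) (at x)"
    by (rule has_derivative_add[OF holo_D[OF f x] holo_D[OF g x]])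
  show "D f x (I v) + D g x (I v) = J (D f x v + D g x v)"
    by (simp only: holo_D_commute[OF f x] holo_D_commute[OF g x] linear_add[OF assms(1)])
qed

lemma holo_minus:
  assumes "linear J" and f: "holo I J S f"
  shows "holo I J S (\<lambda>x. - f x)"
proof (rule holoI[where f'="\<lambda>x v. - D f x v"])
  fix x v assume x: "x \<in> S"
  show "((\<lambda>x. - f x) has_derivative (\<lambda>v. - D f x v)) (at x)"
    by (rule has_derivative_minus[OF holo_D[OF f x]])
  show "- D f x (I v) = J (- D f x v)"
    by (simp only: holo_D_commute[OF f x] linear_neg[OF assms(1)])
qed

lemma holo_diff:
  assumes "linear J" "holo I J S f" "holo I J S g"
  shows "holo I J S (\<lambda>x. f x - g x)"
  using holo_add[OF assms(1,2) holo_minus[OF assms(1,3)]] by simp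

lemma holo_sum:
  assumes "linear J" "\<And>k. k \<in> K \<Longrightarrow> holo I J S (f k)"
  shows "holo I J S (\<lambda>x. \<Sum>k\<in>K. f k x)"
proof (cases "finite K")
  case True
  then show ?thesis using assms(2)
    by (induction K rule: finite_induct) (auto intro: holo_const holo_add assms(1))
qed (auto intro: holo_const assms(1))

lemma linear_jc [simp]: "linear jc" by (rule complex_structure_linear) simp
lemma linear_jv [simp]: "linear (jv :: complex ^ 'n \<Rightarrow> _)" by (rule complex_structure_linear) simp
lemma linear_jp [simp]: "linear jp" by (rule complex_structure_linear) simp

lemma holo_cscale:
  assumes J: "complex_structure J" and c: "holo I jc S c" and g: "holo I J S g"
  shows "holo I J S (\<lambda>x. cscale J (c x) (g x))"
proof (rule holoI)
  fix x v assume x: "x \<in> S"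
  interpret bounded_bilinear "cscale J" by (rule bounded_bilinear_cscale[OF J])
  show "((\<lambda>x. cscale J (c x) (g x)) has_derivative (\<lambda>v. cscale J (c x) (D g x v) + cscale J (D c x v) (g x))) (at x)"
    by (rule FDERIV[OF holo_D[OF c x] holo_D[OF g x]])
  have 1: "J (cscale J w y) = cscale J w (J y)" for w y
    by (metis cscale_mult[OF J] cscale_i mult.commute)
  show "cscale J (c x) (D g x (I v)) + cscale J (D c x (I v)) (g x)
      = J (cscale J (c x) (D g x v) + cscale J (D c x v) (g x))"
    by (simp add: holo_D_commute[OF c x] holo_D_commute[OF g x] cscale_mult[OF J] 1
        linear_add[OF complex_structure_linear[OF J]])
qed

lemma holo_mult: "holo I jc S f \<Longrightarrow> holo I jc S g \<Longrightarrow> holo I jc S (\<lambda>x. f x * g x)"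
  using holo_cscale[OF complex_structure_jc, of I S f g] by simp

lemma holo_prod: "(\<And>k. k \<in> K \<Longrightarrow> holo I jc S (f k)) \<Longrightarrow> holo I jc S (\<lambda>x. \<Prod>k\<in>K. f k x)"
  by (induction K rule: infinite_finite_induct) (auto intro: holo_const holo_mult)

lemma holo_power: "holo I jc S f \<Longrightarrow> holo I jc S (\<lambda>x. f x ^ n)"
  by (induction n) (auto intro: holo_const holo_mult)

lemma holo_inverse:
  assumes f: "holo I jc S f" and "\<And>x. x \<in> S \<Longrightarrow> f x \<noteq> 0"
  shows "holo I jc S (\<lambda>x. inverse (f x))"
proof (rule holoI)
  fix x v assume x: "x \<in> S"
  show "((\<lambda>x. inverse (f x)) has_derivative (\<lambda>v. - (inverse (f x) * D f x v * inverse (f x)))) (at x)"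
    by (rule Deriv.has_derivative_inverse[OF assms(2)[OF x] holo_D[OF f x]])
  show "- (inverse (f x) * D f x (I v) * inverse (f x)) = \<i> * - (inverse (f x) * D f x v * inverse (f x))"
    by (simp add: holo_D_commute[OF f x])
qed

text \<open>The complex linear functional whose real part is the \<open>b\<close>-coordinate; such functionals reduce
  vector valued maps to scalar ones.\<close>

definition complex_coord :: "('a::euclidean_space \<Rightarrow> 'a) \<Rightarrow> 'a \<Rightarrow> 'a \<Rightarrow> complex" where
  "complex_coord J b y = Complex (y \<bullet> b) (- (J y \<bullet> b))"

lemma complex_coord_commute: "complex_structure J \<Longrightarrow> complex_coord J b (J y) = \<i> * complex_coord J b y"
  by (simp add: complex_coord_def complex_eq_iff complex_structure_sq)

lemma linear_complex_coord: "complex_structure J \<Longrightarrow> linear (complex_coord J b)"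
  using complex_structure_linear[of J]
  by (intro linearI) (auto simp: complex_coord_def complex_eq_iff linear_add linear_scale algebra_simps)

lemma Re_complex_coord [simp]: "Re (complex_coord J b y) = y \<bullet> b" by (simp add: complex_coord_def)

lemma holo_complex_coord:
  assumes J: "complex_structure J" and f: "holo I J S f"
  shows "holo I jc S (\<lambda>x. complex_coord J b (f x))"
proof -
  have "holo J jc UNIV (complex_coord J b)"
    by (rule holo_linear_map) (simp_all add: linear_complex_coord[OF J] complex_coord_commute[OF J])
  from holo_compose[OF f this] show ?thesis by simp
qed

lemma D_complex_coord:
  assumes J: "complex_structure J" and f: "(f has_derivative f') (at x)"
  shows "D (\<lambda>x. complex_coord J b (f x)) x v = complex_coord J b (f' v)"
  using has_derivative_D[OF has_derivative_compose[OF f linear_imp_has_derivative[OF linear_complex_coord[OF J]]]]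
  by simp

lemma holo_of_complex_coord:
  fixes f :: "'a::real_normed_vector \<Rightarrow> 'b::euclidean_space"
  assumes J: "complex_structure J" and f: "\<And>b. b \<in> Basis \<Longrightarrow> holo I jc S (\<lambda>x. complex_coord J b (f x))"
  shows "holo I J S f"
proof (rule holoI)
  fix x v assume x: "x \<in> S"
  define f' where "f' = (\<lambda>v. \<Sum>b\<in>Basis. Re (D (\<lambda>x. complex_coord J b (f x)) x v) *\<^sub>R b)"
  have "((\<lambda>x. f x \<bullet> b) has_derivative (\<lambda>v. f' v \<bullet> b)) (at x)" if b: "b \<in> Basis" for b
  proof -
    have "((\<lambda>x. Re (complex_coord J b (f x))) has_derivative (\<lambda>v. Re (D (\<lambda>x. complex_coord J b (f x)) x v))) (at x)"
      by (rule bounded_linear.has_derivative[OF bounded_linear_Re holo_D[OF f[OF b] x]])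
    then show ?thesis using b by (simp add: f'_def inner_sum_left inner_Basis if_distrib cong: if_cong)
  qed
  then show d: "(f has_derivative f') (at x)"
    using has_derivative_componentwise_within by blast
  show "f' (I v) = J (f' v)"
  proof (rule euclidean_eqI)
    fix b :: 'b assume b: "b \<in> Basis"
    have 1: "D (\<lambda>x. complex_coord J b (f x)) x v = complex_coord J b (f' v)" for v by (rule D_complex_coord[OF J d])
    have "f' (I v) \<bullet> b = Re (complex_coord J b (f' (I v)))" by simp
    also have "complex_coord J b (f' (I v)) = \<i> * complex_coord J b (f' v)"
      using holo_D_commute[OF f[OF b] x, of v] unfolding 1 .
    also have "Re \<dots> = J (f' v) \<bullet> b" by (simp add: complex_coord_def)
    finally show "f' (I v) \<bullet> b = J (f' v) \<bullet> b" .
  qed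
qed

theorem holo_derivative:
  fixes f :: "'a::euclidean_space \<Rightarrow> 'b::euclidean_space"
  assumes I: "complex_structure I" and J: "complex_structure J" and S: "open S" and f: "holo I J S f"
  shows "holo I J S (\<lambda>x. D f x v)"
proof (rule holo_of_complex_coord[OF J])
  fix b :: 'b
  show "holo I jc S (\<lambda>x. complex_coord J b (D f x v))"
    by (rule holo_transform[OF holo_derivative_scalar[OF I S holo_complex_coord[OF J f], of b v] S])
       (rule D_complex_coord[OF J holo_D[OF f]])
qed

text \<open>Componentwise holomorphy, assembled by the embeddings of the coordinate axes.\<close>

lemma holo_vec_iff:
  fixes f :: "'a::real_normed_vector \<Rightarrow> complex ^ 'm"
  shows "holo I jv S f \<longleftrightarrow> (\<forall>k. holo I jc S (\<lambda>x. f x $ k))"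
proof
  assume f: "holo I jv S f"
  have "linear (\<lambda>y::complex ^ 'm. y $ k)" for k
    by (rule linearI) auto
  then have "holo jv jc UNIV (\<lambda>y::complex ^ 'm. y $ k)" for k
    by (rule holo_linear_map) simp
  from holo_compose[OF f this] show "\<forall>k. holo I jc S (\<lambda>x. f x $ k)" by simp
next
  assume f: "\<forall>k. holo I jc S (\<lambda>x. f x $ k)"
  have 1: "linear (\<lambda>z::complex. axis k z :: complex ^ 'm)" for k
    by (rule linearI) (auto simp: vec_eq_iff axis_def)
  have "holo jc jv UNIV (\<lambda>z::complex. axis k z :: complex ^ 'm)" for k
    by (rule holo_linear_map[OF 1]) (auto simp: vec_eq_iff axis_def)
  from holo_compose[OF f[rule_format] this]
  have "holo I jv S (\<lambda>x. axis k (f x $ k) :: complex ^ 'm)" for k by simp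
  then have "holo I jv S (\<lambda>x. \<Sum>k\<in>UNIV. axis k (f x $ k) :: complex ^ 'm)"
    by (intro holo_sum) auto
  moreover have "(\<lambda>x. \<Sum>k\<in>UNIV. axis k (f x $ k)) = f"
    by (auto simp: fun_eq_iff vec_eq_iff axis_def if_distrib cong: if_cong)
  ultimately show "holo I jv S f" by simp
qed

section \<open>Inverse functions, uniqueness and series\<close>

lemma inverse_function_C1:
  fixes f :: "'a::euclidean_space \<Rightarrow> 'a"
  assumes U: "open U" and x0: "x0 \<in> U"
    and f: "\<And>x. x \<in> U \<Longrightarrow> (f has_derivative D f x) (at x)"
    and cont: "\<And>v. continuous_on U (\<lambda>x. D f x v)" and id: "\<And>v. D f x0 v = v"
  obtains U' V g where "open U'" "U' \<subseteq> U" "x0 \<in> U'" "open V" "f x0 \<in> V" "homeomorphism U' V f g"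
    "\<And>y. y \<in> V \<Longrightarrow> (g has_derivative D g y) (at y)"
    "\<And>y v. y \<in> V \<Longrightarrow> D f (g y) (D g y v) = v"
    "\<And>y v. y \<in> V \<Longrightarrow> D g y (D f (g y) v) = v"
proof -
  define f' where "f' = (\<lambda>x. Blinfun (D f x))"
  have f': "blinfun_apply (f' x) = D f x" if "x \<in> U" for x
    unfolding f'_def by (rule bounded_linear_Blinfun_apply[OF has_derivative_bounded_linear[OF f[OF that]]])
  have 1: "(f has_derivative blinfun_apply (f' x)) (at x)" if "x \<in> U" for x
    unfolding f'[OF that] by (rule f[OF that])
  have 2: "continuous_on U f'"
  proof (rule continuous_on_blinfun_componentwise)
    show "continuous_on U (\<lambda>x. f' x b)" for b
      by (rule continuous_on_eq[OF cont[of b]]) (simp add: f')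
  qed
  have 3: "id_blinfun o\<^sub>L f' x0 = id_blinfun"
    by (rule blinfun_eqI) (simp add: f'[OF x0] id)
  obtain U' V g g' where *: "open U'" "U' \<subseteq> U" "x0 \<in> U'" "open V" "f x0 \<in> V" "homeomorphism U' V f g"
    and g: "\<And>y. y \<in> V \<Longrightarrow> (g has_derivative (g' y)) (at y)"
    and g': "\<And>y. y \<in> V \<Longrightarrow> g' y = inv (blinfun_apply (f' (g y)))"
    and bij: "\<And>y. y \<in> V \<Longrightarrow> bij (blinfun_apply (f' (g y)))"
    using inverse_function_theorem[OF U 1 2 x0 3] by metis
  have Dg: "D g y = inv (D f (g y))" and b: "bij (D f (g y))" if "y \<in> V" for y
  proof -
    have "g y \<in> U" using * that by (auto simp: homeomorphism_def)
    then show "D g y = inv (D f (g y))" "bij (D f (g y))"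
      using has_derivative_D[OF g[OF that]] g'[OF that] bij[OF that] f' by auto
  qed
  show thesis
  proof (rule that[OF *])
    fix y v assume y: "y \<in> V"
    show "(g has_derivative D g y) (at y)" using g[OF y] has_derivative_D[OF g[OF y]] by simp
    show "D f (g y) (D g y v) = v" unfolding Dg[OF y] using b[OF y] by (simp add: bij_is_surj surj_f_inv_f)
    show "D g y (D f (g y) v) = v" unfolding Dg[OF y] using b[OF y] by (simp add: bij_is_inj)
  qed
qed

lemma holo_D_continuous:
  fixes f :: "'a::euclidean_space \<Rightarrow> 'b::euclidean_space"
  assumes "complex_structure I" "complex_structure J" "open S" "holo I J S f"
  shows "continuous_on S (\<lambda>x. D f x v)"
  by (rule holo_continuous[OF holo_derivative[OF assms]])

text \<open>The inverse function theorem of real analysis also inverts holomorphic maps: the inverse of a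
  complex linear differential is complex linear.\<close>

theorem holo_inverse_function:
  fixes f :: "'a::euclidean_space \<Rightarrow> 'a"
  assumes I: "complex_structure I" and U: "open U" and x0: "x0 \<in> U"
    and f: "holo I I U f" and id: "\<And>v. D f x0 v = v"
  obtains U' V g where "open U'" "U' \<subseteq> U" "x0 \<in> U'" "open V" "f x0 \<in> V" "homeomorphism U' V f g"
    "holo I I V g"
    "\<And>y v. y \<in> V \<Longrightarrow> D f (g y) (D g y v) = v"
    "\<And>y v. y \<in> V \<Longrightarrow> D g y (D f (g y) v) = v"
proof -
  obtain U' V g where *: "open U'" "U' \<subseteq> U" "x0 \<in> U'" "open V" "f x0 \<in> V" "homeomorphism U' V f g"
    and g: "\<And>y. y \<in> V \<Longrightarrow> (g has_derivative D g y) (at y)"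
    and fg: "\<And>y v. y \<in> V \<Longrightarrow> D f (g y) (D g y v) = v"
    and gf: "\<And>y v. y \<in> V \<Longrightarrow> D g y (D f (g y) v) = v"
    using inverse_function_C1[OF U x0 holo_D[OF f] holo_D_continuous[OF I I U f] id] by metis
  have "holo I I V g"
  proof (rule holoI[OF g])
    fix y v assume y: "y \<in> V"
    then have gy: "g y \<in> U" using * by (auto simp: homeomorphism_def)
    have "D g y (I v) = D g y (I (D f (g y) (D g y v)))" by (simp only: fg[OF y])
    also have "\<dots> = D g y (D f (g y) (I (D g y v)))" by (simp only: holo_D_commute[OF f gy])
    finally show "D g y (I v) = I (D g y v)" by (simp only: gf[OF y])
  qed
  then show thesis using that * fg gf by blast
qed

definition rvec :: "real ^ 'm \<Rightarrow> complex ^ 'm" where "rvec t = (\<chi> j. of_real (t $ j))"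

lemma linear_rvec: "linear rvec"
  by (rule linearI) (auto simp: rvec_def vec_eq_iff complex_eq_iff)

lemma norm_rvec [simp]: "norm (rvec t) = norm t"
  by (simp add: rvec_def norm_vec_def L2_set_def)

definition Revec :: "complex ^ 'm \<Rightarrow> real ^ 'm" where "Revec z = (\<chi> j. Re (z $ j))"
definition Imvec :: "complex ^ 'm \<Rightarrow> real ^ 'm" where "Imvec z = (\<chi> j. Im (z $ j))"

lemma rvec_Re_Im: "rvec (Revec z) + \<i> *s rvec (Imvec z) = z"
  by (simp add: rvec_def Revec_def Imvec_def vec_eq_iff complex_eq_iff)

lemma norm_Revec_le: "norm (Revec z) \<le> norm z"
  unfolding norm_vec_def by (intro L2_set_mono) (auto simp: Revec_def abs_Re_le_cmod)

lemma linear_Revec: "linear Revec" and linear_Imvec: "linear Imvec"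
  by (auto intro!: linearI simp: Revec_def Imvec_def vec_eq_iff)

text \<open>Real points are a set of uniqueness: a complex point \<open>x + \<i>y\<close> lies on the complex line through
  the real points \<open>x + sy\<close>.\<close>

theorem holo_identity:
  fixes f :: "complex ^ 'm \<Rightarrow> complex"
  assumes f: "holo jv jc (ball 0 r) f" and zero: "\<And>t. norm t < r \<Longrightarrow> f (rvec t) = 0" and z: "norm z < r"
  shows "f z = 0"
proof -
  define x where "x = rvec (Revec z)"
  define y where "y = rvec (Imvec z)"
  define T where "T = {w. x + cscale jv w y \<in> ball 0 r}"
  have cont: "continuous_on UNIV (\<lambda>w. x + cscale jv w y)"
    by (intro continuous_intros linear_continuous_on
        bounded_bilinear.bounded_linear_left[OF bounded_bilinear_cscale]) simp
  have T: "open T"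
    unfolding T_def using open_vimage[OF open_ball cont, of 0 r] by (simp only: vimage_def)
  have "convex T"
  proof (rule convexI)
    fix u v :: complex and a b :: real assume *: "u \<in> T" "v \<in> T" "0 \<le> a" "0 \<le> b" "a + b = 1"
    have x: "a *\<^sub>R x + b *\<^sub>R x = x" using *(5) by (metis scaleR_add_left scaleR_one)
    have "a *\<^sub>R (x + cscale jv u y) + b *\<^sub>R (x + cscale jv v y)
        = (a *\<^sub>R x + b *\<^sub>R x) + cscale jv (a *\<^sub>R u + b *\<^sub>R v) y"
      by (simp add: vec_eq_iff scaleR_add_right complex_eq_iff algebra_simps)
    then have "x + cscale jv (a *\<^sub>R u + b *\<^sub>R v) y = a *\<^sub>R (x + cscale jv u y) + b *\<^sub>R (x + cscale jv v y)"
      unfolding x by (rule sym)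
    then show "a *\<^sub>R u + b *\<^sub>R v \<in> T"
      using * convexD[OF convex_ball[of 0 r], of "x + cscale jv u y" "x + cscale jv v y" a b] by (simp add: T_def)
  qed
  then have conn: "connected T" by (rule convex_connected)
  have hol: "(\<lambda>w. f (x + cscale jv w y)) holomorphic_on T"
    by (rule line_holomorphic[OF complex_structure_jv f]) (simp add: T_def)
  have zT: "\<i> \<in> T" using z rvec_Re_Im[of z] by (simp add: T_def x_def y_def)
  have "norm x < r" using z norm_Revec_le[of z] by (simp add: x_def)
  then have 0: "0 \<in> T" by (simp add: T_def cscale_def)
  then obtain e where e: "e > 0" "ball 0 e \<subseteq> T" using T open_contains_ball by blast
  \<comment> \<open>the zeros on the real axis accumulate at 0, and T is connected and contains \<i>\<close>
  have lim: "0 islimpt (T \<inter> \<real>)"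
    unfolding islimpt_approachable
  proof (intro allI impI)
    fix d :: real assume d: "d > 0"
    define s where "s = min d e / 2"
    have s: "0 < s" "s < d" "s < e" using d e by (auto simp: s_def min_def)
    then have "of_real s \<in> T \<inter> \<real>" using e by (auto simp: subset_eq)
    then show "\<exists>w\<in>T \<inter> \<real>. w \<noteq> 0 \<and> dist w 0 < d"
      using s by (intro bexI[of _ "of_real s"]) auto
  qed
  have "f (x + cscale jv w y) = 0" if w: "w \<in> T \<inter> \<real>" for w
  proof -
    obtain s where s: "w = of_real s" using w by (auto elim: Reals_cases)
    have "x + cscale jv w y = rvec (Revec z + s *\<^sub>R Imvec z)"
      by (simp add: s x_def y_def rvec_def vec_eq_iff)
    with w zero[of "Revec z + s *\<^sub>R Imvec z"] show ?thesis
      by (simp add: T_def del: cscale_jv flip: norm_rvec)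
  qed
  from analytic_continuation[OF hol T conn _ 0 lim this zT]
  have "f (x + cscale jv \<i> y) = 0" by simp
  then show ?thesis using rvec_Re_Im[of z] by (simp add: x_def y_def)
qed

text \<open>Cauchy's inequality on the disc of radius \<open>r = e / (2 K norm v)\<close> in direction \<open>v\<close>, which lies in
  the ball of radius \<open>e\<close>.\<close>

lemma holo_derivative_bound:
  assumes I: "complex_structure I" and x: "ball x e \<subseteq> S" and e: "e > 0" and f: "holo I jc S f"
    and M: "\<And>y. y \<in> S \<Longrightarrow> norm (f y) \<le> M"
    and K: "K > 0" "\<And>a b. norm (cscale I a b) \<le> norm a * norm b * K"
  shows "norm (D f x v) \<le> 2 * K / e * norm v * M"
proof (cases "v = 0")
  case True
  have "x \<in> S" using x e by auto
  then show ?thesis using True linear_0[OF holo_linear[OF f]] by simp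
next
  case False
  define r where "r = e / (2 * K * norm v)"
  have r: "r > 0" using e K False by (simp add: r_def)
  have sub: "x + cscale I w v \<in> S" if "norm w \<le> r" for w
  proof -
    have "norm (cscale I w v) \<le> norm w * norm v * K" by (rule K(2))
    also have "\<dots> \<le> r * norm v * K" using that K(1) by (intro mult_right_mono) auto
    also have "\<dots> < e" using e K(1) False by (simp add: r_def)
    finally have "x + cscale I w v \<in> ball x e" by (simp add: dist_norm)
    then show ?thesis using x by blast
  qed
  have h: "(\<lambda>w. f (x + cscale I w v)) holomorphic_on cball 0 r"
    by (rule line_holomorphic[OF I f]) (use sub in auto)
  have "norm ((deriv ^^ 1) (\<lambda>w. f (x + cscale I w v)) 0) \<le> fact 1 * M / r ^ 1"
  proof (rule Cauchy_inequality)
    show "norm (f (x + cscale I w v)) \<le> M" if "norm (0 - w) = r" for w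
      using that by (intro M sub) simp
  qed (use h r in \<open>auto intro: holomorphic_on_imp_continuous_on holomorphic_on_subset\<close>)
  moreover have "(deriv ^^ 1) (\<lambda>w. f (x + cscale I w v)) 0 = D f x v"
    using DERIV_imp_deriv[OF line_has_field_derivative[OF I f sub[of 0]]] r by (simp add: cscale_def)
  ultimately show ?thesis using False K e by (simp add: r_def field_simps)
qed

text \<open>The bound of the derivatives makes the differentiated series uniformly convergent near every point.\<close>

theorem holo_series:
  fixes f :: "nat \<Rightarrow> 'a::euclidean_space \<Rightarrow> complex"
  assumes I: "complex_structure I" and S: "open S" and f: "\<And>n. holo I jc S (f n)"
    and M: "\<And>n x. x \<in> S \<Longrightarrow> norm (f n x) \<le> M n" and sM: "summable M"
  shows "holo I jc S (\<lambda>x. \<Sum>n. f n x)"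
  unfolding holo_def
proof
  fix x0 assume "x0 \<in> S"
  then obtain e where e: "e > 0" "ball x0 e \<subseteq> S" using S open_contains_ball by blast
  obtain K where K: "K > 0" "\<And>a b. norm (cscale I a b) \<le> norm a * norm b * K"
    using bounded_bilinear.pos_bounded[OF bounded_bilinear_cscale[OF I]] by blast
  define C where "C = 2 * K / (e/2)"
  have C: "C > 0" using K e by (simp add: C_def)
  define B where "B = ball x0 (e/2)"
  have B: "open B" "convex B" "x0 \<in> B" "B \<subseteq> S" using e by (auto simp: B_def)
  have bound: "norm (D (f n) x h) \<le> C * norm h * M n" if "x \<in> B" for n x h
  proof -
    have "ball x (e/2) \<subseteq> S"
    proof
      fix y assume "y \<in> ball x (e/2)"
      with that dist_triangle[of x0 y x] have "dist x0 y < e" by (simp add: B_def)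
      with e show "y \<in> S" by (simp add: subset_eq)
    qed
    from holo_derivative_bound[OF I this _ f M K] e show ?thesis by (simp add: C_def)
  qed
  define g where "g = (\<lambda>x h. \<Sum>n. D (f n) x h)"
  have sums: "summable (\<lambda>n. D (f n) x h)" if "x \<in> B" for x h
    by (rule summable_comparison_test[OF _ summable_mult[OF sM, of "C * norm h"]])
       (use bound[OF that] in auto)
  have tail: "norm ((\<Sum>i<n. D (f i) x h) - g x h) \<le> C * norm h * (\<Sum>i. M (i + n))" if x: "x \<in> B" for n x h
  proof -
    have sn: "summable (\<lambda>i. M (i + n))" using sM by (simp add: summable_iff_shift)
    have "g x h = (\<Sum>i. D (f (i + n)) x h) + (\<Sum>i<n. D (f i) x h)"
      unfolding g_def by (rule suminf_split_initial_segment[OF sums[OF x]])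
    then have "norm ((\<Sum>i<n. D (f i) x h) - g x h) = norm (\<Sum>i. D (f (i + n)) x h)"
      by (simp add: norm_minus_commute)
    also have "\<dots> \<le> (\<Sum>i. C * norm h * M (i + n))"
      using bound[OF x] by (intro norm_suminf_le summable_mult sn) auto
    finally show ?thesis by (simp add: suminf_mult[OF sn])
  qed
  have ev: "\<forall>\<^sub>F n in sequentially. \<forall>x\<in>B. \<forall>h. norm ((\<Sum>i<n. D (f i) x h) - g x h) \<le> \<epsilon> * norm h"
    if "\<epsilon> > 0" for \<epsilon>
  proof -
    have "(\<lambda>n. \<Sum>i. M (i + n)) \<longlonglongrightarrow> 0" by (rule suminf_exist_split2[OF sM])
    then have "\<forall>\<^sub>F n in sequentially. (\<Sum>i. M (i + n)) < \<epsilon> / C"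
      using that C by (intro order_tendstoD) auto
    then show ?thesis
    proof eventually_elim
      case (elim n)
      have "C * norm h * (\<Sum>i. M (i + n)) \<le> \<epsilon> * norm h" for h :: 'a
      proof -
        have "norm h * (C * (\<Sum>i. M (i + n))) \<le> norm h * \<epsilon>"
          using elim C by (intro mult_left_mono) (auto simp: field_simps)
        then show ?thesis by (simp add: algebra_simps)
      qed
      with tail show ?case using order_trans by blast
    qed
  qed
  have sumf: "(\<lambda>n. f n x) sums (\<Sum>n. f n x)" if "x \<in> S" for x
    using summable_comparison_test[OF _ sM, of "\<lambda>n. f n x"] M[OF that] by (auto intro: summable_sums)
  have "\<exists>F. \<forall>x\<in>B. (\<lambda>n. f n x) sums (F x) \<and> (F has_derivative g x) (at x within B)"
  proof (rule has_derivative_series[OF B(2) _ ev B(3)])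
    show "(f n has_derivative D (f n) x) (at x within B)" if "x \<in> B" for n x
      using holo_D[OF f] that B has_derivative_at_withinI by blast
    show "(\<lambda>n. f n x0) sums (\<Sum>n. f n x0)" by (rule sumf) (use B in auto)
  qed
  then obtain F where F: "\<And>x. x \<in> B \<Longrightarrow> (\<lambda>n. f n x) sums (F x)"
      "(F has_derivative g x0) (at x0 within B)" using B by blast
  have "(F has_derivative g x0) (at x0)"
    using F(2) at_within_open[OF B(3,1)] by simp
  then have d: "((\<lambda>x. \<Sum>n. f n x) has_derivative g x0) (at x0)"
    by (rule has_derivative_transform_within_open[OF _ B(1,3)]) (use F(1) in \<open>auto simp: sums_iff\<close>)
  have "g x0 (I h) = \<i> * g x0 h" for h
  proof -
    have "D (f n) x0 (I h) = \<i> * D (f n) x0 h" for n using B by (intro holo_D_commute[OF f]) auto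
    then show ?thesis by (simp add: g_def suminf_mult[OF sums[OF B(3)]])
  qed
  with d show "\<exists>f'. ((\<lambda>x. \<Sum>n. f n x) has_derivative f') (at x0) \<and> (\<forall>v. f' (I v) = \<i> * f' v)"
    by blast
qed

section \<open>Real analytic functions and holomorphic functions on the complexification\<close>

lemma summable_geometric_PiE:
  fixes q :: "'i \<Rightarrow> real"
  assumes B: "finite B" and q: "\<And>b. b \<in> B \<Longrightarrow> 0 \<le> q b \<and> q b < 1"
  shows "(\<lambda>\<alpha>. \<Prod>b\<in>B. q b ^ \<alpha> b) summable_on (B \<rightarrow>\<^sub>E UNIV)"
proof -
  have "Infinite_Set_Sum.abs_summable_on (\<lambda>\<alpha>. \<Prod>b\<in>B. q b ^ \<alpha> b) (B \<rightarrow>\<^sub>E (UNIV :: nat set))"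
  proof (rule abs_summable_on_prod_PiE[OF B])
    fix b assume "b \<in> B"
    then have "norm (q b) < 1" using q[of b] by auto
    then show "Infinite_Set_Sum.abs_summable_on (\<lambda>n. q b ^ n) UNIV"
      unfolding abs_summable_on_nat_iff' norm_power by (simp add: summable_geometric)
  qed auto
  then show ?thesis
    unfolding abs_summable_equivalent[symmetric] by (rule abs_summable_summable)
qed

text \<open>On each complex line in direction \<open>v\<close> this is the \<open>k\<close>-th derivative of the restriction of \<open>f\<close>; as a
  function on the whole domain it is again holomorphic.\<close>

definition iter_deriv :: "'a::real_normed_vector \<Rightarrow> nat \<Rightarrow> ('a \<Rightarrow> complex) \<Rightarrow> 'a \<Rightarrow> complex" where
  "iter_deriv v k f = ((\<lambda>g x. D g x v) ^^ k) f"

lemma holo_iter_deriv: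
  fixes f :: "'a::euclidean_space \<Rightarrow> complex"
  shows "complex_structure I \<Longrightarrow> open S \<Longrightarrow> holo I jc S f \<Longrightarrow> holo I jc S (iter_deriv v k f)"
  unfolding iter_deriv_def by (induction k) (auto intro: holo_derivative_scalar)

lemma higher_deriv_line:
  fixes f :: "'a::euclidean_space \<Rightarrow> complex"
  assumes I: "complex_structure I" and S: "open S" and f: "holo I jc S f" and w: "x + cscale I w v \<in> S"
  shows "(deriv ^^ k) (\<lambda>w. f (x + cscale I w v)) w = iter_deriv v k f (x + cscale I w v)"
  using w
proof (induction k arbitrary: w)
  case (Suc k)
  define T where "T = {w. x + cscale I w v \<in> S}"
  have "continuous_on UNIV (\<lambda>w. x + cscale I w v)"
    by (intro continuous_intros linear_continuous_on
        bounded_bilinear.bounded_linear_left[OF bounded_bilinear_cscale[OF I]])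
  from open_vimage[OF S this] have T: "open T" unfolding T_def by (simp only: vimage_def)
  have "\<forall>\<^sub>F u in nhds w. (deriv ^^ k) (\<lambda>w. f (x + cscale I w v)) u = iter_deriv v k f (x + cscale I u v)"
    using Suc.prems T Suc.IH by (intro eventually_nhds_in_open[of T w, THEN eventually_mono]) (auto simp: T_def)
  then have "deriv ((deriv ^^ k) (\<lambda>w. f (x + cscale I w v))) w = deriv (\<lambda>u. iter_deriv v k f (x + cscale I u v)) w"
    by (rule deriv_cong_ev) simp
  also have "\<dots> = D (iter_deriv v k f) (x + cscale I w v) v"
    by (rule DERIV_imp_deriv[OF line_has_field_derivative[OF I holo_iter_deriv[OF I S f] Suc.prems]])
  finally show ?case by (simp add: iter_deriv_def)
qed (simp add: iter_deriv_def)

text \<open>Expansion in one variable after another: the coefficients of the expansion in one variable are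
  holomorphic in the others, and Cauchy's inequalities make the resulting multiple series converge
  absolutely.\<close>

lemma holo_power_series:
  fixes v :: "'i \<Rightarrow> 'a::euclidean_space"
  assumes I: "complex_structure I" and S: "open S" and r: "r > 0" and B: "finite B"
    and f: "holo I jc S f"
    and M: "\<And>z. \<forall>b\<in>B. norm (z b) \<le> r \<Longrightarrow>
          W + (\<Sum>b\<in>B. cscale I (z b) (v b)) \<in> S \<and> norm (f (W + (\<Sum>b\<in>B. cscale I (z b) (v b)))) \<le> M"
  shows "\<exists>c. (\<forall>\<alpha> \<in> B \<rightarrow>\<^sub>E UNIV. norm (c \<alpha>) \<le> M / r ^ (\<Sum>b\<in>B. \<alpha> b)) \<and>
     (\<forall>z. (\<forall>b\<in>B. norm (z b) < r) \<longrightarrow>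
        ((\<lambda>\<alpha>. c \<alpha> * (\<Prod>b\<in>B. z b ^ \<alpha> b)) has_sum f (W + (\<Sum>b\<in>B. cscale I (z b) (v b)))) (B \<rightarrow>\<^sub>E UNIV))"
  using B f M
proof (induction B arbitrary: f M rule: finite_induct)
  case empty
  then show ?case
    by (intro exI[of _ "\<lambda>_. f W"]) (auto simp: has_sum_finite_iff)
next
  case (insert i B)
  let ?P = "\<lambda>z. W + (\<Sum>b\<in>B. cscale I (z b) (v b))"
  have upd: "(\<Sum>b\<in>B. cscale I ((z(i := w)) b) (v b)) = (\<Sum>b\<in>B. cscale I (z b) (v b))" for z w
    using insert(2) by (intro sum.cong) auto
  have step: "W + (\<Sum>b\<in>insert i B. cscale I (z b) (v b)) = ?P z + cscale I (z i) (v i)" for z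
    using insert(1,2) by (simp add: algebra_simps)
  have disc: "?P z + cscale I w (v i) \<in> S \<and> norm (f (?P z + cscale I w (v i))) \<le> M"
    if "\<forall>b\<in>B. norm (z b) \<le> r" "norm w \<le> r" for z w
    using insert.prems(2)[of "z(i := w)"] that unfolding step fun_upd_same upd by simp
  \<comment> \<open>the Taylor coefficients in the variable i, to which the induction hypothesis applies\<close>
  define G where "G = (\<lambda>k x. iter_deriv (v i) k f x / fact k)"
  have h: "(\<lambda>w. f (?P z + cscale I w (v i))) holomorphic_on cball 0 r" if "\<forall>b\<in>B. norm (z b) \<le> r" for z
    by (rule line_holomorphic[OF I insert.prems(1)]) (use disc[OF that] in simp)
  have deriv: "(deriv ^^ k) (\<lambda>w. f (?P z + cscale I w (v i))) 0 = fact k * G k (?P z)" and P: "?P z \<in> S"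
    if "\<forall>b\<in>B. norm (z b) \<le> r" for z k
  proof -
    have 0: "cscale I 0 (v i) = 0" by (simp add: cscale_def)
    then show "?P z \<in> S" using disc[OF that, of 0] r by simp
    then show "(deriv ^^ k) (\<lambda>w. f (?P z + cscale I w (v i))) 0 = fact k * G k (?P z)"
      using higher_deriv_line[OF I S insert.prems(1), of "?P z" 0 "v i" k] by (simp add: G_def 0)
  qed
  have bound: "norm (G k (?P z)) \<le> M / r ^ k" if z: "\<forall>b\<in>B. norm (z b) \<le> r" for z k
  proof -
    have "norm ((deriv ^^ k) (\<lambda>w. f (?P z + cscale I w (v i))) 0) \<le> fact k * M / r ^ k"
    proof (rule Cauchy_inequality)
      show "norm (f (?P z + cscale I w (v i))) \<le> M" if "norm (0 - w) = r" for w
        using disc[OF z, of w] that by simp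
    qed (use h[OF z] r in \<open>auto intro: holomorphic_on_imp_continuous_on holomorphic_on_subset\<close>)
    then have "fact k * norm (G k (?P z)) \<le> fact k * (M / r ^ k)"
      unfolding deriv[OF z] by (simp only: norm_mult norm_fact times_divide_eq_right)
    then show ?thesis by (simp only: mult_le_cancel_left_pos[OF fact_gt_zero])
  qed
  have G: "holo I jc S (G k)" for k
    unfolding G_def divide_inverse
    by (rule holo_mult[OF holo_iter_deriv[OF I S insert.prems(1)] holo_const[of jc]]) simp
  let ?Q = "\<lambda>k c. (\<forall>\<alpha> \<in> B \<rightarrow>\<^sub>E UNIV. norm (c \<alpha>) \<le> (M / r ^ k) / r ^ (\<Sum>b\<in>B. \<alpha> b)) \<and>
     (\<forall>z. (\<forall>b\<in>B. norm (z b) < r) \<longrightarrow>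
        ((\<lambda>\<alpha>. c \<alpha> * (\<Prod>b\<in>B. z b ^ \<alpha> b)) has_sum G k (?P z)) (B \<rightarrow>\<^sub>E UNIV))"
  have "\<exists>c. ?Q k c" for k
    by (rule insert.IH[OF G]) (rule conjI[OF P bound])
  then have "\<forall>k. \<exists>c. ?Q k c" by (rule allI)
  from choice[OF this] obtain c where Q: "\<forall>k. ?Q k (c k)" ..
  have c: "norm (c k \<alpha>) \<le> (M / r ^ k) / r ^ (\<Sum>b\<in>B. \<alpha> b)" if "\<alpha> \<in> B \<rightarrow>\<^sub>E UNIV" for k \<alpha>
    using Q that by simp
  have cscale: "((\<lambda>\<alpha>. c k \<alpha> * (\<Prod>b\<in>B. z b ^ \<alpha> b)) has_sum G k (?P z)) (B \<rightarrow>\<^sub>E UNIV)"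
    if "\<forall>b\<in>B. norm (z b) < r" for k z
    using Q that by simp
  define C where "C = (\<lambda>\<alpha>. c (\<alpha> i) (restrict \<alpha> B))"
  have sum_i: "(\<Sum>b\<in>insert i B. \<alpha> b) = \<alpha> i + (\<Sum>b\<in>B. \<alpha> b)" for \<alpha> :: "'i \<Rightarrow> nat"
    using insert(1,2) by simp
  have C: "norm (C \<alpha>) \<le> M / r ^ (\<Sum>b\<in>insert i B. \<alpha> b)" for \<alpha>
  proof -
    have "norm (C \<alpha>) \<le> (M / r ^ \<alpha> i) / r ^ (\<Sum>b\<in>B. restrict \<alpha> B b)"
      unfolding C_def by (rule c) auto
    also have "(\<Sum>b\<in>B. restrict \<alpha> B b) = (\<Sum>b\<in>B. \<alpha> b)" by (rule sum.cong) auto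
    finally show ?thesis by (simp add: sum_i power_add)
  qed
  have "((\<lambda>\<alpha>. C \<alpha> * (\<Prod>b\<in>insert i B. z b ^ \<alpha> b)) has_sum f (W + (\<Sum>b\<in>insert i B. cscale I (z b) (v b))))
          (insert i B \<rightarrow>\<^sub>E UNIV)" if z: "\<forall>b\<in>insert i B. norm (z b) < r" for z
  proof -
    let ?T = "\<lambda>\<alpha>. C \<alpha> * (\<Prod>b\<in>insert i B. z b ^ \<alpha> b)"
    have zB: "\<forall>b\<in>B. norm (z b) \<le> r" using z by (simp add: less_imp_le)
    have "M \<ge> 0" using disc[OF zB, of 0] r by (auto intro: order_trans[OF norm_ge_zero])
    have "Infinite_Set_Sum.abs_summable_on ?T (insert i B \<rightarrow>\<^sub>E UNIV)"
      unfolding abs_summable_equivalent[symmetric]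
    proof (rule Infinite_Sum.abs_summable_on_comparison_test')
      show "(\<lambda>\<alpha>. M * (\<Prod>b\<in>insert i B. (norm (z b) / r) ^ \<alpha> b)) summable_on (insert i B \<rightarrow>\<^sub>E UNIV)"
        using z r insert(1) by (intro summable_on_cmult_right summable_geometric_PiE) auto
      fix \<alpha>
      have "norm (?T \<alpha>) = norm (C \<alpha>) * (\<Prod>b\<in>insert i B. norm (z b) ^ \<alpha> b)"
        by (simp add: norm_mult prod_norm[symmetric] norm_power)
      also have "\<dots> \<le> M / r ^ (\<Sum>b\<in>insert i B. \<alpha> b) * (\<Prod>b\<in>insert i B. norm (z b) ^ \<alpha> b)"
        by (intro mult_right_mono C prod_nonneg) auto
      also have "\<dots> = M * (\<Prod>b\<in>insert i B. (norm (z b) / r) ^ \<alpha> b)"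
        by (simp only: power_divide prod_dividef power_sum) simp
      finally show "norm (?T \<alpha>) \<le> M * (\<Prod>b\<in>insert i B. (norm (z b) / r) ^ \<alpha> b)" .
    qed
    then have "?T summable_on (insert i B \<rightarrow>\<^sub>E UNIV)"
      unfolding abs_summable_equivalent[symmetric] by (rule abs_summable_summable)
    then obtain s where s: "(?T has_sum s) (insert i B \<rightarrow>\<^sub>E UNIV)"
      by (auto simp: summable_on_def)
    have inner: "((\<lambda>\<alpha>. ?T (\<alpha>(i := k))) has_sum (z i ^ k * G k (?P z))) (B \<rightarrow>\<^sub>E UNIV)" for k
    proof -
      have "?T (\<alpha>(i := k)) = z i ^ k * (c k \<alpha> * (\<Prod>b\<in>B. z b ^ \<alpha> b))" if "\<alpha> \<in> B \<rightarrow>\<^sub>E UNIV" for \<alpha>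
      proof -
        have 1: "restrict (\<alpha>(i := k)) B = \<alpha>"
          using that insert(2) by (auto simp: restrict_def PiE_def extensional_def fun_eq_iff)
        have 2: "(\<Prod>b\<in>B. z b ^ (\<alpha>(i := k)) b) = (\<Prod>b\<in>B. z b ^ \<alpha> b)"
          using insert(2) by (intro prod.cong) auto
        show ?thesis
          unfolding C_def 1 using insert(1,2) 2 by simp
      qed
      moreover have "((\<lambda>\<alpha>. z i ^ k * (c k \<alpha> * (\<Prod>b\<in>B. z b ^ \<alpha> b))) has_sum (z i ^ k * G k (?P z))) (B \<rightarrow>\<^sub>E UNIV)"
        using z by (intro has_sum_cmult_right cscale) auto
      ultimately show ?thesis by (subst has_sum_cong) auto
    qed
    \<comment> \<open>summing first over the other exponents and then over k identifies the sum s with the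
      Taylor series in the variable i\<close>
    have "(((\<lambda>\<alpha>. ?T \<alpha>) \<circ> (\<lambda>(k, \<alpha>). \<alpha>(i := k))) has_sum s) (UNIV \<times> (B \<rightarrow>\<^sub>E UNIV))"
      using s unfolding PiE_insert_eq
      by (subst (asm) has_sum_reindex[OF inj_combinator[OF insert(2)]]) simp
    from has_sum_SigmaD[OF this, of "\<lambda>k. z i ^ k * G k (?P z)"] inner
    have "((\<lambda>k. z i ^ k * G k (?P z)) has_sum s) UNIV" by (simp add: o_def)
    then have "(\<lambda>k. z i ^ k * G k (?P z)) sums s" by (rule has_sum_imp_sums)
    moreover have "(\<lambda>k. z i ^ k * G k (?P z)) sums f (?P z + cscale I (z i) (v i))"
    proof -
      have "(\<lambda>w. f (?P z + cscale I w (v i))) holomorphic_on ball 0 r"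
        using h[OF zB] by (rule holomorphic_on_subset) auto
      from holomorphic_power_series[OF this, of "z i"] z
      have "(\<lambda>n. (fact n * G n (?P z)) / fact n * (z i - 0) ^ n) sums f (?P z + cscale I (z i) (v i))"
        unfolding deriv[OF zB] by simp
      then show ?thesis by (simp add: mult.commute)
    qed
    ultimately have "s = f (?P z + cscale I (z i) (v i))" by (rule sums_unique2)
    with s show ?thesis unfolding step by simp
  qed
  with C show ?case by (intro exI[of _ C]) blast
qed

text \<open>The extension is the sum of the power series of \<open>g\<close> at complex arguments. Convergence at a single
  real point \<open>x1\<close>, all of whose coordinates relative to \<open>p\<close> equal \<open>s\<close>, bounds the terms at all complex
  points with coordinates of modulus at most \<open>s\<close>.\<close>

theorem real_analytic_holo_extension:
  fixes g :: "'a::euclidean_space \<Rightarrow> real"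
  assumes "real_analytic_on U g" and p: "p \<in> U"
  obtains r G where "r > 0" "holo jp jc (ball (p, 0) r) G" "\<And>x. x \<in> ball p r \<Longrightarrow> G (x, 0) = of_real (g x)"
proof -
  obtain r0 c where r0: "r0 > 0"
    and c: "\<And>x. x \<in> ball p r0 \<Longrightarrow>
       ((\<lambda>\<alpha>. c \<alpha> * (\<Prod>b\<in>Basis. ((x - p) \<bullet> b) ^ \<alpha> b)) has_sum g x) (Basis \<rightarrow>\<^sub>E UNIV)"
    using assms unfolding real_analytic_on_def by blast
  let ?P = "Basis \<rightarrow>\<^sub>E (UNIV :: nat set) :: ('a \<Rightarrow> nat) set"
  \<comment> \<open>so small that x1 lies in the ball of radius r0\<close>
  define s where "s = r0 / (2 * DIM('a))"
  have s: "s > 0" "s \<le> r0" "DIM('a) * s < r0"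
  proof -
    have 1: "(1::real) \<le> DIM('a)" using DIM_positive[where 'a='a] by linarith
    show "s > 0" using r0 by (simp add: s_def)
    show "DIM('a) * s < r0" using r0 by (simp add: s_def)
    moreover have "1 * s \<le> DIM('a) * s" using 1 \<open>s > 0\<close> by (intro mult_right_mono) auto
    ultimately show "s \<le> r0" by linarith
  qed
  define x1 where "x1 = p + (\<Sum>b\<in>Basis. s *\<^sub>R b :: 'a)"
  have x1b: "(x1 - p) \<bullet> b = s" if "b \<in> Basis" for b
    using that by (simp add: x1_def inner_sum_left inner_Basis if_distrib cong: if_cong)
  have "norm (\<Sum>b\<in>Basis. s *\<^sub>R b :: 'a) \<le> (\<Sum>b\<in>Basis. norm (s *\<^sub>R b :: 'a))" by (rule norm_sum)
  also have "\<dots> = DIM('a) * s" using s by simp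
  finally have "x1 \<in> ball p r0" using s by (simp add: x1_def dist_norm)
  from c[OF this] have "(\<lambda>\<alpha>. c \<alpha> * (\<Prod>b\<in>Basis. ((x1 - p) \<bullet> b) ^ \<alpha> b)) summable_on ?P"
    by (auto simp: summable_on_def)
  from summable_on_iff_abs_summable_on_real[THEN iffD1, OF this]
  have "(\<lambda>\<alpha>. \<bar>c \<alpha> * (\<Prod>b\<in>Basis. ((x1 - p) \<bullet> b) ^ \<alpha> b)\<bar>) summable_on ?P"
    by (simp only: real_norm_def)
  then have sum1: "(\<lambda>\<alpha>. \<bar>c \<alpha>\<bar> * (\<Prod>b\<in>Basis. s ^ \<alpha> b)) summable_on ?P"
    by (rule summable_on_cong[THEN iffD1, rotated])
       (use s in \<open>simp add: abs_mult abs_prod x1b power_abs cong: prod.cong\<close>)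
  have "countable ?P" by (intro countable_PiE) auto
  moreover have "infinite ?P"
  proof -
    obtain b0 :: 'a where b0: "b0 \<in> Basis" using nonempty_Basis by blast
    have "inj (\<lambda>n::nat. restrict (\<lambda>_. n) (Basis :: 'a set))"
    proof (rule injI)
      fix m n :: nat
      assume "restrict (\<lambda>_. m) (Basis :: 'a set) = restrict (\<lambda>_. n) Basis"
      from fun_cong[OF this, of b0] b0 show "m = n" by simp
    qed
    then have "infinite (range (\<lambda>n::nat. restrict (\<lambda>_. n) (Basis :: 'a set)))"
      using finite_imageD infinite_UNIV_nat by blast
    moreover have "range (\<lambda>n::nat. restrict (\<lambda>_. n) (Basis :: 'a set)) \<subseteq> ?P" by auto
    ultimately show ?thesis using finite_subset by blast
  qed
  ultimately have e: "bij_betw (from_nat_into ?P) UNIV ?P" by (rule bij_betw_from_nat_into)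
  define e where "e = from_nat_into ?P"
  note e = e[folded e_def]
  \<comment> \<open>the coordinate b of W - p, as a complex number\<close>
  define Z where "Z = (\<lambda>b (W::'a \<times> 'a). Complex ((fst W - p) \<bullet> b) (snd W \<bullet> b))"
  define f where "f = (\<lambda>n W. of_real (c (e n)) * (\<Prod>b\<in>Basis. Z b W ^ e n b))"
  define M where "M = (\<lambda>n. \<bar>c (e n)\<bar> * (\<Prod>b\<in>Basis. s ^ e n b))"
  have "M summable_on UNIV"
    unfolding M_def using sum1 summable_on_reindex_bij_betw[OF e, of "\<lambda>\<alpha>. \<bar>c \<alpha>\<bar> * (\<Prod>b\<in>Basis. s ^ \<alpha> b)"] by simp
  then have M: "summable M" by (rule summable_on_imp_summable)
  have Z: "holo jp jc UNIV (Z b)" for b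
  proof (rule holoI)
    have bl: "bounded_linear (\<lambda>W::'a \<times> 'a. Complex (fst W \<bullet> b) (snd W \<bullet> b))"
      unfolding linear_conv_bounded_linear[symmetric]
      by (rule linearI) (auto simp: inner_add_left complex_eq_iff)
    have "((\<lambda>W. Complex (fst W \<bullet> b) (snd W \<bullet> b) - of_real (p \<bullet> b)) has_derivative
          (\<lambda>W. Complex (fst W \<bullet> b) (snd W \<bullet> b))) (at W)" for W
      using has_derivative_diff[OF bounded_linear_imp_has_derivative[OF bl, of "at W"] has_derivative_const]
      by (simp only: diff_0_right)
    moreover have "Z b = (\<lambda>W. Complex (fst W \<bullet> b) (snd W \<bullet> b) - of_real (p \<bullet> b))"
      by (auto simp: Z_def fun_eq_iff complex_eq_iff inner_diff_left)
    ultimately show "(Z b has_derivative (\<lambda>W. Complex (fst W \<bullet> b) (snd W \<bullet> b))) (at W)" for W by simp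
  qed (auto simp: jp_def complex_eq_iff)
  have f: "holo jp jc (ball (p, 0) s) (f n)" for n
    unfolding f_def by (intro holo_mult holo_const holo_prod holo_power holo_subset[OF Z]) auto
  have bound: "norm (f n W) \<le> M n" if "W \<in> ball (p, 0) s" for n W
  proof -
    have "norm (Z b W) \<le> s" if "b \<in> Basis" for b
    proof -
      have "norm (Z b W) = sqrt (((fst W - p) \<bullet> b)\<^sup>2 + (snd W \<bullet> b)\<^sup>2)"
        by (simp add: Z_def cmod_def)
      also have "\<dots> \<le> sqrt ((norm (fst W - p))\<^sup>2 + (norm (snd W))\<^sup>2)"
        using Basis_le_norm[OF that, of "fst W - p"] Basis_le_norm[OF that, of "snd W"]
        by (intro real_sqrt_le_mono add_mono) (auto simp: abs_le_square_iff[symmetric])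
      also have "\<dots> = norm (W - (p, 0))" by (cases W) (simp add: norm_Pair)
      also have "\<dots> \<le> s" using \<open>W \<in> ball (p, 0) s\<close> by (simp add: dist_norm norm_minus_commute)
      finally show ?thesis .
    qed
    then show ?thesis
      unfolding f_def M_def norm_mult prod_norm[symmetric] norm_power
      by (intro mult_mono prod_mono) (auto intro: power_mono prod_nonneg)
  qed
  have "holo jp jc (ball (p, 0) s) (\<lambda>W. \<Sum>n. f n W)"
    by (rule holo_series[OF complex_structure_jp open_ball f bound M])
  moreover have "(\<Sum>n. f n (x, 0)) = of_real (g x)" if "x \<in> ball p s" for x
  proof -
    have "x \<in> ball p r0" using that s by simp
    have "((\<lambda>n. c (e n) * (\<Prod>b\<in>Basis. ((x - p) \<bullet> b) ^ e n b)) has_sum g x) UNIV"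
      using has_sum_reindex_bij_betw[OF e, of "\<lambda>\<alpha>. c \<alpha> * (\<Prod>b\<in>Basis. ((x - p) \<bullet> b) ^ \<alpha> b)"]
        c[OF \<open>x \<in> ball p r0\<close>] by simp
    from sums_of_real[OF has_sum_imp_sums[OF this], where 'a=complex]
    have "(\<lambda>n. f n (x, 0)) sums of_real (g x)"
      by (simp add: f_def Z_def complex_of_real_def[symmetric])
    then show ?thesis by (rule sums_unique[symmetric])
  qed
  ultimately show thesis using s that by blast
qed

text \<open>At real arguments the real part of the power series of \<open>G\<close> is the power series with the real parts of
  the coefficients.\<close>

theorem real_analytic_holo_restriction:
  fixes G :: "'a::euclidean_space \<times> 'a \<Rightarrow> complex"
  assumes U: "open U" and S: "open S" and G: "holo jp jc S G" and sub: "\<And>x. x \<in> U \<Longrightarrow> (x, 0) \<in> S"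
  shows "real_analytic_on U (\<lambda>x. Re (G (x, 0)))"
  unfolding real_analytic_on_def
proof (intro conjI U ballI)
  fix p assume p: "p \<in> U"
  let ?v = "\<lambda>b::'a. (b, 0 :: 'a)"
  obtain e where e: "e > 0" "cball (p, 0) e \<subseteq> S" using S sub[OF p] open_contains_cball by blast
  have "compact (G ` cball (p, 0) e)"
    by (intro compact_continuous_image continuous_on_subset[OF holo_continuous[OF G] e(2)]) auto
  then obtain M where M: "\<And>x. x \<in> cball (p, 0) e \<Longrightarrow> norm (G x) \<le> M"
    using compact_imp_bounded[of "G ` cball (p, 0) e"] unfolding bounded_iff by blast
  \<comment> \<open>the polydisc of radius r lies in the ball of radius e\<close>
  define r where "r = e / DIM('a)"
  have r: "r > 0" using e by (simp add: r_def)
  have disc: "(p, 0) + (\<Sum>b\<in>Basis. cscale jp (z b) (?v b)) \<in> cball (p, 0) e"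
    if "\<forall>b\<in>Basis. norm (z b) \<le> r" for z
  proof -
    have "norm (\<Sum>b\<in>Basis. cscale jp (z b) (?v b)) \<le> (\<Sum>b\<in>Basis. norm (cscale jp (z b) (?v b)))" by (rule norm_sum)
    also have "\<dots> \<le> (\<Sum>b\<in>(Basis :: 'a set). r)"
    proof (rule sum_mono)
      fix b :: 'a assume b: "b \<in> Basis"
      have "cscale jp (z b) (?v b) = (Re (z b) *\<^sub>R b, Im (z b) *\<^sub>R b)" by (simp add: cscale_def jp_def)
      then have "norm (cscale jp (z b) (?v b)) = norm (z b)" using b by (simp add: norm_Pair cmod_def)
      with bspec[OF that b] show "norm (cscale jp (z b) (?v b)) \<le> r" by simp
    qed
    also have "\<dots> = e" by (simp add: r_def)
    finally show ?thesis by (simp add: dist_norm)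
  qed
  obtain c where c: "\<And>z. \<forall>b\<in>Basis. norm (z b) < r \<Longrightarrow>
        ((\<lambda>\<alpha>. c \<alpha> * (\<Prod>b\<in>Basis. z b ^ \<alpha> b)) has_sum G ((p, 0) + (\<Sum>b\<in>Basis. cscale jp (z b) (?v b))))
          (Basis \<rightarrow>\<^sub>E UNIV)"
    using holo_power_series[OF complex_structure_jp S r finite_Basis G, of "(p, 0)" ?v M] disc e(2) M
    by blast
  have "((\<lambda>\<alpha>. Re (c \<alpha>) * (\<Prod>b\<in>Basis. ((x - p) \<bullet> b) ^ \<alpha> b)) has_sum Re (G (x, 0))) (Basis \<rightarrow>\<^sub>E UNIV)"
    if x: "x \<in> ball p r" for x
  proof -
    have small: "\<forall>b\<in>Basis. norm (complex_of_real ((x - p) \<bullet> b)) < r"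
      using Basis_le_norm[of _ "x - p"] x by (auto simp: dist_norm norm_minus_commute intro: order.strict_trans1)
    have "(\<Sum>b\<in>Basis. cscale jp (of_real ((x - p) \<bullet> b)) (?v b)) = (x - p, 0)"
      by (simp add: cscale_def sum_prod prod_eq_iff fst_sum snd_sum euclidean_representation)
    with has_sum_bounded_linear[OF bounded_linear_Re c[OF small]]
    have "((\<lambda>\<alpha>. Re (c \<alpha> * (\<Prod>b\<in>Basis. of_real ((x - p) \<bullet> b) ^ \<alpha> b))) has_sum Re (G (x, 0))) (Basis \<rightarrow>\<^sub>E UNIV)"
      by (simp add: o_def del: times_complex.sel)
    moreover have "Re (w * (\<Prod>b\<in>Basis. of_real ((x - p) \<bullet> b) ^ \<alpha> b)) = Re w * (\<Prod>b\<in>Basis. ((x - p) \<bullet> b) ^ \<alpha> b)"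
      for w \<alpha> by (simp flip: of_real_power of_real_prod)
    ultimately show ?thesis by simp
  qed
  then show "\<exists>r>0. \<exists>c :: ('a \<Rightarrow> nat) \<Rightarrow> real. \<forall>x\<in>ball p r.
        ((\<lambda>\<alpha>. c \<alpha> * (\<Prod>b\<in>Basis. ((x - p) \<bullet> b) ^ \<alpha> b)) has_sum Re (G (x, 0))) (Basis \<rightarrow>\<^sub>E UNIV)"
    using r by (intro exI[of _ r] exI[of _ "\<lambda>\<alpha>. Re (c \<alpha>)"] conjI) auto
qed

section \<open>Calculus of smooth functions\<close>

lemma differentiable_D: "f differentiable (at x) \<Longrightarrow> (f has_derivative D f x) (at x)"
  using frechet_derivative_works by blast

lemma differentiable_cong_open:
  assumes "open S" "x \<in> S" "\<And>y. y \<in> S \<Longrightarrow> f y = g y" "f differentiable (at x)"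
  shows "g differentiable (at x)"
  using has_derivative_transform_within_open[OF differentiable_D[OF assms(4)] assms(1,2)] assms(3)
  unfolding differentiable_def by blast

lemma C_k_on_cong:
  assumes "open U" "\<And>x. x \<in> U \<Longrightarrow> f x = g x" "C_k_on k U f"
  shows "C_k_on k U g"
  using assms(2,3)
proof (induction k arbitrary: f g)
  case 0
  then show ?case by (auto intro: continuous_on_eq)
next
  case (Suc k)
  have "D f x v = D g x v" if "x \<in> U" for x v
    using D_cong[OF assms(1) that Suc.prems(1)] by simp
  with Suc.IH[of "\<lambda>x. D f x v" "\<lambda>x. D g x v" for v] Suc.prems differentiable_cong_open[OF assms(1) _ Suc.prems(1)]
  show ?case by auto
qed

lemma C_k_on_Suc: "C_k_on (Suc k) U f \<Longrightarrow> C_k_on k U f"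
proof (induction k arbitrary: f)
  case 0
  then show ?case
    by (auto intro!: continuous_at_imp_continuous_on differentiable_imp_continuous_within)
next
  case (Suc k)
  then show ?case by (metis C_k_on.simps(2))
qed

lemma C_k_on_subset: "C_k_on k U f \<Longrightarrow> V \<subseteq> U \<Longrightarrow> C_k_on k V f"
  by (induction k arbitrary: f) (auto intro: continuous_on_subset)

lemma C_k_on_Un:
  "open U \<Longrightarrow> open V \<Longrightarrow> C_k_on k U f \<Longrightarrow> C_k_on k V f \<Longrightarrow> C_k_on k (U \<union> V) f"
  by (induction k arbitrary: f) (auto intro: continuous_on_open_Un)

lemma C_k_on_const: "C_k_on k U (\<lambda>_. c)"
  by (induction k arbitrary: c) (auto simp: frechet_derivative_const)

lemma C_k_on_linear: "bounded_linear f \<Longrightarrow> C_k_on k U f"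
proof (cases k)
  case (Suc n)
  assume f: "bounded_linear f"
  then have "D f x v = f v" for x v
    using has_derivative_D[OF bounded_linear_imp_has_derivative[OF f]] by simp
  then show ?thesis using f Suc
    by (auto simp: C_k_on_const intro: bounded_linear_imp_differentiable)
qed (auto intro: linear_continuous_on)

lemma C_k_on_add: "open U \<Longrightarrow> C_k_on k U f \<Longrightarrow> C_k_on k U g \<Longrightarrow> C_k_on k U (\<lambda>x. f x + g x)"
proof (induction k arbitrary: f g)
  case (Suc k)
  have d: "((\<lambda>x. f x + g x) has_derivative (\<lambda>v. D f x v + D g x v)) (at x)" if "x \<in> U" for x
    by (rule has_derivative_add) (use Suc.prems that in \<open>auto intro: differentiable_D\<close>)
  have "C_k_on k U (\<lambda>x. D (\<lambda>x. f x + g x) x v)" for v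
    by (rule C_k_on_cong[OF Suc.prems(1) _ Suc.IH[OF Suc.prems(1), of "\<lambda>x. D f x v" "\<lambda>x. D g x v"]])
       (use has_derivative_D[OF d] Suc.prems in auto)
  with d show ?case by (auto simp: differentiable_def)
qed (auto intro: continuous_intros)

lemma C_k_on_bilinear:
  assumes "bounded_bilinear pr" and U: "open U"
  shows "C_k_on k U f \<Longrightarrow> C_k_on k U g \<Longrightarrow> C_k_on k U (\<lambda>x. pr (f x) (g x))"
proof (induction k arbitrary: f g)
  case 0
  then show ?case by (simp add: bounded_bilinear.continuous_on[OF assms(1)])
next
  case (Suc k)
  have d: "((\<lambda>x. pr (f x) (g x)) has_derivative (\<lambda>v. pr (f x) (D g x v) + pr (D f x v) (g x))) (at x)"
    if "x \<in> U" for x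
    by (rule bounded_bilinear.FDERIV[OF assms(1)]) (use Suc.prems that in \<open>auto intro: differentiable_D\<close>)
  have "C_k_on k U (\<lambda>x. pr (f x) (D g x v) + pr (D f x v) (g x))" for v
    using Suc.prems C_k_on_Suc[OF Suc.prems(1)] C_k_on_Suc[OF Suc.prems(2)]
    by (intro C_k_on_add U Suc.IH) auto
  then have "C_k_on k U (\<lambda>x. D (\<lambda>x. pr (f x) (g x)) x v)" for v
    by (rule C_k_on_cong[OF U, rotated]) (use has_derivative_D[OF d] in auto)
  with d show ?case by (auto simp: differentiable_def)
qed

lemma C_k_on_linear_compose:
  assumes h: "bounded_linear h" and U: "open U"
  shows "C_k_on k U f \<Longrightarrow> C_k_on k U (\<lambda>x. h (f x))"
proof (induction k arbitrary: f)
  case 0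
  then show ?case by (simp add: bounded_linear.continuous_on[OF h])
next
  case (Suc k)
  have d: "((\<lambda>x. h (f x)) has_derivative (\<lambda>v. h (D f x v))) (at x)" if "x \<in> U" for x
    by (rule bounded_linear.has_derivative[OF h]) (use Suc.prems that in \<open>auto intro: differentiable_D\<close>)
  have "C_k_on k U (\<lambda>x. D (\<lambda>x. h (f x)) x v)" for v
    by (rule C_k_on_cong[OF U _ Suc.IH[of "\<lambda>x. D f x v"]]) (use has_derivative_D[OF d] Suc.prems in auto)
  with d show ?case by (auto simp: differentiable_def)
qed

lemma C_k_on_sum:
  assumes "open U" "\<And>i. i \<in> A \<Longrightarrow> C_k_on k U (f i)"
  shows "C_k_on k U (\<lambda>x. \<Sum>i\<in>A. f i x)"
  using assms(2) by (induction A rule: infinite_finite_induct)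
    (auto simp: C_k_on_const intro: C_k_on_add[OF assms(1)])

lemma linear_Basis_expansion:
  assumes "linear (f :: 'a::euclidean_space \<Rightarrow> 'b::real_vector)"
  shows "f a = (\<Sum>b\<in>Basis. (a \<bullet> b) *\<^sub>R f b)"
proof -
  have "f a = f (\<Sum>b\<in>Basis. (a \<bullet> b) *\<^sub>R b)" by (simp add: euclidean_representation)
  then show ?thesis by (simp add: linear_sum[OF assms] linear_scale[OF assms])
qed

lemma D_Basis_expansion:
  "f differentiable (at x) \<Longrightarrow> D f x a = (\<Sum>b\<in>Basis. (a \<bullet> b) *\<^sub>R D f x (b::'a::euclidean_space))"
  by (rule linear_Basis_expansion[OF has_derivative_linear[OF differentiable_D]])

text \<open>By the chain rule the derivatives of the composition are sums of products of derivatives of \<open>f\<close> with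
  the derivatives of \<open>g\<close>, composed with \<open>f\<close>, along the vectors of the standard basis.\<close>

lemma C_k_on_compose:
  fixes f :: "'a::euclidean_space \<Rightarrow> 'b::euclidean_space" and g :: "'b \<Rightarrow> 'c::real_normed_vector"
  assumes U: "open U" and sub: "f ` U \<subseteq> V"
  shows "C_k_on k U f \<Longrightarrow> C_k_on k V g \<Longrightarrow> C_k_on k U (\<lambda>x. g (f x))"
proof (induction k arbitrary: g)
  case 0
  then show ?case using sub by (auto intro: continuous_on_compose2)
next
  case (Suc k)
  have d: "((\<lambda>x. g (f x)) has_derivative (\<lambda>v. D g (f x) (D f x v))) (at x)" if "x \<in> U" for x
    by (rule has_derivative_compose) (use Suc.prems that sub in \<open>auto intro!: differentiable_D\<close>)
  have e: "D g (f x) (D f x v) = (\<Sum>b\<in>Basis. (D f x v \<bullet> b) *\<^sub>R D g (f x) b)" if "x \<in> U" for x v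
    by (rule D_Basis_expansion) (use Suc.prems that sub in auto)
  have "C_k_on k U (\<lambda>x. \<Sum>b\<in>Basis. (D f x v \<bullet> b) *\<^sub>R D g (f x) b)" for v
    by (intro C_k_on_sum U C_k_on_bilinear[OF bounded_bilinear_scaleR]
        C_k_on_linear_compose[OF bounded_linear_inner_left] Suc.IH C_k_on_Suc[OF Suc.prems(1)])
       (use Suc.prems in auto)
  then have "C_k_on k U (\<lambda>x. D (\<lambda>x. g (f x)) x v)" for v
    by (rule C_k_on_cong[OF U, rotated]) (use has_derivative_D[OF d] e in auto)
  with d show ?case by (auto simp: differentiable_def)
qed

lemma smooth_on_open: "smooth_on U f \<Longrightarrow> open U"
  by (simp add: smooth_on_def)

lemma smooth_on_cong: "smooth_on U f \<Longrightarrow> (\<And>x. x \<in> U \<Longrightarrow> f x = g x) \<Longrightarrow> smooth_on U g"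
  unfolding smooth_on_def using C_k_on_cong by blast

lemma smooth_on_subset: "smooth_on U f \<Longrightarrow> open V \<Longrightarrow> V \<subseteq> U \<Longrightarrow> smooth_on V f"
  unfolding smooth_on_def using C_k_on_subset by blast

lemma smooth_on_Un: "smooth_on U f \<Longrightarrow> smooth_on V f \<Longrightarrow> smooth_on (U \<union> V) f"
  unfolding smooth_on_def using C_k_on_Un by blast

lemma smooth_on_const: "open U \<Longrightarrow> smooth_on U (\<lambda>_. c)"
  by (simp add: smooth_on_def C_k_on_const)

lemma smooth_on_linear: "open U \<Longrightarrow> bounded_linear f \<Longrightarrow> smooth_on U f"
  by (simp add: smooth_on_def C_k_on_linear)

lemma smooth_on_add: "smooth_on U f \<Longrightarrow> smooth_on U g \<Longrightarrow> smooth_on U (\<lambda>x. f x + g x)"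
  by (simp add: smooth_on_def C_k_on_add)

lemma smooth_on_bilinear:
  "bounded_bilinear pr \<Longrightarrow> smooth_on U f \<Longrightarrow> smooth_on U g \<Longrightarrow> smooth_on U (\<lambda>x. pr (f x) (g x))"
  by (simp add: smooth_on_def C_k_on_bilinear)

lemmas smooth_on_mult = smooth_on_bilinear[OF bounded_bilinear_mult]
lemmas smooth_on_scaleR = smooth_on_bilinear[OF bounded_bilinear_scaleR]

lemma smooth_on_linear_compose: "bounded_linear h \<Longrightarrow> smooth_on U f \<Longrightarrow> smooth_on U (\<lambda>x. h (f x))"
  by (simp add: smooth_on_def C_k_on_linear_compose)

lemma smooth_on_diff:
  assumes "smooth_on U f" "smooth_on U g" shows "smooth_on U (\<lambda>x. f x - g x)"
  using smooth_on_add[OF assms(1) smooth_on_linear_compose[OF bounded_linear_minus[OF bounded_linear_ident] assms(2)]]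
  by simp

lemma smooth_on_sum: "open U \<Longrightarrow> (\<And>i. i \<in> A \<Longrightarrow> smooth_on U (f i)) \<Longrightarrow> smooth_on U (\<lambda>x. \<Sum>i\<in>A. f i x)"
  by (simp add: smooth_on_def C_k_on_sum)

lemma smooth_on_compose:
  fixes f :: "'a::euclidean_space \<Rightarrow> 'b::euclidean_space"
  shows "smooth_on U f \<Longrightarrow> smooth_on V g \<Longrightarrow> f ` U \<subseteq> V \<Longrightarrow> smooth_on U (\<lambda>x. g (f x))"
  unfolding smooth_on_def using C_k_on_compose by blast

lemma smooth_on_differentiable: "smooth_on U f \<Longrightarrow> x \<in> U \<Longrightarrow> f differentiable (at x)"
  unfolding smooth_on_def by (metis C_k_on.simps(2))

lemma smooth_on_D: "smooth_on U f \<Longrightarrow> x \<in> U \<Longrightarrow> (f has_derivative D f x) (at x)"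
  by (rule differentiable_D[OF smooth_on_differentiable])

lemma smooth_on_continuous: "smooth_on U f \<Longrightarrow> continuous_on U f"
  unfolding smooth_on_def by (metis C_k_on.simps(1))

lemma smooth_on_derivative: "smooth_on U f \<Longrightarrow> smooth_on U (\<lambda>x. D f x v)"
  unfolding smooth_on_def by (metis C_k_on.simps(2))

lemma smooth_on_derivative_along:
  assumes f: "smooth_on U f" and a: "smooth_on U a"
  shows "smooth_on U (\<lambda>x. D f x (a x))"
proof (rule smooth_on_cong)
  show "smooth_on U (\<lambda>x. \<Sum>b\<in>Basis. (a x \<bullet> b) *\<^sub>R D f x b)"
    by (intro smooth_on_sum smooth_on_scaleR smooth_on_linear_compose[OF bounded_linear_inner_left]
        smooth_on_derivative f a smooth_on_open[OF f])
qed (simp add: D_Basis_expansion[OF smooth_on_differentiable[OF f], symmetric])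

lemma holo_smooth:
  fixes f :: "'a::euclidean_space \<Rightarrow> 'b::euclidean_space"
  assumes I: "complex_structure I" and J: "complex_structure J" and S: "open S" and f: "holo I J S f"
  shows "smooth_on S f"
proof -
  have "C_k_on k S f" for k
    using f
  proof (induction k arbitrary: f)
    case (Suc k)
    have "f differentiable (at x)" if "x \<in> S" for x
      using holo_D[OF Suc.prems that] by (auto simp: differentiable_def)
    with Suc.IH[OF holo_derivative[OF I J S Suc.prems]] show ?case by simp
  qed (simp add: holo_continuous)
  then show ?thesis using S by (simp add: smooth_on_def)
qed

lemma smooth_on_affine: "open U \<Longrightarrow> bounded_linear L \<Longrightarrow> smooth_on U (\<lambda>x. p + L x)"
  by (intro smooth_on_add smooth_on_const smooth_on_linear)

text \<open>Symmetry of second derivatives. The increment of \<open>f\<close> in direction \<open>v\<close> is the integral of its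
  derivative; differentiating this identity in direction \<open>u\<close> under the integral, and then in direction
  \<open>v\<close> at the lower end, compares the two mixed derivatives.\<close>

theorem second_derivative_symmetric:
  fixes f :: "'a::euclidean_space \<Rightarrow> 'b::euclidean_space"
  assumes f: "smooth_on U f" and x: "x \<in> U"
  shows "D (\<lambda>y. D f y u) x v = D (\<lambda>y. D f y v) x u"
proof -
  obtain e where e: "e > 0" "ball x e \<subseteq> U" using smooth_on_open[OF f] x open_contains_ball by blast
  define \<delta> where "\<delta> = e / (2 * (norm u + norm v + 1))"
  have n: "norm u + norm v + 1 > 0" by (simp add: add_nonneg_pos)
  have \<delta>: "\<delta> > 0" using e n by (simp add: \<delta>_def)
  have inU: "x + s *\<^sub>R u + t *\<^sub>R v \<in> U" if "\<bar>s\<bar> \<le> \<delta>" "\<bar>t\<bar> \<le> \<delta>" for s t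
  proof -
    have "norm (s *\<^sub>R u + t *\<^sub>R v) \<le> \<bar>s\<bar> * norm u + \<bar>t\<bar> * norm v"
      using norm_triangle_ineq[of "s *\<^sub>R u" "t *\<^sub>R v"] by simp
    also have "\<dots> \<le> \<delta> * norm u + \<delta> * norm v"
      using that by (intro add_mono mult_right_mono) auto
    also have "\<dots> < 2 * (\<delta> * (norm u + norm v + 1))"
      using \<delta> by (simp add: algebra_simps add_nonneg_pos)
    also have "\<dots> = e" using n by (simp add: \<delta>_def field_simps)
    finally have "dist (x + s *\<^sub>R u + t *\<^sub>R v) x < e"
      by (simp add: dist_norm algebra_simps)
    then have "x + s *\<^sub>R u + t *\<^sub>R v \<in> ball x e" by (simp add: dist_commute)
    then show ?thesis using e by blast
  qed
  let ?fv = "\<lambda>y. D f y v" and ?fu = "\<lambda>y. D f y u"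
  have fv: "smooth_on U ?fv" and fu: "smooth_on U ?fu" by (rule smooth_on_derivative[OF f])+
  have fvu: "continuous_on U (\<lambda>y. D ?fv y u)"
    by (rule smooth_on_continuous[OF smooth_on_derivative[OF fv]])
  have vd: "((\<lambda>s. g (y + s *\<^sub>R w)) has_vector_derivative D g (y + s *\<^sub>R w) w) (at s within T)"
    if g: "smooth_on U g" and "y + s *\<^sub>R w \<in> U" for g :: "'a \<Rightarrow> 'b" and y w s T
  proof -
    have "((\<lambda>s. y + s *\<^sub>R w) has_derivative (\<lambda>h. h *\<^sub>R w)) (at s)"
      by (auto intro!: derivative_eq_intros)
    from has_derivative_compose[OF this smooth_on_D[OF g that(2)]]
    have "((\<lambda>s. g (y + s *\<^sub>R w)) has_derivative (\<lambda>h. D g (y + s *\<^sub>R w) (h *\<^sub>R w))) (at s)" .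
    moreover have "D g (y + s *\<^sub>R w) (h *\<^sub>R w) = h *\<^sub>R D g (y + s *\<^sub>R w) w" for h
      by (rule linear_scale[OF has_derivative_linear[OF smooth_on_D[OF g that(2)]]])
    ultimately show ?thesis
      by (simp add: has_vector_derivative_def has_derivative_at_withinI)
  qed
  \<comment> \<open>the derivative at s = 0 of the increment from x + su to x + su + tv\<close>
  have key: "?fu (x + t *\<^sub>R v) - ?fu x = integral {0..t} (\<lambda>\<tau>. D ?fv (x + \<tau> *\<^sub>R v) u)"
    if t: "0 \<le> t" "t \<le> \<delta>" for t
  proof -
    define \<phi> where "\<phi> = (\<lambda>s. f (x + s *\<^sub>R u + t *\<^sub>R v) - f (x + s *\<^sub>R u))"
    have 1: "\<phi> s = integral (cbox 0 t) (\<lambda>\<tau>. ?fv (x + s *\<^sub>R u + \<tau> *\<^sub>R v))" if s: "s \<in> {-\<delta>..\<delta>}" for s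
    proof -
      have "((\<lambda>\<tau>. ?fv (x + s *\<^sub>R u + \<tau> *\<^sub>R v)) has_integral
          f (x + s *\<^sub>R u + t *\<^sub>R v) - f (x + s *\<^sub>R u + 0 *\<^sub>R v)) {0..t}"
      proof (rule fundamental_theorem_of_calculus[OF t(1)])
        fix \<tau> assume "\<tau> \<in> {0..t}"
        then have "x + s *\<^sub>R u + \<tau> *\<^sub>R v \<in> U" using s t by (intro inU) auto
        then show "((\<lambda>\<tau>. f (x + s *\<^sub>R u + \<tau> *\<^sub>R v)) has_vector_derivative
            ?fv (x + s *\<^sub>R u + \<tau> *\<^sub>R v)) (at \<tau> within {0..t})" by (rule vd[OF f])
      qed
      then show ?thesis by (simp add: \<phi>_def integral_unique)
    qed
    have swap: "x + s *\<^sub>R u + \<tau> *\<^sub>R v = (x + \<tau> *\<^sub>R v) + s *\<^sub>R u" for s \<tau> by simp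
    have "((\<lambda>s. integral (cbox 0 t) (\<lambda>\<tau>. ?fv (x + s *\<^sub>R u + \<tau> *\<^sub>R v))) has_vector_derivative
        integral (cbox 0 t) (\<lambda>\<tau>. D ?fv (x + 0 *\<^sub>R u + \<tau> *\<^sub>R v) u)) (at 0 within {-\<delta>..\<delta>})"
    proof (rule leibniz_rule_vector_derivative)
      fix s \<tau> assume s: "s \<in> {-\<delta>..\<delta>}" and \<tau>: "\<tau> \<in> cbox 0 t"
      then have "x + \<tau> *\<^sub>R v + s *\<^sub>R u \<in> U" using t inU[of s \<tau>] unfolding swap by auto
      then show "((\<lambda>s. ?fv (x + s *\<^sub>R u + \<tau> *\<^sub>R v)) has_vector_derivative
           D ?fv (x + s *\<^sub>R u + \<tau> *\<^sub>R v) u) (at s within {-\<delta>..\<delta>})"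
        unfolding swap by (rule vd[OF fv])
    next
      fix s assume s: "s \<in> {-\<delta>..\<delta>}"
      have "continuous_on (cbox 0 t) (\<lambda>\<tau>. ?fv (x + s *\<^sub>R u + \<tau> *\<^sub>R v))"
        using s t by (intro continuous_on_compose2[OF smooth_on_continuous[OF fv]] continuous_intros)
          (auto intro!: inU)
      then show "(\<lambda>\<tau>. ?fv (x + s *\<^sub>R u + \<tau> *\<^sub>R v)) integrable_on cbox 0 t"
        by (rule integrable_continuous)
    next
      show "continuous_on ({-\<delta>..\<delta>} \<times> cbox 0 t) (\<lambda>(s, \<tau>). D ?fv (x + s *\<^sub>R u + \<tau> *\<^sub>R v) u)"
        unfolding split_beta using t
        by (intro continuous_on_compose2[OF fvu] continuous_intros) (auto intro!: inU)
    qed (use \<delta> in auto)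
    then have "(\<phi> has_vector_derivative integral (cbox 0 t) (\<lambda>\<tau>. D ?fv (x + 0 *\<^sub>R u + \<tau> *\<^sub>R v) u))
        (at 0 within {-\<delta>..\<delta>})"
      by (rule has_vector_derivative_transform[rotated 2]) (use \<delta> 1 in auto)
    moreover have "(\<phi> has_vector_derivative ?fu (x + t *\<^sub>R v) - ?fu x) (at 0 within {-\<delta>..\<delta>})"
    proof -
      have "x + t *\<^sub>R v + 0 *\<^sub>R u \<in> U" "x + 0 *\<^sub>R u \<in> U" using inU[of 0 t] t x by auto
      from has_vector_derivative_diff[OF vd[OF f this(1)] vd[OF f this(2)]]
      show ?thesis unfolding \<phi>_def swap by simp
    qed
    ultimately show ?thesis
      using vector_derivative_unique_within[of 0 "{-\<delta>..\<delta>}"] \<delta>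
      by (auto simp: trivial_limit_within islimpt_Icc)
  qed
  have "((\<lambda>t. integral {0..t} (\<lambda>\<tau>. D ?fv (x + \<tau> *\<^sub>R v) u)) has_vector_derivative D ?fv (x + 0 *\<^sub>R v) u)
      (at 0 within {0..\<delta>})"
  proof (rule integral_has_vector_derivative)
    show "continuous_on {0..\<delta>} (\<lambda>\<tau>. D ?fv (x + \<tau> *\<^sub>R v) u)"
      using inU[of 0] by (intro continuous_on_compose2[OF fvu] continuous_intros) auto
  qed (use \<delta> in auto)
  then have "((\<lambda>t. ?fu (x + t *\<^sub>R v) - ?fu x) has_vector_derivative D ?fv x u) (at 0 within {0..\<delta>})"
    unfolding scaleR_zero_left add_0_right
    by (rule has_vector_derivative_transform[rotated 2]) (use \<delta> key in auto)
  moreover have "((\<lambda>t. ?fu (x + t *\<^sub>R v) - ?fu x) has_vector_derivative D ?fu x v) (at 0 within {0..\<delta>})"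
    using has_vector_derivative_diff[OF vd[OF fu, of x 0 v "{0..\<delta>}"] has_vector_derivative_const] x by simp
  ultimately show ?thesis
    using vector_derivative_unique_within[of 0 "{0..\<delta>}"] \<delta>
    by (auto simp: trivial_limit_within islimpt_Icc)
qed

text \<open>The functions \<open>p(1/x) exp(-1/x)\<close>, extended by zero to \<open>x \<le> 0\<close>, form a family that is closed
  under differentiation.\<close>

definition flat :: "real poly \<Rightarrow> real \<Rightarrow> real" where
  "flat p x = (if x > 0 then poly p (1/x) * exp (- (1/x)) else 0)"

lemma poly_exp_tendsto_0: "((\<lambda>y. poly p y * exp (- y)) \<longlongrightarrow> 0) (at_top :: real filter)"
proof -
  have "((\<lambda>y. \<Sum>i\<le>degree p. coeff p i * (y ^ i / exp y)) \<longlongrightarrow> (\<Sum>i\<le>degree p. coeff p i * 0)) (at_top :: real filter)"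
    by (intro tendsto_intros tendsto_power_div_exp_0)
  then show ?thesis
    by (simp add: poly_altdef sum_distrib_right exp_minus divide_inverse mult.assoc)
qed

lemma flat_has_derivative:
  "(flat p has_real_derivative flat ((p - pderiv p) * [:0, 0, 1:]) x) (at x)"
proof -
  consider "x > 0" | "x < 0" | "x = 0" by linarith
  then show ?thesis
  proof cases
    case 1
    have "((\<lambda>x. poly p (1/x) * exp (- (1/x))) has_real_derivative
        flat ((p - pderiv p) * [:0, 0, 1:]) x) (at x)"
      using 1 by (auto intro!: derivative_eq_intros simp: flat_def field_simps power2_eq_square)
    then show ?thesis
      by (rule has_field_derivative_transform_within_open[of _ _ _ "{0<..}"]) (use 1 in \<open>auto simp: flat_def\<close>)
  next
    case 2
    have "((\<lambda>x. 0) has_real_derivative 0) (at x)" by simp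
    then have "(flat p has_real_derivative 0) (at x)"
      by (rule has_field_derivative_transform_within_open[of _ _ _ "{..<0}"]) (use 2 in \<open>auto simp: flat_def\<close>)
    then show ?thesis using 2 by (simp add: flat_def)
  next
    case 3
    have "((\<lambda>h. poly (p * [:0, 1:]) (inverse h) * exp (- inverse h)) \<longlongrightarrow> 0) (at_right 0)"
      by (rule filterlim_compose[OF poly_exp_tendsto_0 filterlim_inverse_at_top_right])
    then have "((\<lambda>h. (flat p (0 + h) - flat p 0) / h) \<longlongrightarrow> 0) (at_right 0)"
      by (rule Lim_transform_eventually)
         (auto simp: eventually_at_right_field flat_def field_simps intro!: exI[of _ 1])
    moreover have "((\<lambda>h. (flat p (0 + h) - flat p 0) / h) \<longlongrightarrow> 0) (at_left 0)"
      by (rule Lim_transform_eventually[OF tendsto_const])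
         (auto simp: eventually_at_left_field flat_def intro!: exI[of _ "-1"])
    ultimately have "((\<lambda>h. (flat p (0 + h) - flat p 0) / h) \<longlongrightarrow> 0) (at 0)"
      by (simp add: filterlim_at_split)
    then show ?thesis using 3 by (simp add: DERIV_def flat_def)
  qed
qed

lemma smooth_flat: "smooth_on UNIV (flat p)"
proof -
  have "C_k_on k UNIV (\<lambda>x. c * flat p x)" for k c
  proof (induction k arbitrary: p c)
    case 0
    then show ?case
      using DERIV_isCont[OF flat_has_derivative]
      by (auto intro!: continuous_intros continuous_at_imp_continuous_on)
  next
    case (Suc k)
    have d: "((\<lambda>x. c * flat p x) has_derivative (\<lambda>v. c * (flat ((p - pderiv p) * [:0, 0, 1:]) x * v))) (at x)" for x
      using has_derivative_mult_right[OF flat_has_derivative[unfolded has_field_derivative_def]] .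
    have "(\<lambda>x. D (\<lambda>x. c * flat p x) x v) = (\<lambda>x. (c * v) * flat ((p - pderiv p) * [:0, 0, 1:]) x)" for v
      using has_derivative_D[OF d] by (auto simp: fun_eq_iff)
    with Suc d show ?case by (auto simp: differentiable_def)
  qed
  from this[of _ 1] show ?thesis by (simp add: smooth_on_def)
qed

theorem bump_function:
  fixes x0 :: "'a::euclidean_space"
  assumes e: "e > 0"
  obtains \<theta> :: "'a \<Rightarrow> real" where "smooth_on UNIV \<theta>" "\<And>x. 0 \<le> \<theta> x" "\<And>x. dist x0 x \<ge> e \<Longrightarrow> \<theta> x = 0" "\<theta> x0 > 0"
proof
  let ?\<theta> = "\<lambda>x. flat 1 (e\<^sup>2 - (x - x0) \<bullet> (x - x0))"
  have 1: "smooth_on UNIV (\<lambda>x. x - x0)"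
    by (intro smooth_on_diff smooth_on_const smooth_on_linear) auto
  show "smooth_on UNIV ?\<theta>"
    by (intro smooth_on_compose[OF _ smooth_flat] smooth_on_diff smooth_on_const
        smooth_on_bilinear[OF bounded_bilinear_inner] 1) auto
  show "0 \<le> ?\<theta> x" for x by (simp add: flat_def)
  show "?\<theta> x0 > 0" using e by (simp add: flat_def)
  show "?\<theta> x = 0" if "dist x0 x \<ge> e" for x
  proof -
    have "e\<^sup>2 \<le> (dist x0 x)\<^sup>2" using that e by (intro power_mono) auto
    moreover have "(x - x0) \<bullet> (x - x0) = (dist x0 x)\<^sup>2"
      by (metis dist_norm dist_commute power2_norm_eq_inner)
    ultimately show ?thesis by (simp add: flat_def)
  qed
qed

section \<open>Weak derivatives along complex vector fields\<close>

text \<open>Lebesgue integrals over open sets reduce to integrals over compact sets, where continuity gives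
  integrability and differentiation under the integral sign is available.\<close>

lemma compact_support_integral:
  fixes f :: "'a::euclidean_space \<Rightarrow> 'b::euclidean_space"
  assumes K: "compact K" "K \<subseteq> V" and f: "continuous_on K f" and 0: "\<And>t. t \<in> V \<Longrightarrow> t \<notin> K \<Longrightarrow> f t = 0"
  shows "set_integrable lborel V f" "(LINT t:V|lborel. f t) = (LINT t:K|lborel. f t)"
proof -
  have e: "indicator V t *\<^sub>R f t = indicator K t *\<^sub>R f t" for t
    using K 0[of t] by (auto simp: indicator_def)
  show "set_integrable lborel V f"
    unfolding set_integrable_def e using borel_integrable_compact[OF K(1) f] by simp
  show "(LINT t:V|lborel. f t) = (LINT t:K|lborel. f t)"
    unfolding set_lebesgue_integral_def e ..
qed

lemma compact_support_integral_cbox: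
  fixes f :: "'a::euclidean_space \<Rightarrow> 'b::euclidean_space"
  assumes K: "compact K" "K \<subseteq> cbox a b" "cbox a b \<subseteq> V" and f: "continuous_on (cbox a b) f"
    and 0: "\<And>t. t \<in> V \<Longrightarrow> t \<notin> K \<Longrightarrow> f t = 0"
  shows "(LINT t:V|lborel. f t) = integral (cbox a b) f"
proof -
  have fK: "continuous_on K f" using f K(2) continuous_on_subset by blast
  have "(LINT t:V|lborel. f t) = (LINT t:K|lborel. f t)"
    using compact_support_integral(2)[OF K(1) _ fK 0] K by blast
  also have "\<dots> = (LINT t:cbox a b|lborel. f t)"
    using compact_support_integral(2)[OF K(1,2) fK 0] K(3) by (simp add: subset_iff)
  also have "\<dots> = integral (cbox a b) f"
    by (rule set_borel_integral_eq_integral(2)[OF compact_support_integral(1)[OF compact_cbox order_refl f]]) simp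
  finally show ?thesis .
qed

lemma lborel_integral_translate:
  fixes f :: "'a::euclidean_space \<Rightarrow> 'b::euclidean_space"
  assumes "f \<in> borel_measurable borel"
  shows "(LINT t|lborel. f (c + t)) = (LINT t|lborel. f t)"
proof -
  have "(LINT t|lborel. f t) = (LINT t|distr lborel borel ((+) c). f t)" by (simp only: lborel_distr_plus)
  also have "\<dots> = (LINT t|lborel. f (c + t))" by (rule integral_distr) (use assms in auto)
  finally show ?thesis by simp
qed

lemma derivative_zero_off_support:
  assumes "closed K" "\<And>t. t \<notin> K \<Longrightarrow> f t = 0" "t \<notin> K"
  shows "D f t v = 0"
proof -
  have "D f t = D (\<lambda>_. 0) t" by (rule D_cong[of "- K"]) (use assms in auto)
  then show ?thesis by (simp add: frechet_derivative_const)
qed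

text \<open>The integral of a compactly supported function is invariant under translation; differentiating
  this in the translation vector shows that derivatives have integral zero.\<close>

lemma integral_derivative_zero:
  fixes w :: "'a::euclidean_space \<Rightarrow> 'b::euclidean_space"
  assumes w: "smooth_on UNIV w" and K: "compact K" and 0: "\<And>t. t \<notin> K \<Longrightarrow> w t = 0"
  shows "(LINT t|lborel. D w t v) = 0"
proof -
  \<comment> \<open>contains the supports of all the translates that occur\<close>
  define K' where "K' = (\<lambda>(t, s). t - s *\<^sub>R v) ` (K \<times> {0..1::real})"
  have "compact K'"
    unfolding K'_def by (intro compact_continuous_image compact_Times K compact_Icc)
      (auto simp: split_beta intro!: continuous_intros)
  then obtain a b where ab: "K' \<subseteq> cbox a b" using bounded_subset_cbox_symmetric compact_imp_bounded by metis
  have sub: "K \<subseteq> K'" by (force simp: K'_def)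
  have contw: "continuous_on T w" for T by (rule continuous_on_subset[OF smooth_on_continuous[OF w]]) auto
  have contD: "continuous_on T (\<lambda>t. D w t v)" for T
    by (rule continuous_on_subset[OF smooth_on_continuous[OF smooth_on_derivative[OF w]]]) auto
  have const: "integral (cbox a b) (\<lambda>t. w (s *\<^sub>R v + t)) = (LINT t|lborel. w t)" if s: "s \<in> {0..1}" for s
  proof -
    have z: "w (s *\<^sub>R v + t) = 0" if "t \<notin> K'" for t
    proof (rule 0, rule notI)
      assume "s *\<^sub>R v + t \<in> K"
      then have "(s *\<^sub>R v + t) - s *\<^sub>R v \<in> K'" unfolding K'_def using s by force
      with that show False by simp
    qed
    have "(LINT t:UNIV|lborel. w (s *\<^sub>R v + t)) = integral (cbox a b) (\<lambda>t. w (s *\<^sub>R v + t))"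
      by (rule compact_support_integral_cbox[OF \<open>compact K'\<close> ab])
         (auto intro!: continuous_on_compose2[OF contw[of UNIV]] continuous_intros z)
    moreover have "(LINT t|lborel. w (s *\<^sub>R v + t)) = (LINT t|lborel. w t)"
      by (rule lborel_integral_translate) (intro borel_measurable_continuous_onI contw)
    ultimately show ?thesis by (simp add: set_lebesgue_integral_def)
  qed
  have "((\<lambda>s. integral (cbox a b) (\<lambda>t. w (s *\<^sub>R v + t))) has_vector_derivative
      integral (cbox a b) (\<lambda>t. D w (0 *\<^sub>R v + t) v)) (at 0 within {0..1})"
  proof (rule leibniz_rule_vector_derivative)
    fix s t
    have "((\<lambda>s. s *\<^sub>R v + t) has_derivative (\<lambda>h. h *\<^sub>R v)) (at s within {0..1})"
      by (auto intro!: derivative_eq_intros)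
    from has_derivative_compose[OF this smooth_on_D[OF w]]
    show "((\<lambda>s. w (s *\<^sub>R v + t)) has_vector_derivative D w (s *\<^sub>R v + t) v) (at s within {0..1})"
      using linear_scale[OF has_derivative_linear[OF smooth_on_D[OF w]]]
      by (simp add: has_vector_derivative_def)
  next
    show "(\<lambda>t. w (s *\<^sub>R v + t)) integrable_on cbox a b" for s
      by (intro integrable_continuous continuous_on_compose2[OF contw[of UNIV]] continuous_intros) auto
    show "continuous_on ({0..1} \<times> cbox a b) (\<lambda>(s, t). D w (s *\<^sub>R v + t) v)"
      unfolding split_beta
      by (intro continuous_on_compose2[OF contD[of UNIV]] continuous_intros) auto
  qed auto
  then have "((\<lambda>s. (LINT t|lborel. w t)) has_vector_derivative integral (cbox a b) (\<lambda>t. D w t v)) (at 0 within {0..1})"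
    unfolding scaleR_zero_left add_0_left
    by (rule has_vector_derivative_transform[rotated 2]) (use const in auto)
  moreover have "at (0::real) within {0..1} \<noteq> bot" by (simp add: trivial_limit_within islimpt_Icc)
  ultimately have "integral (cbox a b) (\<lambda>t. D w t v) = 0"
    using vector_derivative_unique_within has_vector_derivative_const by blast
  moreover have "(LINT t:UNIV|lborel. D w t v) = integral (cbox a b) (\<lambda>t. D w t v)"
    by (rule compact_support_integral_cbox[OF K _ _ contD])
       (use sub ab derivative_zero_off_support[OF compact_imp_closed[OF K] 0] in auto)
  ultimately show ?thesis by (simp add: set_lebesgue_integral_def)
qed

abbreviation partial :: "'m \<Rightarrow> (real ^ 'm \<Rightarrow> 'b::real_normed_vector) \<Rightarrow> real ^ 'm \<Rightarrow> 'b" where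
  "partial j f t \<equiv> D f t (axis j 1)"

definition smooth_field :: "(real ^ 'm) set \<Rightarrow> (real ^ 'm \<Rightarrow> complex ^ 'm) \<Rightarrow> bool" where
  "smooth_field V a \<longleftrightarrow> (\<forall>j. smooth_on V (\<lambda>t. a t $ j))"

text \<open>A map \<open>a\<close> stands for the vector field \<open>\<Sum>\<^sub>j a\<^sub>j \<partial>/\<partial>t\<^sub>j\<close>. The formula of \<open>div_mult\<close> is the divergence of
  the field \<open>\<theta> a\<close>, up to sign the formal transpose of \<open>a\<close>.\<close>

definition field_deriv :: "(real ^ 'm \<Rightarrow> complex ^ 'm) \<Rightarrow> (real ^ 'm \<Rightarrow> complex) \<Rightarrow> real ^ 'm \<Rightarrow> complex" where
  "field_deriv a f t = (\<Sum>k\<in>UNIV. a t $ k * partial k f t)"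

definition div_mult :: "(real ^ 'm \<Rightarrow> complex ^ 'm) \<Rightarrow> (real ^ 'm \<Rightarrow> complex) \<Rightarrow> real ^ 'm \<Rightarrow> complex" where
  "div_mult a \<theta> t = (\<Sum>j\<in>UNIV. partial j (\<lambda>s. a s $ j * \<theta> s) t)"

definition bracket :: "(real ^ 'm \<Rightarrow> complex ^ 'm) \<Rightarrow> (real ^ 'm \<Rightarrow> complex ^ 'm) \<Rightarrow> real ^ 'm \<Rightarrow> complex ^ 'm" where
  "bracket a b t = (\<chi> j. field_deriv a (\<lambda>s. b s $ j) t - field_deriv b (\<lambda>s. a s $ j) t)"

text \<open>\<open>a u = g\<close> in the sense of distributions on \<open>V\<close>.\<close>

definition weak_deriv :: "(real ^ 'm) set \<Rightarrow> (real ^ 'm \<Rightarrow> complex) \<Rightarrow> (real ^ 'm \<Rightarrow> complex ^ 'm) \<Rightarrow>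
    (real ^ 'm \<Rightarrow> complex) \<Rightarrow> bool" where
  "weak_deriv V u a g \<longleftrightarrow> (\<forall>\<theta>. test_function V \<theta> \<longrightarrow>
      (LINT t:V|lborel. u t * div_mult a \<theta> t) = - (LINT t:V|lborel. g t * \<theta> t))"

lemma partial_add: "smooth_on V f \<Longrightarrow> smooth_on V g \<Longrightarrow> t \<in> V \<Longrightarrow> partial k (\<lambda>s. f s + g s) t = partial k f t + partial k g t"
  using has_derivative_D[OF has_derivative_add[OF smooth_on_D[of V f t] smooth_on_D[of V g t]]] by simp

lemma partial_diff: "smooth_on V f \<Longrightarrow> smooth_on V g \<Longrightarrow> t \<in> V \<Longrightarrow> partial k (\<lambda>s. f s - g s) t = partial k f t - partial k g t"
  using has_derivative_D[OF has_derivative_diff[OF smooth_on_D[of V f t] smooth_on_D[of V g t]]] by simp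

lemma partial_minus: "smooth_on V f \<Longrightarrow> t \<in> V \<Longrightarrow> partial k (\<lambda>s. - f s) t = - partial k f t"
  using has_derivative_D[OF has_derivative_minus[OF smooth_on_D[of V f t]]] by simp

lemma partial_mult:
  fixes f g :: "real ^ 'm \<Rightarrow> complex"
  shows "smooth_on V f \<Longrightarrow> smooth_on V g \<Longrightarrow> t \<in> V \<Longrightarrow> partial k (\<lambda>s. f s * g s) t = f t * partial k g t + partial k f t * g t"
  using has_derivative_D[OF has_derivative_mult[OF smooth_on_D[of V f t] smooth_on_D[of V g t]]] by simp

lemma partial_sum:
  assumes "\<And>i. i \<in> A \<Longrightarrow> smooth_on V (f i)" "t \<in> V"
  shows "partial k (\<lambda>s. \<Sum>i\<in>A. f i s) t = (\<Sum>i\<in>A. partial k (f i) t)"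
  using has_derivative_D[OF has_derivative_sum[of A f "\<lambda>i. D (f i) t" "at t"]] smooth_on_D assms by metis

lemma partial_cong: "open V \<Longrightarrow> t \<in> V \<Longrightarrow> (\<And>s. s \<in> V \<Longrightarrow> f s = g s) \<Longrightarrow> partial k f t = partial k g t"
  using D_cong by metis

lemma partial_symmetric:
  "smooth_on V (f :: real ^ 'm \<Rightarrow> complex) \<Longrightarrow> t \<in> V \<Longrightarrow> partial j (\<lambda>s. partial k f s) t = partial k (\<lambda>s. partial j f s) t"
  by (rule second_derivative_symmetric)

lemma smooth_field_smooth: "smooth_field V a \<Longrightarrow> smooth_on V (\<lambda>t. a t $ j)"
  by (simp add: smooth_field_def)

lemma test_function_smooth: "test_function V \<theta> \<Longrightarrow> open S \<Longrightarrow> smooth_on S \<theta>"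
  unfolding test_function_def using smooth_on_subset by blast

lemma smooth_field_deriv: "open V \<Longrightarrow> smooth_field V a \<Longrightarrow> smooth_on V f \<Longrightarrow> smooth_on V (field_deriv a f)"
  unfolding field_deriv_def by (intro smooth_on_sum smooth_on_mult smooth_on_derivative smooth_field_smooth)

lemma test_mult:
  assumes V: "open V" and b: "smooth_on V b" and \<theta>: "test_function V \<theta>"
  shows "test_function V (\<lambda>t. b t * \<theta> t)"
proof -
  obtain K where K: "compact K" "K \<subseteq> V" "\<And>t. t \<notin> K \<Longrightarrow> \<theta> t = 0"
    using \<theta> unfolding test_function_def by blast
  have "smooth_on V (\<lambda>t. b t * \<theta> t)" by (intro smooth_on_mult b test_function_smooth[OF \<theta>] V)
  moreover have "smooth_on (- K) (\<lambda>t. b t * \<theta> t)"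
    by (rule smooth_on_cong[OF smooth_on_const[of _ 0]]) (use K compact_imp_closed in auto)
  ultimately have "smooth_on (V \<union> - K) (\<lambda>t. b t * \<theta> t)" by (rule smooth_on_Un)
  moreover have "V \<union> - K = UNIV" using K by blast
  ultimately show ?thesis using K unfolding test_function_def by auto
qed

lemma test_derivative:
  assumes \<theta>: "test_function V \<theta>" shows "test_function V (\<lambda>t. D \<theta> t v)"
proof -
  obtain K where K: "compact K" "K \<subseteq> V" "\<And>t. t \<notin> K \<Longrightarrow> \<theta> t = 0"
    using \<theta> unfolding test_function_def by blast
  have "D \<theta> t v = 0" if "t \<notin> K" for t
    by (rule derivative_zero_off_support[OF compact_imp_closed[OF K(1)] K(3) that])
  then show ?thesis using K \<theta> smooth_on_derivative unfolding test_function_def by blast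
qed

lemma test_add:
  assumes "test_function V \<theta>" "test_function V \<eta>" shows "test_function V (\<lambda>t. \<theta> t + \<eta> t)"
proof -
  obtain K L where K: "compact K" "K \<subseteq> V" "\<And>t. t \<notin> K \<Longrightarrow> \<theta> t = 0"
    and L: "compact L" "L \<subseteq> V" "\<And>t. t \<notin> L \<Longrightarrow> \<eta> t = 0"
    using assms unfolding test_function_def by blast
  then show ?thesis
    using assms smooth_on_add unfolding test_function_def
    by (intro conjI exI[of _ "K \<union> L"]) (auto intro: compact_Un)
qed

lemma test_sum: "(\<And>i. i \<in> A \<Longrightarrow> test_function V (f i)) \<Longrightarrow> test_function V (\<lambda>t. \<Sum>i\<in>A. f i t)"
proof (induction A rule: infinite_finite_induct)
  case (insert i A)
  then show ?case using test_add[of V "f i" "\<lambda>t. \<Sum>i\<in>A. f i t"] by simp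
qed (auto simp: test_function_def smooth_on_const)

lemma test_div_mult: "open V \<Longrightarrow> smooth_field V a \<Longrightarrow> test_function V \<theta> \<Longrightarrow> test_function V (div_mult a \<theta>)"
  unfolding div_mult_def by (intro test_sum test_derivative test_mult smooth_field_smooth)

lemma test_cnj:
  assumes "test_function V \<theta>" shows "test_function V (\<lambda>t. cnj (\<theta> t))"
proof -
  obtain K where K: "compact K" "K \<subseteq> V" "\<And>t. t \<notin> K \<Longrightarrow> \<theta> t = 0" and s: "smooth_on UNIV \<theta>"
    using assms unfolding test_function_def by blast
  show ?thesis
    unfolding test_function_def
    using smooth_on_linear_compose[OF bounded_linear_cnj s] K by (intro conjI exI[of _ K]) auto
qed

lemma test_integrable:
  fixes u :: "real ^ 'm \<Rightarrow> complex"
  assumes u: "continuous_on V u" and w: "test_function V w"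
  shows "set_integrable lborel V (\<lambda>t. u t * w t)"
proof -
  obtain K where K: "compact K" "K \<subseteq> V" "\<And>t. t \<notin> K \<Longrightarrow> w t = 0"
    using w unfolding test_function_def by blast
  have "continuous_on UNIV w" using w unfolding test_function_def by (blast intro: smooth_on_continuous)
  then have "continuous_on K (\<lambda>t. u t * w t)"
    using u K(2) by (intro continuous_on_mult) (auto intro: continuous_on_subset)
  then show ?thesis by (rule compact_support_integral(1)[OF K(1,2)]) (simp add: K(3))
qed

lemma integral_partial_test:
  assumes w: "test_function V w" shows "(LINT t:V|lborel. D w t v) = 0"
proof -
  obtain K where K: "compact K" "K \<subseteq> V" "\<And>t. t \<notin> K \<Longrightarrow> w t = 0" and s: "smooth_on UNIV w"
    using w unfolding test_function_def by blast
  have "indicator V t *\<^sub>R D w t v = D w t v" for t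
  proof (cases "t \<in> V")
    case False
    then have "t \<notin> K" using K(2) by blast
    from derivative_zero_off_support[OF compact_imp_closed[OF K(1)] K(3) this] show ?thesis by simp
  qed simp
  then show ?thesis
    unfolding set_lebesgue_integral_def using integral_derivative_zero[OF s K(1,3)] by simp
qed

lemma set_integral_sum_complex:
  fixes f :: "'i \<Rightarrow> 'a \<Rightarrow> complex"
  assumes "finite A" "\<And>i. i \<in> A \<Longrightarrow> set_integrable M V (f i)"
  shows "set_integrable M V (\<lambda>t. \<Sum>i\<in>A. f i t) \<and>
     (LINT t:V|M. (\<Sum>i\<in>A. f i t)) = (\<Sum>i\<in>A. LINT t:V|M. f i t)"
  using assms
proof (induction A rule: finite_induct)
  case empty
  then show ?case by (simp add: set_integrable_def set_lebesgue_integral_def)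
qed auto

lemma div_mult_product:
  assumes V: "open V" and a: "smooth_field V a" and v: "smooth_on V v" and \<theta>: "smooth_on V \<theta>" and t: "t \<in> V"
  shows "div_mult a (\<lambda>s. v s * \<theta> s) t = v t * div_mult a \<theta> t + field_deriv a v t * \<theta> t"
proof -
  have "partial j (\<lambda>s. a s $ j * (v s * \<theta> s)) t = v t * partial j (\<lambda>s. a s $ j * \<theta> s) t + a t $ j * partial j v t * \<theta> t" for j
  proof -
    have "partial j (\<lambda>s. a s $ j * (v s * \<theta> s)) t = partial j (\<lambda>s. v s * (a s $ j * \<theta> s)) t"
      by (simp add: ac_simps)
    also have "\<dots> = v t * partial j (\<lambda>s. a s $ j * \<theta> s) t + partial j v t * (a t $ j * \<theta> t)"
      by (rule partial_mult[OF v smooth_on_mult[OF smooth_field_smooth[OF a] \<theta>] t])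
    finally show ?thesis by (simp add: ac_simps)
  qed
  then show ?thesis
    by (simp add: div_mult_def field_deriv_def sum.distrib sum_distrib_left sum_distrib_right)
qed

text \<open>Integration by parts: smooth functions have their classical derivatives.\<close>

lemma weak_deriv_smooth:
  assumes V: "open V" and a: "smooth_field V a" and v: "smooth_on V v"
  shows "weak_deriv V v a (field_deriv a v)"
  unfolding weak_deriv_def
proof (intro allI impI)
  fix \<theta> assume \<theta>: "test_function V \<theta>"
  have \<theta>V: "smooth_on V \<theta>" by (rule test_function_smooth[OF \<theta> V])
  have t: "test_function V (\<lambda>s. a s $ j * (v s * \<theta> s))" for j
    by (rule test_mult[OF V smooth_field_smooth[OF a] test_mult[OF V v \<theta>]])
  have "set_integrable lborel V (\<lambda>s. partial j (\<lambda>s. a s $ j * (v s * \<theta> s)) s)" for j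
    using test_integrable[of V "\<lambda>_. 1", OF _ test_derivative[OF t]] by simp
  then have "(LINT t:V|lborel. div_mult a (\<lambda>s. v s * \<theta> s) t) = 0"
    unfolding div_mult_def using set_integral_sum_complex[of UNIV lborel V "\<lambda>j. partial j (\<lambda>s. a s $ j * (v s * \<theta> s))"]
      integral_partial_test[OF t] by simp
  moreover have "(LINT t:V|lborel. div_mult a (\<lambda>s. v s * \<theta> s) t) = (LINT t:V|lborel. v t * div_mult a \<theta> t + field_deriv a v t * \<theta> t)"
    by (rule set_lebesgue_integral_cong) (use V div_mult_product[OF V a v \<theta>V] in auto)
  moreover have "\<dots> = (LINT t:V|lborel. v t * div_mult a \<theta> t) + (LINT t:V|lborel. field_deriv a v t * \<theta> t)"
    by (intro set_integral_add test_integrable test_div_mult V a \<theta> smooth_on_continuous[OF v]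
        smooth_on_continuous[OF smooth_field_deriv[OF V a v]])
  ultimately show "(LINT t:V|lborel. v t * div_mult a \<theta> t) = - (LINT t:V|lborel. field_deriv a v t * \<theta> t)"
    by (simp add: eq_neg_iff_add_eq_0)
qed

lemma weak_derivD: "weak_deriv V u a g \<Longrightarrow> test_function V \<theta> \<Longrightarrow>
    (LINT t:V|lborel. u t * div_mult a \<theta> t) = - (LINT t:V|lborel. g t * \<theta> t)"
  by (simp add: weak_deriv_def)

text \<open>The factor \<open>b\<close> passes to the test function, since \<open>div (\<theta> b a)\<close> is formed from the test
  function \<open>b \<theta>\<close>.\<close>

lemma weak_deriv_mult:
  assumes V: "open V" and b: "smooth_on V b" and weak_deriv: "weak_deriv V u a g"
  shows "weak_deriv V u (\<lambda>t. b t *s a t) (\<lambda>t. b t * g t)"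
  unfolding weak_deriv_def
proof (intro allI impI)
  fix \<theta> assume \<theta>: "test_function V \<theta>"
  have "div_mult (\<lambda>t. b t *s a t) \<theta> = div_mult a (\<lambda>t. b t * \<theta> t)"
    by (simp add: div_mult_def fun_eq_iff ac_simps)
  then show "(LINT t:V|lborel. u t * div_mult (\<lambda>t. b t *s a t) \<theta> t) = - (LINT t:V|lborel. b t * g t * \<theta> t)"
    using weak_derivD[OF weak_deriv test_mult[OF V b \<theta>]] by (simp add: ac_simps)
qed

lemma weak_deriv_add:
  assumes V: "open V" and u: "continuous_on V u" and a: "smooth_field V a" and b: "smooth_field V b"
    and g: "continuous_on V g" and h: "continuous_on V h"
    and 1: "weak_deriv V u a g" and 2: "weak_deriv V u b h"
  shows "weak_deriv V u (\<lambda>t. a t + b t) (\<lambda>t. g t + h t)"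
  unfolding weak_deriv_def
proof (intro allI impI)
  fix \<theta> assume \<theta>: "test_function V \<theta>"
  have \<theta>V: "smooth_on V \<theta>" by (rule test_function_smooth[OF \<theta> V])
  have div_mult: "div_mult (\<lambda>t. a t + b t) \<theta> t = div_mult a \<theta> t + div_mult b \<theta> t" if "t \<in> V" for t
    using partial_add[OF smooth_on_mult[OF smooth_field_smooth[OF a] \<theta>V] smooth_on_mult[OF smooth_field_smooth[OF b] \<theta>V] that]
    by (simp add: div_mult_def distrib_right sum.distrib)
  have "(LINT t:V|lborel. u t * div_mult (\<lambda>t. a t + b t) \<theta> t) = (LINT t:V|lborel. u t * div_mult a \<theta> t + u t * div_mult b \<theta> t)"
    by (rule set_lebesgue_integral_cong) (use V div_mult in \<open>auto simp: distrib_left\<close>)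
  also have "\<dots> = (LINT t:V|lborel. u t * div_mult a \<theta> t) + (LINT t:V|lborel. u t * div_mult b \<theta> t)"
    by (intro set_integral_add test_integrable u test_div_mult V a b \<theta>)
  also have "\<dots> = - ((LINT t:V|lborel. g t * \<theta> t) + (LINT t:V|lborel. h t * \<theta> t))"
    using weak_derivD[OF 1 \<theta>] weak_derivD[OF 2 \<theta>] by simp
  also have "(LINT t:V|lborel. g t * \<theta> t) + (LINT t:V|lborel. h t * \<theta> t) = (LINT t:V|lborel. g t * \<theta> t + h t * \<theta> t)"
    by (rule set_integral_add(2)[symmetric]) (intro test_integrable g h \<theta>)+
  finally show "(LINT t:V|lborel. u t * div_mult (\<lambda>t. a t + b t) \<theta> t) = - (LINT t:V|lborel. (g t + h t) * \<theta> t)"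
    by (simp add: distrib_right)
qed

lemma weak_deriv_lincomb:
  assumes V: "open V" and u: "continuous_on V u" and v: "continuous_on V v" and a: "smooth_field V a"
    and g: "continuous_on V g" and h: "continuous_on V h"
    and 1: "weak_deriv V u a g" and 2: "weak_deriv V v a h"
  shows "weak_deriv V (\<lambda>t. u t + c * v t) a (\<lambda>t. g t + c * h t)"
  unfolding weak_deriv_def
proof (intro allI impI)
  fix \<theta> assume \<theta>: "test_function V \<theta>"
  have "(LINT t:V|lborel. (u t + c * v t) * div_mult a \<theta> t)
      = (LINT t:V|lborel. u t * div_mult a \<theta> t + c * (v t * div_mult a \<theta> t))" by (simp add: distrib_right mult.assoc)
  also have "\<dots> = (LINT t:V|lborel. u t * div_mult a \<theta> t) + (LINT t:V|lborel. c * (v t * div_mult a \<theta> t))"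
    by (intro set_integral_add set_integrable_mult_right test_integrable u v test_div_mult V a \<theta>)
  also have "\<dots> = - ((LINT t:V|lborel. g t * \<theta> t) + (LINT t:V|lborel. c * (h t * \<theta> t)))"
    using weak_derivD[OF 1 \<theta>] weak_derivD[OF 2 \<theta>] by simp
  also have "(LINT t:V|lborel. g t * \<theta> t) + (LINT t:V|lborel. c * (h t * \<theta> t))
      = (LINT t:V|lborel. g t * \<theta> t + c * (h t * \<theta> t))"
    by (rule set_integral_add(2)[symmetric]) (intro set_integrable_mult_right test_integrable g h \<theta>)+
  finally show "(LINT t:V|lborel. (u t + c * v t) * div_mult a \<theta> t) = - (LINT t:V|lborel. (g t + c * h t) * \<theta> t)"
    by (simp add: distrib_right mult.assoc)
qed

lemma partial_cnj: "smooth_on V f \<Longrightarrow> t \<in> V \<Longrightarrow> partial k (\<lambda>s. cnj (f s)) t = cnj (partial k f t)"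
  using has_derivative_D[OF bounded_linear.has_derivative[OF bounded_linear_cnj smooth_on_D]] by metis

lemma set_integral_cnj: "(LINT t:V|M. cnj (f t)) = cnj (LINT t:V|M. f t)"
  unfolding set_lebesgue_integral_def by (subst Bochner_Integration.integral_cnj[symmetric]) simp

text \<open>For a real function, derivatives along conjugate fields are conjugate; the conjugate of a test
  function is again one.\<close>

lemma weak_deriv_cnj:
  assumes V: "open V" and a: "smooth_field V a" and 1: "weak_deriv V u a g" and u: "\<And>t. cnj (u t) = u t"
  shows "weak_deriv V u (\<lambda>t. \<chi> j. cnj (a t $ j)) (\<lambda>t. cnj (g t))"
  unfolding weak_deriv_def
proof (intro allI impI)
  fix \<theta> assume \<theta>: "test_function V \<theta>"
  have \<theta>V: "smooth_on V (\<lambda>t. cnj (\<theta> t))" by (rule test_function_smooth[OF test_cnj[OF \<theta>] V])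
  have "div_mult (\<lambda>t. \<chi> j. cnj (a t $ j)) \<theta> t = cnj (div_mult a (\<lambda>t. cnj (\<theta> t)) t)" if "t \<in> V" for t
    using partial_cnj[OF smooth_on_mult[OF smooth_field_smooth[OF a] \<theta>V] that] by (simp add: div_mult_def)
  then have "(LINT t:V|lborel. u t * div_mult (\<lambda>t. \<chi> j. cnj (a t $ j)) \<theta> t)
      = (LINT t:V|lborel. cnj (u t * div_mult a (\<lambda>t. cnj (\<theta> t)) t))"
    by (intro set_lebesgue_integral_cong) (use V u in auto)
  also have "\<dots> = - cnj (LINT t:V|lborel. g t * cnj (\<theta> t))"
    unfolding set_integral_cnj weak_derivD[OF 1 test_cnj[OF \<theta>]] by simp
  also have "\<dots> = - (LINT t:V|lborel. cnj (g t) * \<theta> t)"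
    unfolding set_integral_cnj[symmetric] by simp
  finally show "(LINT t:V|lborel. u t * div_mult (\<lambda>t. \<chi> j. cnj (a t $ j)) \<theta> t)
      = - (LINT t:V|lborel. cnj (g t) * \<theta> t)" .
qed

lemma weak_deriv_cong:
  assumes V: "open V" and "\<And>t. t \<in> V \<Longrightarrow> u t = u' t" "\<And>t. t \<in> V \<Longrightarrow> a t = a' t" "\<And>t. t \<in> V \<Longrightarrow> g t = g' t"
    and "weak_deriv V u a g"
  shows "weak_deriv V u' a' g'"
proof -
  have "div_mult a \<theta> t = div_mult a' \<theta> t" if "t \<in> V" for \<theta> t
    unfolding div_mult_def using assms(3) by (intro sum.cong refl partial_cong[OF V that]) simp
  then have "(LINT t:V|lborel. u t * div_mult a \<theta> t) = (LINT t:V|lborel. u' t * div_mult a' \<theta> t)"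
      "(LINT t:V|lborel. g t * \<theta> t) = (LINT t:V|lborel. g' t * \<theta> t)" for \<theta>
    by (intro set_lebesgue_integral_cong; use V assms in auto)+
  with assms(5) show ?thesis by (simp add: weak_deriv_def)
qed

text \<open>The formal transpose of \<open>a\<close> is \<open>\<theta> \<mapsto> - div (\<theta> a)\<close>, and transposition reverses commutators. The
  vector fields \<open>\<theta> [a, b]\<close> and \<open>a div (\<theta> b) - b div (\<theta> a)\<close> differ by the divergence of the antisymmetric
  tensor \<open>\<theta> (a\<^sub>i b\<^sub>j - a\<^sub>j b\<^sub>i)\<close>, which is divergence free by the symmetry of second derivatives.\<close>

lemma div_mult_bracket:
  assumes V: "open V" and a: "smooth_field V a" and b: "smooth_field V b" and \<theta>: "smooth_on V \<theta>" and t: "t \<in> V"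
  shows "div_mult (bracket a b) \<theta> t = div_mult a (div_mult b \<theta>) t - div_mult b (div_mult a \<theta>) t"
proof -
  define F where "F = (\<lambda>i j s. \<theta> s * (a s $ i * b s $ j - a s $ j * b s $ i))"
  define A where "A = (\<lambda>i s. a s $ i * \<theta> s)"
  define B where "B = (\<lambda>i s. b s $ i * \<theta> s)"
  have sA: "smooth_on V (A i)" and sB: "smooth_on V (B i)" and sF: "smooth_on V (F i j)" for i j
    unfolding A_def B_def F_def
    by (intro smooth_on_mult smooth_on_diff smooth_field_smooth[OF a] smooth_field_smooth[OF b] \<theta>)+
  have sdv: "smooth_on V (div_mult c \<theta>)" if "smooth_field V c" for c
    unfolding div_mult_def by (intro smooth_on_sum smooth_on_derivative smooth_on_mult \<theta> smooth_field_smooth[OF that] V)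
  have comp: "bracket a b s $ j * \<theta> s = (\<Sum>i\<in>UNIV. partial i (F i j) s) - b s $ j * div_mult a \<theta> s + a s $ j * div_mult b \<theta> s"
    if s: "s \<in> V" for s j
  proof -
    have "partial i (F i j) s = (b s $ j * partial i (A i) s + \<theta> s * (a s $ i * partial i (\<lambda>s. b s $ j) s))
        - (a s $ j * partial i (B i) s + \<theta> s * (b s $ i * partial i (\<lambda>s. a s $ j) s))" for i
    proof -
      have "F i j = (\<lambda>s. b s $ j * A i s - a s $ j * B i s)"
        by (simp add: F_def A_def B_def fun_eq_iff algebra_simps)
      then have "partial i (F i j) s = partial i (\<lambda>s. b s $ j * A i s) s - partial i (\<lambda>s. a s $ j * B i s) s"
        using partial_diff[OF smooth_on_mult[OF smooth_field_smooth[OF b] sA] smooth_on_mult[OF smooth_field_smooth[OF a] sB] s]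
        by simp
      then show ?thesis
        using partial_mult[OF smooth_field_smooth[OF b] sA s] partial_mult[OF smooth_field_smooth[OF a] sB s]
        by (simp add: A_def B_def algebra_simps)
    qed
    then have e: "(\<Sum>i\<in>UNIV. partial i (F i j) s) = (\<Sum>i\<in>UNIV. (b s $ j * partial i (A i) s + \<theta> s * (a s $ i * partial i (\<lambda>s. b s $ j) s))
        - (a s $ j * partial i (B i) s + \<theta> s * (b s $ i * partial i (\<lambda>s. a s $ j) s)))"
      by (rule sum.cong[OF refl])
    show ?thesis
      unfolding e
      by (simp add: bracket_def field_deriv_def div_mult_def A_def B_def sum.distrib sum_subtractf sum_distrib_left
          sum_distrib_right algebra_simps)
  qed
  have sumF: "smooth_on V (\<lambda>s. \<Sum>i\<in>UNIV. partial i (F i j) s)" for j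
    by (intro smooth_on_sum V smooth_on_derivative sF)
  have "partial j (\<lambda>s. bracket a b s $ j * \<theta> s) t
      = (\<Sum>i\<in>UNIV. partial j (partial i (F i j)) t) - partial j (\<lambda>s. b s $ j * div_mult a \<theta> s) t + partial j (\<lambda>s. a s $ j * div_mult b \<theta> s) t" for j
  proof -
    have 1: "smooth_on V (\<lambda>s. b s $ j * div_mult a \<theta> s)" "smooth_on V (\<lambda>s. a s $ j * div_mult b \<theta> s)"
      by (intro smooth_on_mult smooth_field_smooth[OF a] smooth_field_smooth[OF b] sdv a b)+
    have "partial j (\<lambda>s. bracket a b s $ j * \<theta> s) t
        = partial j (\<lambda>s. (\<Sum>i\<in>UNIV. partial i (F i j) s) - b s $ j * div_mult a \<theta> s + a s $ j * div_mult b \<theta> s) t"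
      by (rule partial_cong[OF V t comp])
    then show ?thesis
      by (simp add: partial_add[OF smooth_on_diff[OF sumF 1(1)] 1(2) t] partial_diff[OF sumF 1(1) t]
          partial_sum[OF smooth_on_derivative[OF sF] t])
  qed
  then have "div_mult (bracket a b) \<theta> t
      = (\<Sum>j\<in>UNIV. \<Sum>i\<in>UNIV. partial j (partial i (F i j)) t) - div_mult b (div_mult a \<theta>) t + div_mult a (div_mult b \<theta>) t"
    by (simp add: div_mult_def sum.distrib sum_subtractf)
  moreover have "(\<Sum>j\<in>UNIV. \<Sum>i\<in>UNIV. partial j (partial i (F i j)) t) = 0" (is "?S = 0")
  proof -
    have "partial j (partial i (F i j)) t = - partial i (partial j (F j i)) t" for i j
    proof -
      have "F j i = (\<lambda>s. - F i j s)" by (simp add: F_def fun_eq_iff algebra_simps)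
      then have "partial j (F j i) s = - partial j (F i j) s" if "s \<in> V" for s
        using partial_minus[OF sF that] by simp
      then have "partial i (partial j (F j i)) t = partial i (\<lambda>s. - partial j (F i j) s) t" by (rule partial_cong[OF V t])
      also have "\<dots> = - partial i (partial j (F i j)) t" by (rule partial_minus[OF smooth_on_derivative[OF sF] t])
      also have "partial i (partial j (F i j)) t = partial j (partial i (F i j)) t" by (rule partial_symmetric[OF sF t])
      finally show ?thesis by (simp only: minus_minus)
    qed
    then have "?S = (\<Sum>j\<in>UNIV. \<Sum>i\<in>UNIV. - partial i (partial j (F j i)) t)" by (intro sum.cong refl)
    also have "\<dots> = - (\<Sum>i\<in>UNIV. \<Sum>j\<in>UNIV. partial i (partial j (F j i)) t)"
      by (subst sum.swap) (simp add: sum_negf)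
    finally have "?S = - ?S" .
    moreover have "z = - z \<Longrightarrow> z = 0" for z :: complex by (simp add: complex_eq_iff)
    ultimately show ?thesis by blast
  qed
  ultimately show ?thesis by simp
qed

text \<open>Testing \<open>[a, b] u\<close> against \<open>\<theta>\<close> amounts to testing \<open>u\<close> against two iterated transposes of \<open>\<theta>\<close>. The inner
  ones are test functions, so the outer ones can be moved to \<open>u\<close>, which yields \<open>g\<close> and \<open>h\<close>; these are
  smooth, so the inner ones can be moved as well.\<close>

theorem weak_deriv_bracket:
  assumes V: "open V" and u: "continuous_on V u" and a: "smooth_field V a" and b: "smooth_field V b"
    and g: "smooth_on V g" and h: "smooth_on V h"
    and 1: "weak_deriv V u a g" and 2: "weak_deriv V u b h"
  shows "weak_deriv V u (bracket a b) (\<lambda>t. field_deriv a h t - field_deriv b g t)"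
  unfolding weak_deriv_def
proof (intro allI impI)
  fix \<theta> assume \<theta>: "test_function V \<theta>"
  have \<theta>V: "smooth_on V \<theta>" by (rule test_function_smooth[OF \<theta> V])
  note ta = test_div_mult[OF V a \<theta>] and tb = test_div_mult[OF V b \<theta>]
  have "(LINT t:V|lborel. u t * div_mult (bracket a b) \<theta> t)
      = (LINT t:V|lborel. u t * div_mult a (div_mult b \<theta>) t - u t * div_mult b (div_mult a \<theta>) t)"
    by (rule set_lebesgue_integral_cong) (use V div_mult_bracket[OF V a b \<theta>V] in \<open>auto simp: right_diff_distrib\<close>)
  also have "\<dots> = (LINT t:V|lborel. u t * div_mult a (div_mult b \<theta>) t) - (LINT t:V|lborel. u t * div_mult b (div_mult a \<theta>) t)"
    by (intro set_integral_diff test_integrable u test_div_mult V a b ta tb)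
  also have "\<dots> = (LINT t:V|lborel. h t * div_mult a \<theta> t) - (LINT t:V|lborel. g t * div_mult b \<theta> t)"
    using weak_derivD[OF 1 tb] weak_derivD[OF 2 ta] by simp
  also have "\<dots> = - ((LINT t:V|lborel. field_deriv a h t * \<theta> t) - (LINT t:V|lborel. field_deriv b g t * \<theta> t))"
    using weak_derivD[OF weak_deriv_smooth[OF V a h] \<theta>] weak_derivD[OF weak_deriv_smooth[OF V b g] \<theta>] by simp
  also have "(LINT t:V|lborel. field_deriv a h t * \<theta> t) - (LINT t:V|lborel. field_deriv b g t * \<theta> t)
      = (LINT t:V|lborel. field_deriv a h t * \<theta> t - field_deriv b g t * \<theta> t)"
    by (rule set_integral_diff(2)[symmetric])
       (intro test_integrable \<theta> smooth_on_continuous[OF smooth_field_deriv[OF V a h]]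
          smooth_on_continuous[OF smooth_field_deriv[OF V b g]])+
  finally show "(LINT t:V|lborel. u t * div_mult (bracket a b) \<theta> t)
      = - (LINT t:V|lborel. (field_deriv a h t - field_deriv b g t) * \<theta> t)"
    by (simp add: left_diff_distrib)
qed

lemma weak_deriv_subset:
  assumes V: "weak_deriv V u a g" and V': "V' \<subseteq> V"
  shows "weak_deriv V' u a g"
  unfolding weak_deriv_def
proof (intro allI impI)
  fix \<theta> assume \<theta>: "test_function V' \<theta>"
  obtain K where K: "compact K" "K \<subseteq> V'" "\<And>t. t \<notin> K \<Longrightarrow> \<theta> t = 0"
    using \<theta> unfolding test_function_def by blast
  have "div_mult a \<theta> t = 0" if "t \<notin> K" for t
    unfolding div_mult_def using that K(3)
    by (intro sum.neutral ballI derivative_zero_off_support[OF compact_imp_closed[OF K(1)]]) auto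
  then have e: "indicator V' t *\<^sub>R (u t * div_mult a \<theta> t) = indicator V t *\<^sub>R (u t * div_mult a \<theta> t)"
      "indicator V' t *\<^sub>R (g t * \<theta> t) = indicator V t *\<^sub>R (g t * \<theta> t)" for t
    using K V' by (auto simp: indicator_def subset_iff)
  have "test_function V \<theta>" using \<theta> V' unfolding test_function_def by blast
  then show "(LINT t:V'|lborel. u t * div_mult a \<theta> t) = - (LINT t:V'|lborel. g t * \<theta> t)"
    using weak_derivD[OF V, of \<theta>] unfolding set_lebesgue_integral_def e by simp
qed

section \<open>Functions with a continuous weak gradient\<close>

text \<open>A bump function, divided by its integral.\<close>

lemma mollifier:
  fixes x0 :: "'a::euclidean_space"
  assumes e: "e > 0"
  obtains \<theta> :: "'a \<Rightarrow> real" where "smooth_on UNIV \<theta>" "\<And>x. 0 \<le> \<theta> x" "\<And>x. dist x0 x \<ge> e \<Longrightarrow> \<theta> x = 0"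
    "(LINT x|lborel. \<theta> x) = 1"
proof -
  obtain \<theta> :: "'a \<Rightarrow> real" where \<theta>: "smooth_on UNIV \<theta>" "\<And>x. 0 \<le> \<theta> x" "\<And>x. dist x0 x \<ge> e \<Longrightarrow> \<theta> x = 0" "\<theta> x0 > 0"
    using bump_function[OF e] by metis
  have cont: "continuous_on UNIV \<theta>" by (rule smooth_on_continuous[OF \<theta>(1)])
  have "set_integrable lborel UNIV \<theta>"
    by (rule compact_support_integral(1)[of "cball x0 e"])
       (use \<theta>(3) continuous_on_subset[OF cont] in auto)
  then have int: "integrable lborel \<theta>" by (simp add: set_integrable_def)
  have "open {x. \<theta> x > \<theta> x0 / 2}"
    by (intro open_Collect_less continuous_on_const cont)
  moreover have "x0 \<in> {x. \<theta> x > \<theta> x0 / 2}" using \<theta>(4) by simp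
  ultimately obtain d where d: "d > 0" "ball x0 d \<subseteq> {x. \<theta> x > \<theta> x0 / 2}"
    using open_contains_ball by blast
  have fin: "emeasure lborel (ball x0 d) < \<infinity>" by (intro emeasure_bounded_finite) simp
  have "0 < \<theta> x0 / 2 * measure lborel (ball x0 d)"
    using \<theta>(4) content_ball_pos[OF d(1), of x0] by simp
  also have "\<dots> = (LINT x|lborel. \<theta> x0 / 2 * indicator (ball x0 d) x)"
    using fin by simp
  also have "\<dots> \<le> (LINT x|lborel. \<theta> x)"
  proof (rule integral_mono)
    show "integrable lborel (\<lambda>x. \<theta> x0 / 2 * indicator (ball x0 d) x)"
      using fin by (intro integrable_mult_right integrable_real_indicator) auto
    show "\<theta> x0 / 2 * indicator (ball x0 d) x \<le> \<theta> x" for x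
    proof (cases "x \<in> ball x0 d")
      case True
      then have "\<theta> x > \<theta> x0 / 2" using d(2) by blast
      then show ?thesis using True by simp
    qed (use \<theta>(2) in simp)
  qed (rule int)
  finally have c: "(LINT x|lborel. \<theta> x) > 0" .
  show thesis
  proof (rule that)
    let ?\<eta> = "\<lambda>x. inverse (LINT x|lborel. \<theta> x) * \<theta> x"
    show "smooth_on UNIV ?\<eta>" by (intro smooth_on_mult smooth_on_const \<theta>(1)) auto
    show "0 \<le> ?\<eta> x" for x using c \<theta>(2) by simp
    show "?\<eta> x = 0" if "dist x0 x \<ge> e" for x using \<theta>(3)[OF that] by simp
    show "(LINT x|lborel. ?\<eta> x) = 1" using c by simp
  qed
qed

lemma average_bound:
  fixes h :: "'a::euclidean_space \<Rightarrow> complex"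
  assumes N: "compact N" "N \<subseteq> V" and \<theta>: "continuous_on UNIV \<theta>" "\<And>x. 0 \<le> \<theta> x" "\<And>x. x \<notin> N \<Longrightarrow> \<theta> x = 0"
    and 1: "(LINT x|lborel. \<theta> x) = (1::real)" and h: "continuous_on V h"
    and bound: "\<And>x. x \<in> N \<Longrightarrow> norm (h x - c) \<le> \<eta>"
  shows "norm ((LINT x:V|lborel. h x * of_real (\<theta> x)) - c) \<le> \<eta>"
proof -
  have c\<theta>: "continuous_on N \<theta>" and ch: "continuous_on N h"
    using \<theta>(1) h N(2) continuous_on_subset by blast+
  have i: "set_integrable lborel V (\<lambda>x. g x * of_real (\<theta> x))" if "continuous_on N g" for g :: "'a \<Rightarrow> complex"
    by (rule compact_support_integral(1)[OF N])
       (use \<theta>(3) in \<open>auto intro!: continuous_intros that c\<theta>\<close>)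
  have V1: "(LINT x:V|lborel. \<theta> x) = 1"
  proof -
    have e: "indicator V x *\<^sub>R \<theta> x = \<theta> x" for x using \<theta>(3)[of x] N(2) by (auto simp: indicator_def)
    show ?thesis unfolding set_lebesgue_integral_def e by (rule 1)
  qed
  have iV: "set_integrable lborel V \<theta>"
    by (rule compact_support_integral(1)[OF N c\<theta>]) (use \<theta>(3) in auto)
  have "(LINT x:V|lborel. c * of_real (\<theta> x)) = c"
    using V1 by (simp add: set_integral_complex_of_real)
  then have "(LINT x:V|lborel. h x * of_real (\<theta> x)) - c
      = (LINT x:V|lborel. h x * of_real (\<theta> x)) - (LINT x:V|lborel. c * of_real (\<theta> x))" by simp
  also have "\<dots> = (LINT x:V|lborel. h x * of_real (\<theta> x) - c * of_real (\<theta> x))"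
    by (rule set_integral_diff(2)[symmetric]) (intro i ch continuous_on_const)+
  also have "norm \<dots> \<le> (LINT x:V|lborel. \<eta> * \<theta> x)"
    unfolding set_lebesgue_integral_def
  proof (rule Bochner_Integration.integral_norm_bound_integral)
    show "integrable lborel (\<lambda>x. indicator V x *\<^sub>R (h x * of_real (\<theta> x) - c * of_real (\<theta> x)))"
      using set_integral_diff(1)[OF i[OF ch] i[OF continuous_on_const]] by (simp add: set_integrable_def)
    show "integrable lborel (\<lambda>x. indicator V x *\<^sub>R (\<eta> * \<theta> x))"
      using set_integrable_mult_right[OF iV, of \<eta>] by (simp add: set_integrable_def)
    fix x
    have "norm (h x - c) * \<theta> x \<le> \<eta> * \<theta> x"
      using bound[of x] \<theta>(2,3)[of x] by (cases "x \<in> N") (auto intro: mult_right_mono)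
    moreover have "norm (h x * of_real (\<theta> x) - c * of_real (\<theta> x)) = norm (h x - c) * \<theta> x"
      using \<theta>(2)[of x] by (simp add: left_diff_distrib[symmetric] norm_mult)
    ultimately show "norm (indicator V x *\<^sub>R (h x * of_real (\<theta> x) - c * of_real (\<theta> x))) \<le> indicator V x *\<^sub>R (\<eta> * \<theta> x)"
      by (simp add: indicator_def)
  qed
  also have "\<dots> = \<eta>" using V1 by simp
  finally show ?thesis .
qed

lemma test_of_real:
  fixes \<theta> :: "real ^ 'm \<Rightarrow> real"
  assumes "smooth_on UNIV \<theta>" "compact N" "N \<subseteq> V" "\<And>x. x \<notin> N \<Longrightarrow> \<theta> x = 0"
  shows "test_function V (\<lambda>x. of_real (\<theta> x))"
  unfolding test_function_def
  using assms smooth_on_linear_compose[OF bounded_linear_of_real assms(1)]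
  by (intro conjI exI[of _ N]) auto

lemma continuous_nbhd:
  fixes h :: "'a::euclidean_space \<Rightarrow> complex"
  assumes V: "open V" and h: "continuous_on V h" and x: "x \<in> V" and \<eta>: "\<eta> > 0"
  obtains e where "e > 0" "cball x e \<subseteq> V" "\<And>y. y \<in> cball x e \<Longrightarrow> norm (h y - h x) \<le> \<eta>"
proof -
  have "isCont h x" using h V x by (simp add: continuous_on_eq_continuous_at)
  then obtain d where d: "d > 0" "\<And>y. dist y x < d \<Longrightarrow> dist (h y) (h x) < \<eta>"
    using \<eta> unfolding continuous_at_eps_delta by blast
  obtain r where r: "r > 0" "cball x r \<subseteq> V" using V x open_contains_cball by blast
  show thesis
  proof (rule that[of "min r (d/2)"])
    show "norm (h y - h x) \<le> \<eta>" if "y \<in> cball x (min r (d/2))" for y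
      using d(2)[of y] that d(1) by (simp add: dist_commute dist_norm[symmetric])
  qed (use r d in auto)
qed

text \<open>The averages of \<open>g\<close> and \<open>h\<close> against mollifiers concentrated near \<open>x\<close> coincide and are
  close to \<open>g x\<close> and \<open>h x\<close>.\<close>

lemma weak_deriv_unique:
  assumes V: "open V" and g: "continuous_on V g" and h: "continuous_on V h"
    and 1: "weak_deriv V u a g" and 2: "weak_deriv V u a h" and x: "x \<in> V"
  shows "g x = h x"
proof -
  have "norm (g x - h x) \<le> \<eta>" if "\<eta> > 0" for \<eta>
  proof -
    have gh: "continuous_on V (\<lambda>y. g y - h y)" by (intro continuous_intros g h)
    obtain e where e: "e > 0" "cball x e \<subseteq> V"
        "\<And>y. y \<in> cball x e \<Longrightarrow> norm ((g y - h y) - (g x - h x)) \<le> \<eta>"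
      by (rule continuous_nbhd[OF V gh x \<open>\<eta> > 0\<close>]) blast
    obtain \<theta> where \<theta>: "smooth_on UNIV \<theta>" "\<And>y. 0 \<le> \<theta> y" "\<And>y. dist x y \<ge> e \<Longrightarrow> \<theta> y = 0"
        "(LINT y|lborel. \<theta> y) = (1::real)"
      using mollifier[OF e(1)] by metis
    have \<theta>0: "\<theta> y = 0" if "y \<notin> cball x e" for y using \<theta>(3)[of y] that by simp
    have t: "test_function V (\<lambda>y. of_real (\<theta> y))" by (rule test_of_real[OF \<theta>(1) _ e(2) \<theta>0]) auto
    have "norm ((LINT y:V|lborel. (g y - h y) * of_real (\<theta> y)) - (g x - h x)) \<le> \<eta>"
      by (rule average_bound[OF _ e(2) smooth_on_continuous[OF \<theta>(1)] \<theta>(2) \<theta>0 \<theta>(4) gh e(3)]) auto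
    moreover have "(LINT y:V|lborel. (g y - h y) * of_real (\<theta> y))
        = (LINT y:V|lborel. g y * of_real (\<theta> y)) - (LINT y:V|lborel. h y * of_real (\<theta> y))"
      unfolding left_diff_distrib by (rule set_integral_diff(2)) (intro test_integrable g h t)+
    moreover have "\<dots> = 0" using weak_derivD[OF 1 t] weak_derivD[OF 2 t] by simp
    ultimately show ?thesis by (simp add: norm_minus_commute)
  qed
  then have "norm (g x - h x) \<le> 0" by (rule dense_ge)
  then show ?thesis by simp
qed

text \<open>Testing against a moving mollifier: its averages of \<open>u\<close> are differentiable along the motion, with
  the averages of the weak derivative as derivatives. Letting the mollifier shrink compares the
  increment of \<open>u\<close> with the weak derivative.\<close>

lemma weak_increment:
  fixes u G :: "real ^ 'm \<Rightarrow> complex" and X :: "real ^ 'm"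
  assumes V: "open V" and u: "continuous_on V u" and G: "continuous_on V G"
    and weak: "\<And>\<theta>. test_function V \<theta> \<Longrightarrow> (LINT t:V|lborel. u t * D \<theta> t X) = - (LINT t:V|lborel. G t * \<theta> t)"
    and C: "cball x R \<subseteq> cbox a b" "cbox a b \<subseteq> V" and X: "norm X < R"
    and \<eta>: "\<And>y. y \<in> cball x R \<Longrightarrow> norm (G y - G x) \<le> \<eta>"
  shows "norm (u (x + X) - u x - G x) \<le> \<eta>"
proof (rule field_le_epsilon)
  fix \<delta> :: real assume \<delta>: "\<delta> > 0"
  have R: "R > 0" using X norm_ge_zero[of X] by linarith
  have xV: "x \<in> V" "x + X \<in> V" using C X R by (auto simp: subset_iff dist_norm)
  obtain e1 where e1: "e1 > 0" "\<And>y. y \<in> cball x e1 \<Longrightarrow> norm (u y - u x) \<le> \<delta>/2"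
    using continuous_nbhd[OF V u xV(1), of "\<delta>/2"] \<delta> by (metis half_gt_zero)
  obtain e2 where e2: "e2 > 0" "\<And>y. y \<in> cball (x + X) e2 \<Longrightarrow> norm (u y - u (x + X)) \<le> \<delta>/2"
    using continuous_nbhd[OF V u xV(2), of "\<delta>/2"] \<delta> by (metis half_gt_zero)
  \<comment> \<open>the last bound keeps the support of the moving mollifier inside the ball of radius R\<close>
  define e where "e = min (min e1 e2) (R - norm X)"
  have e: "e > 0" "e \<le> e1" "e \<le> e2" "e \<le> R - norm X" using e1 e2 X by (auto simp: e_def)
  obtain \<theta> where \<theta>: "smooth_on UNIV \<theta>" "\<And>y. 0 \<le> \<theta> y" "\<And>y. dist x y \<ge> e \<Longrightarrow> \<theta> y = 0"
      "(LINT y|lborel. \<theta> y) = (1::real)"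
    using mollifier[OF e(1)] by metis
  define \<Theta> where "\<Theta> = (\<lambda>s y. complex_of_real (\<theta> (y - s *\<^sub>R X)))"
  define N where "N = (\<lambda>s. cball (x + s *\<^sub>R X) e)"
  have N: "compact (N s)" for s by (simp add: N_def)
  have NR: "N s \<subseteq> cball x R" if "s \<in> {0..1}" for s
  proof
    fix y assume "y \<in> N s"
    then have "dist (x + s *\<^sub>R X) y \<le> e" by (simp add: N_def)
    moreover have "dist x (x + s *\<^sub>R X) \<le> norm X" using that by (simp add: dist_norm mult_left_le_one_le)
    ultimately show "y \<in> cball x R" using e(4) dist_triangle[of x y "x + s *\<^sub>R X"] by simp
  qed
  have NV: "N s \<subseteq> V" and NC: "N s \<subseteq> cbox a b" if "s \<in> {0..1}" for s using NR[OF that] C by auto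
  have \<theta>s: "smooth_on UNIV (\<lambda>y. \<theta> (y - s *\<^sub>R X))" for s
    by (rule smooth_on_compose[OF _ \<theta>(1)])
       (auto intro!: smooth_on_diff smooth_on_linear[OF _ bounded_linear_ident] smooth_on_const)
  have off: "\<theta> (y - s *\<^sub>R X) = 0" if "y \<notin> N s" for y s
    using that by (intro \<theta>(3)) (simp add: N_def dist_norm algebra_simps)
  have test: "test_function V (\<Theta> s)" if "s \<in> {0..1}" for s
    unfolding \<Theta>_def by (rule test_of_real[OF \<theta>s N NV[OF that] off])
  have one: "(LINT y|lborel. \<theta> (y - s *\<^sub>R X)) = 1" for s
    using lborel_integral_translate[of \<theta> "- (s *\<^sub>R X)"] \<theta>(4)
      borel_measurable_continuous_onI[OF smooth_on_continuous[OF \<theta>(1)]] by (simp add: algebra_simps)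
  have avg: "norm ((LINT y:V|lborel. h y * \<Theta> s y) - c) \<le> \<eta>'"
    if "s \<in> {0..1}" "continuous_on V h" "\<And>y. y \<in> N s \<Longrightarrow> norm (h y - c) \<le> \<eta>'" for s h c \<eta>'
    unfolding \<Theta>_def
    by (rule average_bound[OF N NV[OF that(1)] smooth_on_continuous[OF \<theta>s] \<theta>(2) off one that(2,3)])
  \<comment> \<open>its derivative is the average of G, so F 1 - F 0 is close to G x; the ends are close to u x
    and u (x + X)\<close>
  define F where "F = (\<lambda>s. LINT y:V|lborel. u y * \<Theta> s y)"
  have \<theta>c: "smooth_on UNIV (\<lambda>y. complex_of_real (\<theta> y))"
    by (rule smooth_on_linear_compose[OF bounded_linear_of_real \<theta>(1)])
  let ?T = "\<lambda>y. complex_of_real (\<theta> y)"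
  have uC: "continuous_on (cbox a b) u" using u C(2) continuous_on_subset by blast
  have D\<Theta>: "D (\<Theta> s) y v = D ?T (y - s *\<^sub>R X) v" for s y v
  proof -
    have "((\<lambda>y. y - s *\<^sub>R X) has_derivative (\<lambda>h. h)) (at y)" by (auto intro!: derivative_eq_intros)
    from has_derivative_D[OF has_derivative_compose[OF this smooth_on_D[OF \<theta>c]]]
    show ?thesis by (simp add: \<Theta>_def)
  qed
  have FC: "F s = integral (cbox a b) (\<lambda>y. u y * \<Theta> s y)" if s: "s \<in> {0..1}" for s
    unfolding F_def
    by (rule compact_support_integral_cbox[OF N NC[OF s] C(2)])
       (use off in \<open>auto simp: \<Theta>_def intro!: continuous_intros uC
          continuous_on_subset[OF smooth_on_continuous[OF \<theta>s]]\<close>)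
  have contD: "continuous_on UNIV (\<lambda>y. D ?T y X)"
    by (rule smooth_on_continuous[OF smooth_on_derivative[OF \<theta>c]])
  have "((\<lambda>s. integral (cbox a b) (\<lambda>y. u y * \<Theta> s y)) has_vector_derivative
      integral (cbox a b) (\<lambda>y. u y * (- D ?T (y - s *\<^sub>R X) X))) (at s within {0..1})" if s: "s \<in> {0..1}" for s
  proof (rule leibniz_rule_vector_derivative)
    fix s y
    have "((\<lambda>s. y - s *\<^sub>R X) has_derivative (\<lambda>h. h *\<^sub>R (- X))) (at s within {0..1})"
      by (auto intro!: derivative_eq_intros)
    from has_derivative_compose[OF this smooth_on_D[OF \<theta>c]]
    have "((\<lambda>s. \<Theta> s y) has_derivative (\<lambda>h. D ?T (y - s *\<^sub>R X) (h *\<^sub>R (- X)))) (at s within {0..1})"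
      by (simp add: \<Theta>_def)
    moreover have "D ?T (y - s *\<^sub>R X) (h *\<^sub>R (- X)) = h *\<^sub>R (- D ?T (y - s *\<^sub>R X) X)" for h
      using has_derivative_linear[OF smooth_on_D[OF \<theta>c, of "y - s *\<^sub>R X"]]
      by (simp only: linear_scale linear_neg UNIV_I)
    ultimately have "((\<lambda>s. \<Theta> s y) has_vector_derivative (- D ?T (y - s *\<^sub>R X) X)) (at s within {0..1})"
      by (simp add: has_vector_derivative_def)
    from bounded_linear.has_vector_derivative[OF bounded_linear_mult_right this, of "u y"]
    show "((\<lambda>s. u y * \<Theta> s y) has_vector_derivative u y * (- D ?T (y - s *\<^sub>R X) X)) (at s within {0..1})" .
  next
    show "(\<lambda>y. u y * \<Theta> s y) integrable_on cbox a b" for s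
      unfolding \<Theta>_def
      by (intro integrable_continuous continuous_intros uC continuous_on_subset[OF smooth_on_continuous[OF \<theta>s]]) auto
    show "continuous_on ({0..1} \<times> cbox a b) (\<lambda>(s, y). u y * (- D ?T (y - s *\<^sub>R X) X))"
      unfolding split_beta
      by (intro continuous_intros continuous_on_compose2[OF contD] continuous_on_compose2[OF uC]) auto
  qed (use s in auto)
  moreover have "integral (cbox a b) (\<lambda>y. u y * (- D ?T (y - s *\<^sub>R X) X)) = (LINT y:V|lborel. G y * \<Theta> s y)"
    if s: "s \<in> {0..1}" for s
  proof -
    have "integral (cbox a b) (\<lambda>y. u y * D (\<Theta> s) y X) = (LINT y:V|lborel. u y * D (\<Theta> s) y X)"
    proof (rule compact_support_integral_cbox[OF N NC[OF s] C(2), symmetric])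
      show "continuous_on (cbox a b) (\<lambda>y. u y * D (\<Theta> s) y X)"
        unfolding D\<Theta> by (intro continuous_intros uC continuous_on_compose2[OF contD]) auto
      show "u y * D (\<Theta> s) y X = 0" if "y \<notin> N s" for y
        using derivative_zero_off_support[OF compact_imp_closed[OF N], of s "\<Theta> s" y X] off that
        by (simp add: \<Theta>_def)
    qed
    then show ?thesis using weak[OF test[OF s]] unfolding D\<Theta> by simp
  qed
  ultimately have F': "(F has_vector_derivative (LINT y:V|lborel. G y * \<Theta> s y)) (at s within {0..1})"
    if s: "s \<in> {0..1}" for s
    by (intro has_vector_derivative_transform[OF s FC]) (use that in auto)
  have "((\<lambda>s. (LINT y:V|lborel. G y * \<Theta> s y)) has_integral F 1 - F 0) {0..1}"
    by (rule fundamental_theorem_of_calculus[OF _ F']) auto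
  moreover have "((\<lambda>s. G x) has_integral G x) {0..1::real}"
    using has_integral_const_real[of "G x" 0 1] by simp
  ultimately have int: "((\<lambda>s. (LINT y:V|lborel. G y * \<Theta> s y) - G x) has_integral (F 1 - F 0 - G x)) (cbox 0 1)"
    unfolding cbox_interval by (rule has_integral_diff)
  have \<eta>0: "\<eta> \<ge> 0" using \<eta>[of x] R by simp
  have "norm (F 1 - F 0 - G x) \<le> \<eta> * measure lborel (cbox 0 (1::real))"
  proof (rule has_integral_bound[OF \<eta>0 int])
    fix s :: real assume s: "s \<in> cbox 0 1"
    then show "norm ((LINT y:V|lborel. G y * \<Theta> s y) - G x) \<le> \<eta>"
      using NR[of s] by (intro avg G \<eta>) auto
  qed
  then have 1: "norm (F 1 - F 0 - G x) \<le> \<eta>" by simp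
  have 2: "norm (F 0 - u x) \<le> \<delta>/2"
    unfolding F_def by (rule avg[OF _ u]) (use e e1(2) in \<open>auto simp: N_def\<close>)
  have 3: "norm (F 1 - u (x + X)) \<le> \<delta>/2"
    unfolding F_def by (rule avg[OF _ u]) (use e e2(2) in \<open>auto simp: N_def\<close>)
  have "u (x + X) - u x - G x = (F 1 - F 0 - G x) + (F 0 - u x) - (F 1 - u (x + X))" by simp
  also have "norm \<dots> \<le> norm (F 1 - F 0 - G x) + norm (F 0 - u x) + norm (F 1 - u (x + X))"
    by (meson norm_triangle_ineq norm_triangle_ineq4 add_right_mono order_trans)
  finally show "norm (u (x + X) - u x - G x) \<le> \<eta> + \<delta>" using 1 2 3 by linarith
qed

text \<open>The increment of \<open>u\<close> along \<open>X\<close> is compared with its weak derivative along the constant field \<open>X\<close>,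
  whose oscillation near \<open>x\<close> is small relative to \<open>X\<close> by continuity of the weak gradient.\<close>

theorem weak_gradient_has_derivative:
  fixes u :: "real ^ 'm \<Rightarrow> complex"
  assumes V: "open V" and u: "continuous_on V u" and g: "\<And>k. continuous_on V (g k)"
    and weak_deriv: "\<And>k. weak_deriv V u (\<lambda>_. axis k 1) (g k)" and x: "x \<in> V"
  shows "(u has_derivative (\<lambda>X. \<Sum>k\<in>UNIV. of_real (X $ k) * g k x)) (at x)"
  unfolding has_derivative_at_alt
proof (intro conjI allI impI)
  let ?G = "\<lambda>X t. \<Sum>k\<in>UNIV. of_real (X $ k) * g k t"
  show "bounded_linear (\<lambda>X. ?G X x)"
    unfolding linear_conv_bounded_linear[symmetric]
    by (rule linearI) (auto simp: distrib_right sum.distrib scaleR_sum_right complex_eq_iff algebra_simps)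
  have cG: "continuous_on V (?G X)" for X by (intro continuous_intros g)
  have weak: "(LINT t:V|lborel. u t * D \<theta> t X) = - (LINT t:V|lborel. ?G X t * \<theta> t)"
    if \<theta>: "test_function V \<theta>" for \<theta> X
  proof -
    have sm: "smooth_on UNIV \<theta>" using \<theta> by (simp add: test_function_def)
    have dvk: "div_mult (\<lambda>_. axis k 1) \<theta> t = partial k \<theta> t" for k t
    proof -
      have "(\<lambda>s. axis k 1 $ j * \<theta> s) = (if j = k then \<theta> else (\<lambda>_. 0))" for j
        by (auto simp: axis_def fun_eq_iff)
      then show ?thesis
        by (simp add: div_mult_def if_distrib[of "\<lambda>f. D f t _"] frechet_derivative_const cong: if_cong)
    qed
    have k: "(LINT t:V|lborel. u t * partial k \<theta> t) = - (LINT t:V|lborel. g k t * \<theta> t)" for k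
      using weak_derivD[OF weak_deriv[of k] \<theta>] by (simp add: dvk)
    have D: "D \<theta> t X = (\<Sum>k\<in>UNIV. of_real (X $ k) * partial k \<theta> t)" for t
    proof -
      have lin: "linear (D \<theta> t)" by (rule has_derivative_linear[OF smooth_on_D[OF sm]]) simp
      have "X = (\<Sum>k\<in>UNIV. X $ k *\<^sub>R axis k 1)"
        by (simp add: vec_eq_iff axis_def if_distrib cong: if_cong)
      then have "D \<theta> t X = D \<theta> t (\<Sum>k\<in>UNIV. X $ k *\<^sub>R axis k 1)" by simp
      also have "\<dots> = (\<Sum>k\<in>UNIV. of_real (X $ k) * partial k \<theta> t)"
        by (simp add: linear_sum[OF lin] linear_scale[OF lin] complex_eq_iff)
      finally show ?thesis .
    qed
    have i1: "set_integrable lborel V (\<lambda>t. of_real (X $ k) * (u t * partial k \<theta> t))" for k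
      by (intro set_integrable_mult_right test_integrable u test_derivative \<theta>)
    have i2: "set_integrable lborel V (\<lambda>t. of_real (X $ k) * (g k t * \<theta> t))" for k
      by (intro set_integrable_mult_right test_integrable g \<theta>)
    have "(LINT t:V|lborel. u t * D \<theta> t X) = (LINT t:V|lborel. \<Sum>k\<in>UNIV. of_real (X $ k) * (u t * partial k \<theta> t))"
      by (simp add: D sum_distrib_left ac_simps)
    also have "\<dots> = (\<Sum>k\<in>UNIV. LINT t:V|lborel. of_real (X $ k) * (u t * partial k \<theta> t))"
      by (rule conjunct2[OF set_integral_sum_complex[OF finite]]) (rule i1)
    also have "\<dots> = - (\<Sum>k\<in>UNIV. LINT t:V|lborel. of_real (X $ k) * (g k t * \<theta> t))"
      by (simp add: k sum_negf)
    also have "(\<Sum>k\<in>UNIV. LINT t:V|lborel. of_real (X $ k) * (g k t * \<theta> t)) = (LINT t:V|lborel. ?G X t * \<theta> t)"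
      using set_integral_sum_complex[of UNIV lborel V "\<lambda>k t. of_real (X $ k) * (g k t * \<theta> t)"] i2
      unfolding sum_distrib_right mult.assoc by (metis finite)
    finally show ?thesis .
  qed
  fix e :: real assume e: "e > 0"
  define \<eta> where "\<eta> = e / CARD('m)"
  have \<eta>: "\<eta> > 0" using e by (simp add: \<eta>_def)
  have "\<forall>k. \<exists>r>0. \<forall>y\<in>cball x r. norm (g k y - g k x) \<le> \<eta>"
    using continuous_nbhd[OF V g x \<eta>] by metis
  then obtain r where r: "\<And>k. r k > 0" "\<And>k y. y \<in> cball x (r k) \<Longrightarrow> norm (g k y - g k x) \<le> \<eta>" by metis
  obtain a b where ab: "cbox a b \<subseteq> V" "x \<in> box a b"
    using V x open_contains_cbox by (metis)
  obtain r0 where r0: "r0 > 0" "cball x r0 \<subseteq> box a b" using ab(2) open_box open_contains_cball by blast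
  define R where "R = min r0 (Min (range r))"
  have Rr: "R \<le> r k" for k unfolding R_def by (intro min.coboundedI2 Min_le) auto
  have R: "R > 0" "R \<le> r0" using r0 r(1) by (auto simp: R_def)
  show "\<exists>d>0. \<forall>y. norm (y - x) < d \<longrightarrow> norm (u y - u x - ?G (y - x) x) \<le> e * norm (y - x)"
  proof (intro exI[of _ R] conjI allI impI)
    fix y assume y: "norm (y - x) < R"
    let ?X = "y - x"
    have "norm (u (x + ?X) - u x - ?G ?X x) \<le> e * norm ?X"
    proof (rule weak_increment[OF V u cG weak _ ab(1) y])
      show "cball x R \<subseteq> cbox a b"
        using r0(2) R(2) box_subset_cbox[of a b] by (auto simp: subset_iff)
      fix z assume z: "z \<in> cball x R"
      have "norm (?G ?X z - ?G ?X x) = norm (\<Sum>k\<in>UNIV. of_real (?X $ k) * (g k z - g k x))"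
        by (simp add: sum_subtractf right_diff_distrib)
      also have "\<dots> \<le> (\<Sum>k\<in>(UNIV :: 'm set). norm ?X * \<eta>)"
      proof (rule sum_norm_le)
        fix k
        have "norm (g k z - g k x) \<le> \<eta>" by (rule r(2)) (use z Rr[of k] in auto)
        then show "norm (of_real (?X $ k) * (g k z - g k x)) \<le> norm ?X * \<eta>"
          unfolding norm_mult norm_of_real using component_le_norm_cart[of ?X k] by (intro mult_mono) auto
      qed
      also have "\<dots> = e * norm ?X" by (simp add: \<eta>_def)
      finally show "norm (?G ?X z - ?G ?X x) \<le> e * norm ?X" .
    qed
    then show "norm (u y - u x - ?G ?X x) \<le> e * norm ?X" by simp
  qed (use R in auto)
qed

section \<open>Linear algebra of generic submanifolds and holomorphic submersions\<close>

lemma span_image_sum: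
  assumes "finite I" "x \<in> span (n ` I)"
  shows "\<exists>c. x = (\<Sum>i\<in>I. c i *\<^sub>R (n i :: 'a::real_vector))"
proof -
  let ?S = "range (\<lambda>c. \<Sum>i\<in>I. c i *\<^sub>R n i)"
  have "subspace ?S"
  proof (rule subspaceI)
    show "0 \<in> ?S" by (rule range_eqI[of _ _ "\<lambda>_. 0"]) simp
    fix x y assume "x \<in> ?S" "y \<in> ?S"
    then obtain c c' where "x = (\<Sum>i\<in>I. c i *\<^sub>R n i)" "y = (\<Sum>i\<in>I. c' i *\<^sub>R n i)" by blast
    then show "x + y \<in> ?S"
      by (intro range_eqI[of _ _ "\<lambda>i. c i + c' i"]) (simp add: scaleR_add_left sum.distrib)
  next
    fix a x assume "x \<in> ?S"
    then obtain c where "x = (\<Sum>i\<in>I. c i *\<^sub>R n i)" by blast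
    then show "a *\<^sub>R x \<in> ?S" by (intro range_eqI[of _ _ "\<lambda>i. a * c i"]) (simp add: scaleR_sum_right)
  qed
  moreover have "n ` I \<subseteq> ?S"
  proof
    fix y assume "y \<in> n ` I"
    then obtain k where k: "k \<in> I" "y = n k" by blast
    show "y \<in> ?S"
      by (rule range_eqI[of _ _ "\<lambda>i. if i = k then 1 else 0"])
         (use k assms(1) in \<open>simp add: if_distrib[of "\<lambda>a. a *\<^sub>R _"] cong: if_cong\<close>)
  qed
  ultimately have "span (n ` I) \<subseteq> ?S" by (rule span_minimal[rotated])
  with assms(2) show ?thesis by blast
qed

text \<open>Represent \<open>\<mu> j\<close> as the inner product with a vector \<open>n j\<close>. The component of \<open>n j\<close> orthogonal to the other
  vectors is nonzero by independence, and a multiple of it is dual to \<open>\<mu> j\<close>.\<close>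

lemma dual_vectors:
  fixes \<mu> :: "nat \<Rightarrow> 'a::euclidean_space \<Rightarrow> real"
  assumes lin: "\<And>j. j < d \<Longrightarrow> linear (\<mu> j)"
    and indep: "\<And>c. (\<And>X. (\<Sum>j<d. c j * \<mu> j X) = 0) \<Longrightarrow> \<forall>j<d. c j = 0"
  obtains e where "\<And>i j. i < d \<Longrightarrow> j < d \<Longrightarrow> \<mu> i (e j) = (if i = j then 1 else 0)"
    "subspace {X. \<forall>j<d. \<mu> j X = 0}" "dim {X. \<forall>j<d. \<mu> j X = 0} + d = DIM('a)"
proof -
  define n where "n = (\<lambda>j. \<Sum>b\<in>Basis. \<mu> j b *\<^sub>R b)"
  have n: "\<mu> j X = n j \<bullet> X" if "j < d" for j X
  proof -
    have "\<mu> j X = (\<Sum>b\<in>Basis. (X \<bullet> b) *\<^sub>R \<mu> j b)" by (rule linear_Basis_expansion[OF lin[OF that]])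
    then show ?thesis by (simp add: n_def inner_sum_left inner_commute[of X] mult.commute)
  qed
  have "\<exists>e. \<forall>i<d. \<mu> i e = (if i = j then 1 else 0)" if j: "j < d" for j
  proof -
    let ?I = "{..<d} - {j}"
    obtain y z where yz: "y \<in> span (n ` ?I)" "\<And>w. w \<in> span (n ` ?I) \<Longrightarrow> orthogonal z w" "n j = y + z"
      using orthogonal_subspace_decomp_exists[of "n ` ?I" "n j"] by metis
    have "z \<noteq> 0"
    proof
      assume "z = 0"
      then have "n j \<in> span (n ` ?I)" using yz by simp
      then obtain c where c: "n j = (\<Sum>i\<in>?I. c i *\<^sub>R n i)" using span_image_sum[of ?I] by blast
      \<comment> \<open>otherwise n j would be a combination of the others, a linear relation\<close>
      have "(\<Sum>i<d. (c(j := -1)) i * \<mu> i X) = 0" for X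
      proof -
        have "(\<Sum>i<d. (c(j := -1)) i * \<mu> i X) = - \<mu> j X + (\<Sum>i\<in>?I. c i * \<mu> i X)"
          using j by (subst sum.remove[of _ j]) (auto intro!: sum.cong)
        also have "(\<Sum>i\<in>?I. c i * \<mu> i X) = (\<Sum>i\<in>?I. c i *\<^sub>R n i) \<bullet> X"
          using n by (simp add: inner_sum_left)
        finally show ?thesis using n[OF j] c by simp
      qed
      then have "(c(j := -1)) j = 0" using indep j by blast
      then show False by simp
    qed
    have z0: "z \<bullet> n i = 0" if "i < d" "i \<noteq> j" for i
      using yz(2)[of "n i"] that by (simp add: span_base orthogonal_def)
    have zj: "z \<bullet> n j = z \<bullet> z"
      using yz(2)[OF yz(1)] yz(3) by (simp add: orthogonal_def inner_add_right)
    show ?thesis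
    proof (intro exI allI impI)
      fix i assume i: "i < d"
      show "\<mu> i ((1 / (z \<bullet> z)) *\<^sub>R z) = (if i = j then 1 else 0)"
        using n[OF i] z0[OF i] zj \<open>z \<noteq> 0\<close> by (auto simp: inner_commute)
    qed
  qed
  then obtain e where e: "\<And>i j. i < d \<Longrightarrow> j < d \<Longrightarrow> \<mu> i (e j) = (if i = j then 1 else 0)" by metis
  have ne: "n i \<bullet> e j = (if i = j then 1 else 0)" if "i < d" "j < d" for i j using n e that by metis
  have inj: "inj_on n {..<d}"
    by (rule inj_onI) (metis ne lessThan_iff zero_neq_one)
  have ind: "independent (n ` {..<d})"
  proof (rule independent_if_scalars_zero)
    fix f x assume s: "(\<Sum>y\<in>n ` {..<d}. f y *\<^sub>R y) = 0" and "x \<in> n ` {..<d}"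
    then obtain j where j: "j < d" "x = n j" by blast
    have "0 = (\<Sum>y\<in>n ` {..<d}. f y *\<^sub>R y) \<bullet> e j" using s by simp
    also have "\<dots> = (\<Sum>i<d. f (n i) * (n i \<bullet> e j))"
      by (simp add: sum.reindex[OF inj] inner_sum_left)
    also have "\<dots> = (\<Sum>i<d. if i = j then f (n i) else 0)"
      using ne j by (intro sum.cong) auto
    also have "\<dots> = f x" using j by simp
    finally show "f x = 0" by simp
  qed simp
  have "dim (span (n ` {..<d})) = d"
    using dim_eq_card_independent[OF ind] card_image[OF inj] by simp
  moreover have "{X. \<forall>j<d. \<mu> j X = 0} = {y \<in> UNIV. \<forall>x\<in>span (n ` {..<d}). orthogonal x y}"
  proof (intro set_eqI iffI)
    fix X assume "X \<in> {X. \<forall>j<d. \<mu> j X = 0}"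
    then have "\<And>y. y \<in> n ` {..<d} \<Longrightarrow> orthogonal X y" using n by (auto simp: orthogonal_def inner_commute)
    then show "X \<in> {y \<in> UNIV. \<forall>x\<in>span (n ` {..<d}). orthogonal x y}"
      using orthogonal_to_span orthogonal_commute by blast
  next
    fix X assume "X \<in> {y \<in> UNIV. \<forall>x\<in>span (n ` {..<d}). orthogonal x y}"
    then show "X \<in> {X. \<forall>j<d. \<mu> j X = 0}" using n by (auto simp: orthogonal_def span_base)
  qed
  ultimately have "dim {X. \<forall>j<d. \<mu> j X = 0} + d = DIM('a)"
    using dim_subspace_orthogonal_to_vectors[of "span (n ` {..<d})" UNIV] by (simp add: dim_UNIV)
  moreover have "subspace {X. \<forall>j<d. \<mu> j X = 0}"
    by (rule subspaceI) (auto simp: linear_0[OF lin] linear_add[OF lin] linear_scale[OF lin])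
  ultimately show thesis using that e by blast
qed

text \<open>The complex linear extension of the identity from \<open>complex ^ 'n\<close> to its complexification. On the
  complexification of \<open>M\<close> it is the continuation of the coordinates \<open>Z\<close>; on complex tangent vectors its
  kernel is the space of vectors of type (0,1).\<close>

definition zmap :: "(complex ^ 'n) \<times> (complex ^ 'n) \<Rightarrow> complex ^ 'n" where
  "zmap W = fst W + \<i> *s snd W"

lemma linear_zmap: "linear zmap"
  by (rule linearI) (auto simp: zmap_def vec_eq_iff complex_eq_iff algebra_simps)

lemma zmap_jp: "zmap (jp W) = \<i> *s zmap W"
  by (simp add: zmap_def jp_def vec_eq_iff complex_eq_iff)

lemma zmap_holo: "holo jp jv S zmap"
  by (rule holo_linear_map) (simp_all add: linear_zmap zmap_jp)

lemma T01_iff: "W \<in> T01 \<longleftrightarrow> zmap W = 0"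
proof -
  have "zmap (X, Y) = 0 \<longleftrightarrow> Y = \<i> *s X" for X Y :: "complex ^ 'n"
  proof -
    have "a + \<i> * b = 0 \<longleftrightarrow> b = \<i> * a" for a b by (auto simp: complex_eq_iff)
    then show ?thesis by (simp add: zmap_def vec_eq_iff)
  qed
  then show ?thesis by (cases W) (auto simp: T01_def)
qed

text \<open>Genericity says that the tangent space spans over the complex numbers: a real functional that
  vanishes on \<open>T + \<i>T\<close> would give a linear relation between the \<open>\<partial>\<rho>\<^sub>j\<close>.\<close>

lemma generic_spans:
  fixes \<rho> :: "nat \<Rightarrow> complex ^ 'n \<Rightarrow> real"
  assumes lin: "\<And>j. j < d \<Longrightarrow> linear (D (\<rho> j) p)"
    and e: "\<And>i j. i < d \<Longrightarrow> j < d \<Longrightarrow> D (\<rho> i) p (e j) = (if i = j then 1 else 0)"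
    and gen: "\<And>c :: nat \<Rightarrow> complex. (\<Sum>j<d. c j *s del (\<rho> j) p) = 0 \<Longrightarrow> \<forall>j<d. c j = 0"
  shows "\<exists>x y. (\<forall>j<d. D (\<rho> j) p x = 0) \<and> (\<forall>j<d. D (\<rho> j) p y = 0) \<and> x + \<i> *s y = Z"
proof -
  let ?T = "{X. \<forall>j<d. D (\<rho> j) p X = 0}"
  define S where "S = {x + \<i> *s y | x y. x \<in> ?T \<and> y \<in> ?T}"
  have T: "subspace ?T"
    by (rule subspaceI) (auto simp: linear_0[OF lin] linear_add[OF lin] linear_scale[OF lin])
  have "subspace S"
  proof (rule subspaceI)
    have "0 = 0 + \<i> *s (0 :: complex ^ 'n)" by simp
    then show "0 \<in> S" unfolding S_def using subspace_0[OF T] by blast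
    fix u v assume "u \<in> S" "v \<in> S"
    then obtain x y x' y' where *: "u = x + \<i> *s y" "v = x' + \<i> *s y'" "x \<in> ?T" "y \<in> ?T" "x' \<in> ?T" "y' \<in> ?T"
      unfolding S_def by blast
    have "u + v = (x + x') + \<i> *s (y + y')" using * by (simp add: vector_add_ldistrib)
    then show "u + v \<in> S" unfolding S_def using subspace_add[OF T] * by blast
  next
    fix a u assume "u \<in> S"
    then obtain x y where *: "u = x + \<i> *s y" "x \<in> ?T" "y \<in> ?T" unfolding S_def by blast
    have "a *\<^sub>R u = a *\<^sub>R x + \<i> *s (a *\<^sub>R y)" using * by (simp add: scaleR_add_right jv_scaleR)
    then show "a *\<^sub>R u \<in> S" unfolding S_def using subspace_scale[OF T] * by blast
  qed
  \<comment> \<open>z is the component of Z orthogonal to T + \<i>T; the inner product with z then depends on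
    the D (\<rho> j) p only\<close>
  obtain y z where yz: "y \<in> span S" "\<And>w. w \<in> span S \<Longrightarrow> orthogonal z w" "Z = y + z"
    using orthogonal_subspace_decomp_exists[of S Z] by metis
  have zS: "z \<bullet> w = 0" if "w \<in> S" for w using yz(2)[OF span_base[OF that]] by (simp add: orthogonal_def)
  have proj: "X - (\<Sum>j<d. D (\<rho> j) p X *\<^sub>R e j) \<in> ?T" for X
  proof -
    have "D (\<rho> i) p (\<Sum>j<d. D (\<rho> j) p X *\<^sub>R e j) = D (\<rho> i) p X" if "i < d" for i
      using that by (simp add: linear_sum[OF lin] linear_scale[OF lin] e if_distrib cong: if_cong)
    then show ?thesis by (simp add: linear_diff[OF lin])
  qed
  have T0: "z \<bullet> x = 0" "z \<bullet> (\<i> *s x) = 0" if "x \<in> ?T" for x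
  proof -
    have "x = x + \<i> *s 0" "\<i> *s x = 0 + \<i> *s x" by (simp_all add: vec_eq_iff)
    then have "x \<in> S" "\<i> *s x \<in> S" unfolding S_def using that subspace_0[OF T] by blast+
    then show "z \<bullet> x = 0" "z \<bullet> (\<i> *s x) = 0" by (auto intro: zS)
  qed
  have c: "z \<bullet> X = (\<Sum>j<d. D (\<rho> j) p X * (z \<bullet> e j))" for X
    using T0(1)[OF proj[of X]] by (simp add: inner_diff_right inner_sum_right)
  have b: "z \<bullet> (\<i> *s X) = (\<Sum>j<d. D (\<rho> j) p X * (z \<bullet> (\<i> *s e j)))" for X
  proof -
    have "linear (\<lambda>X. z \<bullet> (\<i> *s X))"
      by (intro linear_compose[OF linear_jv, unfolded o_def, of "\<lambda>x. z \<bullet> x"])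
         (simp add: linear_conv_bounded_linear bounded_linear_inner_right)
    from linear_diff[OF this, of X "\<Sum>j<d. D (\<rho> j) p X *\<^sub>R e j"] T0(2)[OF proj[of X]]
    show ?thesis by (simp add: linear_sum[OF \<open>linear (\<lambda>X. z \<bullet> (\<i> *s X))\<close>] linear_scale[OF \<open>linear (\<lambda>X. z \<bullet> (\<i> *s X))\<close>])
  qed
  have ii: "\<i> *s axis k 1 = axis k \<i>" "\<i> *s axis k \<i> = - axis k 1" for k :: 'n
    by (auto simp: vec_eq_iff axis_def)
  \<comment> \<open>the coefficients of the resulting relation between the \<partial>\<rho>\<close>
  define C where "C = (\<lambda>j. Complex (z \<bullet> e j) (z \<bullet> (\<i> *s e j)))"
  have "(\<Sum>j<d. C j *s del (\<rho> j) p) = 0"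
  proof (rule vec_eq_iff[THEN iffD2, rule_format])
    fix k :: 'n
    have 1: "z \<bullet> axis k 1 = (\<Sum>j<d. D (\<rho> j) p (axis k 1) * (z \<bullet> e j))" by (rule c)
    have 2: "z \<bullet> axis k \<i> = (\<Sum>j<d. D (\<rho> j) p (axis k \<i>) * (z \<bullet> e j))" by (rule c)
    have 3: "z \<bullet> axis k \<i> = (\<Sum>j<d. D (\<rho> j) p (axis k 1) * (z \<bullet> (\<i> *s e j)))"
      using b[of "axis k 1"] ii by simp
    have 4: "- (z \<bullet> axis k 1) = (\<Sum>j<d. D (\<rho> j) p (axis k \<i>) * (z \<bullet> (\<i> *s e j)))"
      using b[of "axis k \<i>"] ii by simp
    have "(\<Sum>j<d. C j *s del (\<rho> j) p) $ k = (\<Sum>j<d. C j * del (\<rho> j) p $ k)" by simp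
    also have "\<dots> = Complex
       ((\<Sum>j<d. D (\<rho> j) p (axis k 1) * (z \<bullet> e j)) / 2 + (\<Sum>j<d. D (\<rho> j) p (axis k \<i>) * (z \<bullet> (\<i> *s e j))) / 2)
       ((\<Sum>j<d. D (\<rho> j) p (axis k 1) * (z \<bullet> (\<i> *s e j))) / 2 - (\<Sum>j<d. D (\<rho> j) p (axis k \<i>) * (z \<bullet> e j)) / 2)"
      by (rule complex_eqI; simp add: Re_sum Im_sum C_def del_def sum_divide_distrib
            flip: sum.distrib sum_subtractf; intro sum.cong refl; simp add: field_simps)
    also have "\<dots> = 0" unfolding 1[symmetric] 2[symmetric] 3[symmetric] 4[symmetric] by (simp add: complex_eq_iff)
    finally show "(\<Sum>j<d. C j *s del (\<rho> j) p) $ k = 0 $ k" by simp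
  qed
  then have "\<forall>j<d. C j = 0" by (rule gen)
  then have "z \<bullet> e j = 0" if "j < d" for j using that by (simp add: C_def complex_eq_iff)
  then have "z \<bullet> z = 0" using c[of z] by simp
  then have "Z \<in> S" using yz \<open>subspace S\<close> by (simp add: span_eq_iff[THEN iffD2])
  then show ?thesis unfolding S_def by blast
qed

lemma holo_D_cscale: "holo I J S f \<Longrightarrow> x \<in> S \<Longrightarrow> D f x (cscale I w v) = cscale J w (D f x v)"
  using cscale_commute[of "D f x" I J w v] holo_linear[of I J S f x] holo_D_commute[of I J S f x] by blast

lemma linear_vec_expand:
  fixes f :: "complex ^ 'm \<Rightarrow> 'b::real_normed_vector"
  assumes lin: "linear f" and com: "\<And>v. f (\<i> *s v) = J (f v)"
  shows "f c = (\<Sum>k\<in>UNIV. cscale J (c $ k) (f (axis k 1)))"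
proof -
  have e: "c = (\<Sum>k\<in>UNIV. cscale jv (c $ k) (axis k 1))"
    by (simp add: vec_eq_iff axis_def if_distrib cong: if_cong)
  have "f c = f (\<Sum>k\<in>UNIV. cscale jv (c $ k) (axis k 1))" by (rule arg_cong[OF e])
  also have "\<dots> = (\<Sum>k\<in>UNIV. cscale J (c $ k) (f (axis k 1)))"
    unfolding linear_sum[OF lin] by (intro sum.cong refl cscale_commute[of f jv J, OF lin com])
  finally show ?thesis .
qed

lemma holo_D_vec:
  assumes f: "holo jv J S f" and x: "x \<in> S"
  shows "D f x c = (\<Sum>k\<in>UNIV. cscale J (c $ k) (D f x (axis k 1)))"
  by (rule linear_vec_expand[OF holo_linear[OF f x] holo_D_commute[OF f x]])

text \<open>Straightening a submersion: \<open>G(x) = x + R(H(x) - H(0) - H'(0) x)\<close>, with \<open>R\<close> a right inverse of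
  \<open>H'(0)\<close>, has \<open>G'(0) = 1\<close> and \<open>H'(0) G = H - H(0)\<close>. In the coordinates \<open>G\<close> the kernels of the
  differentials of \<open>H\<close> are constant, and functions that are annihilated by them factor through \<open>H\<close>.\<close>

theorem holo_submersion:
  fixes H :: "complex ^ 'm \<Rightarrow> complex ^ 'n"
  assumes H: "holo jv jv (ball 0 r0) H" and r0: "r0 > 0" and surj: "\<And>y. \<exists>x. D H 0 x = y"
  obtains r1 and l :: "'m \<Rightarrow> complex ^ 'm \<Rightarrow> complex ^ 'm" where "0 < r1" "r1 \<le> r0"
    "\<And>j. holo jv jv (ball 0 r1) (l j)"
    "\<And>x j. norm x < r1 \<Longrightarrow> D H x (l j x) = 0"
    "\<And>x c. norm x < r1 \<Longrightarrow> D H x c = 0 \<Longrightarrow> c = (\<Sum>j\<in>UNIV. c $ j *s l j x)"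
    "\<And>f r. 0 < r \<Longrightarrow> r \<le> r1 \<Longrightarrow> holo jv jc (ball 0 r) f \<Longrightarrow>
        (\<And>x c. norm x < r \<Longrightarrow> D H x c = 0 \<Longrightarrow> D f x c = 0) \<Longrightarrow>
        \<exists>U F r2. open U \<and> H 0 \<in> U \<and> holo jv jc U F \<and> 0 < r2 \<and> r2 \<le> r \<and>
            (\<forall>x. norm x < r2 \<longrightarrow> H x \<in> U \<and> F (H x) = f x)"
proof -
  have 0: "(0 :: complex ^ 'm) \<in> ball 0 r0" using r0 by simp
  define H' where "H' = D H 0"
  have linH': "linear H'" unfolding H'_def by (rule holo_linear[OF H 0])
  have jH': "H' (\<i> *s v) = \<i> *s H' v" for v unfolding H'_def by (rule holo_D_commute[OF H 0])
  have "\<forall>k. \<exists>x. H' x = axis k 1" using surj unfolding H'_def by blast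
  from choice[OF this] obtain x where x: "\<And>k. H' (x k) = axis k 1" by blast
  define R where "R = (\<lambda>y :: complex ^ 'n. \<Sum>k\<in>UNIV. y $ k *s x k)"
  have linR: "linear R"
    by (rule linearI) (auto simp: R_def vec_eq_iff complex_eq_iff sum.distrib sum_distrib_left algebra_simps)
  have jR: "R (\<i> *s y) = \<i> *s R y" for y
    by (simp add: R_def vec_eq_iff sum_distrib_left ac_simps)
  have csH': "H' (w *s v) = w *s H' v" for w v
    using cscale_commute[of H' jv jv w v, OF linH' jH'] by simp
  have H'R: "H' (R y) = y" for y
  proof -
    have "H' (R y) = (\<Sum>k\<in>UNIV. y $ k *s axis k 1)" by (simp add: R_def linear_sum[OF linH'] csH' x)
    also have "\<dots> = y" by (simp add: vec_eq_iff axis_def if_distrib cong: if_cong)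
    finally show ?thesis .
  qed
  have hR: "holo jv jv S R" and hH': "holo jv jv S' H'" for S S'
    by (rule holo_linear_map; simp add: linR jR linH' jH')+
  define G where "G = (\<lambda>x. x + R (H x - H 0 - H' x))"
  have hd: "holo jv jv (ball 0 r0) (\<lambda>x. H x - H 0 - H' x)"
    by (intro holo_diff linear_jv H holo_const hH')
  have hG: "holo jv jv (ball 0 r0) G"
    unfolding G_def by (intro holo_add linear_jv holo_ident holo_compose[OF hd hR[of UNIV]]) auto
  have "((\<lambda>x. H x - H 0 - H' x) has_derivative (\<lambda>v. H' v - 0 - H' v)) (at 0)"
    by (intro has_derivative_diff has_derivative_const linear_imp_has_derivative linH')
       (use holo_D[OF H 0] in \<open>simp add: H'_def\<close>)
  from has_derivative_add[OF has_derivative_ident has_derivative_compose[OF this linear_imp_has_derivative[OF linR]]]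
  have "(G has_derivative (\<lambda>v. v)) (at 0)" by (simp add: G_def linear_0[OF linR])
  then have DG0: "D G 0 v = v" for v by (simp add: has_derivative_D)
  have G0: "G 0 = 0" by (simp add: G_def linear_0[OF linR] linear_0[OF linH'])
  have H'G: "H' (G x) = H x - H 0" for x
    by (simp add: G_def linear_add[OF linH'] H'R)
  obtain U' V \<Gamma> where U': "open U'" "U' \<subseteq> ball 0 r0" "0 \<in> U'" and V: "open V" "G 0 \<in> V"
    and hom: "homeomorphism U' V G \<Gamma>" and h\<Gamma>: "holo jv jv V \<Gamma>"
    and G\<Gamma>: "\<And>y v. y \<in> V \<Longrightarrow> D G (\<Gamma> y) (D \<Gamma> y v) = v"
    and \<Gamma>G: "\<And>y v. y \<in> V \<Longrightarrow> D \<Gamma> y (D G (\<Gamma> y) v) = v"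
    using holo_inverse_function[OF complex_structure_jv open_ball 0 hG DG0] by metis
  have inv: "x \<in> U' \<Longrightarrow> \<Gamma> (G x) = x" "x \<in> U' \<Longrightarrow> G x \<in> V" "y \<in> V \<Longrightarrow> G (\<Gamma> y) = y" "y \<in> V \<Longrightarrow> \<Gamma> y \<in> U'" for x y
    using hom by (auto simp: homeomorphism_def)
  obtain r1' where r1': "r1' > 0" "ball 0 r1' \<subseteq> U'" using U' open_contains_ball by blast
  define r1 where "r1 = min r1' r0"
  have r1: "0 < r1" "r1 \<le> r0" "ball 0 r1 \<subseteq> U'" using r1' r0 by (auto simp: r1_def)
  have DH: "D H x v = H' (D G x v)" if "x \<in> ball 0 r0" for x v
  proof -
    have "H x = H 0 + H' (G x)" for x using H'G[of x] by simp
    then have e: "H = (\<lambda>x. H 0 + H' (G x))" by (rule ext)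
    have "((\<lambda>x. H 0 + H' (G x)) has_derivative (\<lambda>v. 0 + H' (D G x v))) (at x)"
      by (intro has_derivative_add has_derivative_const
          has_derivative_compose[OF holo_D[OF hG that] linear_imp_has_derivative[OF linH']])
    then have "D (\<lambda>x. H 0 + H' (G x)) x v = H' (D G x v)" by (simp add: has_derivative_D)
    then show ?thesis using e by metis
  qed
  \<comment> \<open>the projection onto the kernel of H' along the image of R; the fields l are the projections
    of the coordinate fields, taken in the coordinates G\<close>
  define N where "N = (\<lambda>c. c - R (H' c))"
  have H'N: "H' (N c) = 0" for c by (simp add: N_def linear_diff[OF linH'] H'R)
  define l where "l = (\<lambda>j x. D \<Gamma> (G x) (N (D G x (axis j 1))))"
  have GU: "D G x (D \<Gamma> (G x) v) = v" "D \<Gamma> (G x) (D G x v) = v" "x \<in> ball 0 r0" if "norm x < r1" for x v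
  proof -
    have "x \<in> U'" using that r1(3) by auto
    then show "D G x (D \<Gamma> (G x) v) = v" "D \<Gamma> (G x) (D G x v) = v" "x \<in> ball 0 r0"
      using G\<Gamma>[of "G x" v] \<Gamma>G[of "G x" v] inv U'(2) by auto
  qed
  have hl: "holo jv jv (ball 0 r1) (l j)" for j
  proof -
    have hc: "holo jv jv (ball 0 r1) (\<lambda>x. N (D G x (axis j 1)))"
    proof -
      have hD: "holo jv jv (ball 0 r1) (\<lambda>x. D G x (axis j 1))"
        by (rule holo_subset[OF holo_derivative[OF complex_structure_jv complex_structure_jv open_ball hG]])
           (use r1 in auto)
      have "holo jv jv (ball 0 r1) (\<lambda>x. H' (D G x (axis j 1)))"
        by (rule holo_compose[OF hD hH'[of UNIV]]) simp
      from holo_compose[OF this hR[of UNIV]] hD show ?thesis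
        unfolding N_def by (intro holo_diff linear_jv) auto
    qed
    have hk: "holo jv jv (ball 0 r1) (\<lambda>x. D \<Gamma> (G x) (axis k 1))" for k
      by (rule holo_compose[OF holo_subset[OF hG] holo_derivative[OF complex_structure_jv complex_structure_jv V(1) h\<Gamma>]])
         (use r1 inv(2) in auto)
    have hs: "holo jv jv (ball 0 r1) (\<lambda>x. \<Sum>k\<in>UNIV. cscale jv (N (D G x (axis j 1)) $ k) (D \<Gamma> (G x) (axis k 1)))"
      by (intro holo_sum linear_jv holo_cscale complex_structure_jv hk) (rule hc[unfolded holo_vec_iff, rule_format])
    show ?thesis
    proof (rule holo_transform[OF hs open_ball])
      fix x :: "complex ^ 'm" assume "x \<in> ball 0 r1"
      then have V': "G x \<in> V" using inv(2) r1(3) by blast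
      show "(\<Sum>k\<in>UNIV. cscale jv (N (D G x (axis j 1)) $ k) (D \<Gamma> (G x) (axis k 1))) = l j x"
        unfolding l_def by (rule holo_D_vec[OF h\<Gamma> V', symmetric])
    qed
  qed
  show thesis
  proof (rule that[OF r1(1,2) hl])
    fix x :: "complex ^ 'm" assume x: "norm x < r1"
    show "D H x (l j x) = 0" for j
      unfolding DH[OF GU(3)[OF x]] l_def GU(1)[OF x] by (rule H'N)
    fix c assume c: "D H x c = 0"
    then have "N (D G x c) = D G x c" unfolding DH[OF GU(3)[OF x]] N_def by (simp add: linear_0[OF linR])
    then have "c = D \<Gamma> (G x) (N (D G x c))" using GU(2)[OF x] by simp
    also have "N (D G x c) = (\<Sum>j\<in>UNIV. c $ j *s N (D G x (axis j 1)))"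
    proof -
      have linG: "linear (D G x)" by (rule holo_linear[OF hG GU(3)[OF x]])
      have linN: "linear N" unfolding N_def
        by (intro linear_compose_sub linear_id[unfolded id_def] linear_compose[OF linH' linR, unfolded o_def])
      have jN: "N (\<i> *s v) = \<i> *s N v" for v by (simp add: N_def jH' jR vec_eq_iff right_diff_distrib)
      have "N (D G x c) = (\<Sum>j\<in>UNIV. cscale jv (c $ j) (N (D G x (axis j 1))))"
        by (rule linear_vec_expand[of "\<lambda>v. N (D G x v)"])
           (auto intro: linear_compose[OF linG linN, unfolded o_def] simp: jN holo_D_commute[OF hG GU(3)[OF x]])
      then show ?thesis by simp
    qed
    also have "D \<Gamma> (G x) \<dots> = (\<Sum>j\<in>UNIV. c $ j *s l j x)"
    proof -
      have V': "G x \<in> V" using inv(2) r1(3) x by auto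
      have "D \<Gamma> (G x) (w *s v) = w *s D \<Gamma> (G x) v" for w v
        using holo_D_cscale[OF h\<Gamma> V', of w v] by simp
      then show ?thesis
        unfolding l_def linear_sum[OF holo_linear[OF h\<Gamma> V']] by simp
    qed
    finally show "c = (\<Sum>j\<in>UNIV. c $ j *s l j x)" .
  next
    fix f r assume r: "0 < r" "r \<le> r1" and f: "holo jv jc (ball 0 r) f"
      and kill: "\<And>x c. norm x < r \<Longrightarrow> D H x c = 0 \<Longrightarrow> D f x c = 0"
    have \<Gamma>0: "\<Gamma> 0 = 0" using inv(1)[OF U'(3)] G0 by simp
    have "isCont \<Gamma> 0" using holo_continuous[OF h\<Gamma>] V G0 by (simp add: continuous_on_eq_continuous_at)
    then obtain s1 where s1: "s1 > 0" "\<And>y. dist y 0 < s1 \<Longrightarrow> dist (\<Gamma> y) (\<Gamma> 0) < r"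
      using r(1) unfolding continuous_at_eps_delta by blast
    obtain s2 where s2: "s2 > 0" "ball 0 s2 \<subseteq> V" using V G0 open_contains_ball by metis
    define s where "s = min s1 s2"
    have s: "s > 0" "ball 0 s \<subseteq> V" "\<And>y. y \<in> ball 0 s \<Longrightarrow> norm (\<Gamma> y) < r"
      using s1 s2 \<Gamma>0 by (auto simp: s_def)
    define g where "g = (\<lambda>y. f (\<Gamma> y))"
    have hg: "holo jv jc (ball 0 s) g"
      unfolding g_def by (rule holo_compose[OF holo_subset[OF h\<Gamma> s(2)] f]) (use s(3) in auto)
    have gk: "D g y v = 0" if y: "y \<in> ball 0 s" and v: "H' v = 0" for y v
    proof -
      have yV: "y \<in> V" using y s(2) by blast
      have "D g y v = D f (\<Gamma> y) (D \<Gamma> y v)"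
        unfolding g_def by (rule D_compose[OF f holo_D[OF h\<Gamma> yV]]) (use s(3)[OF y] in simp)
      moreover have "D H (\<Gamma> y) (D \<Gamma> y v) = 0"
        using DH[of "\<Gamma> y" "D \<Gamma> y v"] s(3)[OF y] r r1 G\<Gamma>[OF yV] v by simp
      ultimately show ?thesis using kill s(3)[OF y] by simp
    qed
    \<comment> \<open>g is constant along the segment from R (H' y) to y, whose direction lies in the kernel of
      H'\<close>
    have gc: "g y = g (R (H' y))" if y: "y \<in> ball 0 s" and Ry: "R (H' y) \<in> ball 0 s" for y
    proof -
      let ?p = "\<lambda>t. R (H' y) + t *\<^sub>R (y - R (H' y))"
      have in_ball: "?p t \<in> ball 0 s" if "t \<in> {0..1}" for t
      proof -
        have "?p t = (1 - t) *\<^sub>R R (H' y) + t *\<^sub>R y" by (simp add: algebra_simps)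
        then show ?thesis using convexD[OF convex_ball Ry y, of "1 - t" t] that by simp
      qed
      have "((\<lambda>t. g (?p t)) has_derivative (\<lambda>h. 0)) (at t within {0..1})" if t: "t \<in> {0..1}" for t
      proof -
        have "(?p has_derivative (\<lambda>h. h *\<^sub>R (y - R (H' y)))) (at t within {0..1})"
          by (auto intro!: derivative_eq_intros)
        from has_derivative_compose[OF this holo_D[OF hg in_ball[OF t]]]
        have "((\<lambda>t. g (?p t)) has_derivative (\<lambda>h. D g (?p t) (h *\<^sub>R (y - R (H' y))))) (at t within {0..1})" .
        moreover have "D g (?p t) (h *\<^sub>R (y - R (H' y))) = 0" for h
          by (rule gk[OF in_ball[OF t]]) (simp add: linear_scale[OF linH'] linear_diff[OF linH'] H'R)
        ultimately show ?thesis by simp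
      qed
      then obtain c where c: "\<And>t. t \<in> {0..1} \<Longrightarrow> g (?p t) = c"
        using has_derivative_zero_constant[of "{0..1}" "\<lambda>t. g (?p t)"] by auto
      show ?thesis using c[of 0] c[of 1] by simp
    qed
    define U where "U = {Z. R (Z - H 0) \<in> ball 0 s}"
    have contR: "continuous_on S R" for S
      using linR linear_continuous_on linear_conv_bounded_linear by blast
    have contH': "continuous_on S H'" for S
      using linH' linear_continuous_on linear_conv_bounded_linear by blast
    have "continuous_on UNIV (\<lambda>Z. R (Z - H 0))"
      by (intro continuous_on_compose2[OF contR[of UNIV]] continuous_intros) auto
    from open_vimage[OF open_ball this, of 0 s] have U: "open U" unfolding U_def by (simp only: vimage_def)
    have cG: "continuous_on (ball 0 r) G" using holo_continuous[OF hG] r r1 by (auto intro: continuous_on_subset)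
    have cRG: "continuous_on (ball 0 r) (\<lambda>x. R (H' (G x)))"
      by (intro continuous_on_compose2[OF contR[of UNIV]] continuous_on_compose2[OF contH'[of UNIV]] cG) auto
    let ?A = "(ball 0 r \<inter> G -` ball 0 s) \<inter> (ball 0 r \<inter> (\<lambda>x. R (H' (G x))) -` ball 0 s)"
    have "open ?A"
      by (intro open_Int continuous_open_preimage[OF cG] continuous_open_preimage[OF cRG] open_ball)
    moreover have "0 \<in> ?A"
      using r s G0 by (simp add: linear_0[OF linR] linear_0[OF linH'])
    ultimately obtain r2' where r2': "r2' > 0" "ball 0 r2' \<subseteq> ?A"
      using open_contains_ball by metis
    \<comment> \<open>R maps the value Z = H x to the point R (H' (G x)) of the fibre of H' through G x\<close>
    define F where "F = (\<lambda>Z. g (R (Z - H 0)))"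
    have hF: "holo jv jc U F"
      unfolding F_def
      by (rule holo_compose[OF holo_compose[OF holo_diff[OF linear_jv holo_ident holo_const[OF linear_jv]] hR[of UNIV]] hg])
         (auto simp: U_def)
    show "\<exists>U F r2. open U \<and> H 0 \<in> U \<and> holo jv jc U F \<and> 0 < r2 \<and> r2 \<le> r \<and>
            (\<forall>x. norm x < r2 \<longrightarrow> H x \<in> U \<and> F (H x) = f x)"
    proof (intro exI conjI allI impI)
      show "H 0 \<in> U" using s by (simp add: U_def linear_0[OF linR])
      show "0 < min r2' r" "min r2' r \<le> r" using r2' r by auto
      fix x :: "complex ^ 'm" assume "norm x < min r2' r"
      then have x: "G x \<in> ball 0 s" "R (H' (G x)) \<in> ball 0 s" "norm x < r"
        using r2'(2) by (auto simp: subset_iff)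
      then show "H x \<in> U" by (simp add: U_def H'G)
      have "F (H x) = g (R (H' (G x)))" by (simp add: F_def H'G)
      also have "\<dots> = g (G x)" by (rule gc[OF x(1,2), symmetric])
      also have "\<dots> = f x"
      proof -
        have "x \<in> ball 0 r1" using x(3) r by simp
        then show ?thesis using inv(1)[of x] r1(3) by (auto simp: g_def)
      qed
      finally show "F (H x) = f x" .
    qed (rule U hF)+
  qed
qed

section \<open>Complexified charts of generic submanifolds\<close>

lemma cscale_jp [simp]: "cscale jp w (x, y) = (Re w *\<^sub>R x - Im w *\<^sub>R y, Im w *\<^sub>R x + Re w *\<^sub>R y)"
  by (simp add: cscale_def jp_def algebra_simps)

lemma dist_Pair_0 [simp]: "dist (p, 0) (x, 0) = dist p x"
  by (simp add: dist_Pair_Pair)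

text \<open>A real analytic chart of a generic manifold and its complexification \<open>\<Phi>\<close>, with a holomorphic left
  inverse \<open>\<Xi>\<close> in the ambient space. As in the case of submersions, \<open>\<rho>\<close> is straightened by a map \<open>\<Psi>\<close>
  whose differential at the base point is the identity, so that the manifold becomes its own tangent
  space \<open>T\<close>; the same formula defines \<open>\<Psi>\<close> on the complexification.\<close>

theorem generic_chart:
  fixes M W :: "(complex ^ 'n) set"
  assumes gen: "generic d M" and card: "CARD('m::finite) + d = 2 * CARD('n)"
    and p0: "p0 \<in> M" and W: "open W" "p0 \<in> W"
  obtains r and \<Phi> :: "complex ^ 'm \<Rightarrow> (complex ^ 'n) \<times> (complex ^ 'n)" and \<Xi> S U
  where "0 < r" "holo jv jp (ball 0 r) \<Phi>" "\<Phi> 0 = (p0, 0)"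
    "\<And>t. norm t < r \<Longrightarrow> snd (\<Phi> (rvec t)) = 0"
    "open S" "holo jp jv S \<Xi>" "\<And>x. norm x < r \<Longrightarrow> \<Phi> x \<in> S \<and> \<Xi> (\<Phi> x) = x"
    "open U" "U \<subseteq> W" "\<And>X. X \<in> U \<Longrightarrow> (X, 0) \<in> S \<and> (\<exists>t. norm t < r \<and> \<Xi> (X, 0) = rvec t)"
    "M \<inter> U = (\<lambda>t. fst (\<Phi> (rvec t))) ` ball 0 r"
    "\<And>y. \<exists>c. zmap (D \<Phi> 0 c) = y"
proof -
  obtain U0 \<rho> where U0: "p0 \<in> U0" and ldf: "local_defining_functions d M U0 \<rho>"
    and ind: "\<forall>q\<in>M \<inter> U0. \<forall>c :: nat \<Rightarrow> complex. (\<Sum>j<d. c j *s del (\<rho> j) q) = 0 \<longrightarrow> (\<forall>j<d. c j = 0)"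
    using bspec[OF gen[unfolded generic_def] p0] by (elim exE conjE) (rule that)
  have indC: "\<forall>j<d. c j = 0" if "(\<Sum>j<d. c j *s del (\<rho> j) p0) = 0" for c :: "nat \<Rightarrow> complex"
    using ind p0 U0 that by simp
  have oU0: "open U0" and ra: "\<And>j. j < d \<Longrightarrow> real_analytic_on U0 (\<rho> j)"
    and MU0: "M \<inter> U0 = {Z\<in>U0. \<forall>j<d. \<rho> j Z = 0}"
    and indR: "\<And>c :: nat \<Rightarrow> real. (\<And>X. (\<Sum>j<d. c j * D (\<rho> j) p0 X) = 0) \<Longrightarrow> \<forall>j<d. c j = 0"
    using ldf U0 unfolding local_defining_functions_def by blast+
  have "\<forall>j. \<exists>r G. j < d \<longrightarrow> r > 0 \<and> holo jp jc (ball (p0, 0) r) G \<and> (\<forall>x\<in>ball p0 r. G (x, 0) = of_real (\<rho> j x))"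
    using real_analytic_holo_extension[OF ra U0] by metis
  then obtain rr G where rG: "\<And>j. j < d \<Longrightarrow> rr j > 0 \<and> holo jp jc (ball (p0, 0) (rr j)) (G j) \<and>
       (\<forall>x\<in>ball p0 (rr j). G j (x, 0) = of_real (\<rho> j x))" by metis
  obtain R0 where R0: "R0 > 0" "ball p0 R0 \<subseteq> U0 \<inter> W"
    using open_contains_ball[of "U0 \<inter> W"] oU0 W U0 by blast
  define R where "R = Min (insert R0 (rr ` {..<d}))"
  have R: "R > 0" using R0 rG by (simp add: R_def)
  have Rr: "R \<le> rr j" if "j < d" for j unfolding R_def using that by (intro Min_le) auto
  have "R \<le> R0" unfolding R_def by (intro Min_le) auto
  then have BU: "ball p0 R \<subseteq> U0" "ball p0 R \<subseteq> W" using R0(2) by (auto simp: subset_iff)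
  let ?B = "ball (p0, 0 :: complex ^ 'n) R"
  have pB: "(p0, 0) \<in> ?B" using R by simp
  have hG: "holo jp jc ?B (G j)" if "j < d" for j
    using rG[OF that] Rr[OF that] by (auto intro: holo_subset)
  have Gr: "G j (x, 0) = of_real (\<rho> j x)" if "j < d" "x \<in> ball p0 R" for j x
    using rG[OF that(1)] Rr[OF that(1)] that(2) by auto
  define \<mu> where "\<mu> = (\<lambda>j. D (\<rho> j) p0)"
  define g where "g = (\<lambda>j. D (G j) (p0, 0))"
  have emb: "((\<lambda>x. (x, 0 :: complex ^ 'n)) has_derivative (\<lambda>v. (v, 0))) (at x)" for x :: "complex ^ 'n"
    by (auto intro!: derivative_eq_intros)
  have d\<rho>: "(\<rho> j has_derivative \<mu> j) (at p0)" and g\<mu>: "g j (v, 0) = of_real (\<mu> j v)" if j: "j < d" for j v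
  proof -
    have dG: "((\<lambda>x. G j (x, 0)) has_derivative (\<lambda>v. g j (v, 0))) (at p0)"
      unfolding g_def by (rule has_derivative_compose[OF emb holo_D[OF hG[OF j] pB]])
    have "((\<lambda>x. Re (G j (x, 0))) has_derivative (\<lambda>v. Re (g j (v, 0)))) (at p0)"
      by (rule bounded_linear.has_derivative[OF bounded_linear_Re dG])
    then have 1: "(\<rho> j has_derivative (\<lambda>v. Re (g j (v, 0)))) (at p0)"
      by (rule has_derivative_transform_within_open[of _ _ _ _ "ball p0 R"]) (use R Gr[OF j] in auto)
    then show 2: "(\<rho> j has_derivative \<mu> j) (at p0)" unfolding \<mu>_def by (metis has_derivative_D)
    have "((\<lambda>x. complex_of_real (\<rho> j x)) has_derivative (\<lambda>v. of_real (\<mu> j v))) (at p0)"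
      by (rule bounded_linear.has_derivative[OF bounded_linear_of_real 2])
    then have "((\<lambda>x. G j (x, 0)) has_derivative (\<lambda>v. of_real (\<mu> j v))) (at p0)"
      by (rule has_derivative_transform_within_open[of _ _ _ _ "ball p0 R"]) (use R Gr[OF j] in auto)
    from has_derivative_unique[OF dG this] show "g j (v, 0) = of_real (\<mu> j v)" by metis
  qed
  have lin\<mu>: "linear (\<mu> j)" if "j < d" for j by (rule has_derivative_linear[OF d\<rho>[OF that]])
  have ind\<mu>: "\<forall>j<d. c j = 0" if "\<And>X. (\<Sum>j<d. c j * \<mu> j X) = 0" for c :: "nat \<Rightarrow> real"
    by (rule indR) (use that in \<open>simp add: \<mu>_def\<close>)
  obtain e where e: "\<And>i j. i < d \<Longrightarrow> j < d \<Longrightarrow> \<mu> i (e j) = (if i = j then 1 else 0)"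
    and T: "subspace {X. \<forall>j<d. \<mu> j X = 0}" and dimT: "dim {X. \<forall>j<d. \<mu> j X = 0} + d = DIM(complex ^ 'n)"
    by (rule dual_vectors[of d \<mu>, OF lin\<mu> ind\<mu>]) (assumption, assumption, rule that)
  let ?T = "{X. \<forall>j<d. \<mu> j X = 0}"
  \<comment> \<open>a right inverse of the vector of the functionals g\<close>
  define \<sigma> where "\<sigma> = (\<lambda>c. \<Sum>j<d. cscale jp (c j) (e j, 0 :: complex ^ 'n))"
  have ling: "linear (g j)" and jg: "g j (jp v) = \<i> * g j v" if "j < d" for j v
    unfolding g_def by (rule holo_linear[OF hG[OF that] pB], rule holo_D_commute[OF hG[OF that] pB])
  have g\<sigma>: "g i (\<sigma> c) = c i" if "i < d" for i c
  proof -
    have "g i (\<sigma> c) = (\<Sum>j<d. c j * g i (e j, 0))"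
      unfolding \<sigma>_def linear_sum[OF ling[OF that]]
      by (intro sum.cong refl) (simp only: cscale_commute[of "g i" jp jc, OF ling[OF that] jg[OF that]] cscale_jc)
    also have "\<dots> = (\<Sum>j<d. if i = j then c j else 0)"
      using that by (intro sum.cong refl) (simp add: g\<mu> e)
    finally show ?thesis using that by simp
  qed
  define H where "H = (\<lambda>w. \<sigma> (\<lambda>j. G j w))"
  define P where "P = (\<lambda>v. \<sigma> (\<lambda>j. g j v))"
  define \<Psi> where "\<Psi> = (\<lambda>w. (w - (p0, 0)) + (H w - P (w - (p0, 0))))"
  have bl: "bounded_linear (\<lambda>c. cscale jp c v)" for v :: "(complex ^ 'n) \<times> (complex ^ 'n)"
    by (rule bounded_bilinear.bounded_linear_left[OF bounded_bilinear_cscale]) simp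
  have hH: "holo jp jp ?B H"
    unfolding H_def \<sigma>_def by (intro holo_sum linear_jp holo_cscale complex_structure_jp holo_const hG) simp
  have linP: "linear P"
  proof -
    have "linear (\<lambda>v. cscale jp (g j v) (e j, 0 :: complex ^ 'n))" if "j < d" for j
      using linear_compose[OF ling[OF that] bounded_linear.linear[OF bl]] by (simp only: o_def)
    then show ?thesis unfolding P_def \<sigma>_def by (intro linear_compose_sum ballI) simp
  qed
  have jP: "P (jp v) = jp (P v)" for v
  proof -
    have "P (jp v) = (\<Sum>j<d. jp (cscale jp (g j v) (e j, 0)))"
      unfolding P_def \<sigma>_def
      by (intro sum.cong refl) (subst jg, simp, simp add: jp_def)
    then show ?thesis by (simp only: P_def \<sigma>_def linear_sum[OF linear_jp])
  qed
  have hP: "holo jp jp S P" for S by (rule holo_linear_map[OF linP]) (rule jP)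
  have hsub: "holo jp jp S (\<lambda>w. w - (p0, 0))" for S by (intro holo_diff linear_jp holo_ident holo_const)
  have h\<Psi>: "holo jp jp ?B \<Psi>"
    unfolding \<Psi>_def by (intro holo_add holo_diff linear_jp hH holo_compose[OF hsub hP[of UNIV]] holo_ident holo_const) auto
  have dH: "(H has_derivative P) (at (p0, 0))"
    unfolding H_def P_def \<sigma>_def g_def
    by (intro has_derivative_sum bounded_linear.has_derivative[OF bl] holo_D[OF hG pB]) simp
  have dsub: "((\<lambda>w. w - (p0, 0)) has_derivative (\<lambda>v. v)) (at w)" for w :: "(complex ^ 'n) \<times> (complex ^ 'n)"
    by (auto intro!: derivative_eq_intros)
  have "(\<Psi> has_derivative (\<lambda>v. v + (P v - P v))) (at (p0, 0))"
    unfolding \<Psi>_def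
    by (intro has_derivative_add has_derivative_diff dsub dH has_derivative_compose[OF dsub linear_imp_has_derivative[OF linP]])
  then have D\<Psi>0: "D \<Psi> (p0, 0) v = v" for v by (simp add: has_derivative_D)
  have g\<Psi>: "g i (\<Psi> w) = G i w" if "i < d" for i w
    unfolding \<Psi>_def H_def P_def
    by (simp add: linear_add[OF ling[OF that]] linear_diff[OF ling[OF that]] g\<sigma>[OF that])
  have "\<rho> j p0 = 0" if "j < d" for j using MU0 p0 U0 that by blast
  then have "H (p0, 0) = 0" unfolding H_def \<sigma>_def using Gr R by (intro sum.neutral) (simp add: zero_prod_def)
  then have \<Psi>p: "\<Psi> (p0, 0) = 0" by (simp add: \<Psi>_def linear_0[OF linP])
  define \<psi> where "\<psi> = (\<lambda>x. fst (\<Psi> (x, 0)))"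
  \<comment> \<open>\<Psi> preserves real points, because the G j are real there and the g j are real on real
    vectors\<close>
  have \<Psi>r: "\<Psi> (x, 0) = (\<psi> x, 0)" if x: "x \<in> ball p0 R" for x
  proof -
    have "snd (\<sigma> c) = 0" if "\<And>j. j < d \<Longrightarrow> Im (c j) = 0" for c
      unfolding \<sigma>_def snd_sum using that by (intro sum.neutral) simp
    then have "snd (H (x, 0)) = 0" "snd (P (x - p0, 0)) = 0"
      unfolding H_def P_def using Gr[OF _ x] g\<mu> by auto
    then have "snd (\<Psi> (x, 0)) = 0" by (simp add: \<Psi>_def)
    then show ?thesis by (simp add: \<psi>_def prod_eq_iff)
  qed
  have \<mu>\<psi>: "\<mu> j (\<psi> x) = \<rho> j x" if "j < d" "x \<in> ball p0 R" for j x
    using g\<Psi>[OF that(1), of "(x, 0)"] unfolding \<Psi>r[OF that(2)] g\<mu>[OF that(1)] Gr[OF that] by simp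
  obtain UC VC \<Theta> where UC: "open UC" "UC \<subseteq> ?B" "(p0, 0) \<in> UC" and VC: "open VC" "\<Psi> (p0, 0) \<in> VC"
    and homC: "homeomorphism UC VC \<Psi> \<Theta>" and h\<Theta>: "holo jp jp VC \<Theta>"
    and \<Theta>\<Psi>: "\<And>y v. y \<in> VC \<Longrightarrow> D \<Theta> y (D \<Psi> (\<Theta> y) v) = v"
    using holo_inverse_function[OF complex_structure_jp open_ball pB h\<Psi> D\<Psi>0] by metis
  have invC: "w \<in> UC \<Longrightarrow> \<Theta> (\<Psi> w) = w" "w \<in> UC \<Longrightarrow> \<Psi> w \<in> VC" for w
    using homC by (auto simp: homeomorphism_def)
  have invC': "y \<in> VC \<Longrightarrow> \<Psi> (\<Theta> y) = y" "y \<in> VC \<Longrightarrow> \<Theta> y \<in> UC" for y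
    using homC by (auto simp: homeomorphism_def)
  define B0 where "B0 = {x. (x, 0 :: complex ^ 'n) \<in> UC}"
  have cemb: "continuous_on UNIV (\<lambda>x. (x, 0 :: complex ^ 'n))" by (intro continuous_intros)
  have B0: "open B0" "p0 \<in> B0"
    using open_vimage[OF UC(1) cemb] UC(3) unfolding B0_def by (auto simp: vimage_def)
  have B0R: "B0 \<subseteq> ball p0 R"
  proof
    fix x assume "x \<in> B0"
    then have "(x, 0) \<in> ?B" using UC(2) unfolding B0_def by blast
    then show "x \<in> ball p0 R" by simp
  qed
  have d\<psi>: "(\<psi> has_derivative (\<lambda>v. fst (D \<Psi> (x, 0) (v, 0)))) (at x)" if "x \<in> B0" for x
    unfolding \<psi>_def using that B0R
    by (intro has_derivative_fst has_derivative_compose[OF emb holo_D[OF h\<Psi>]]) auto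
  have D\<psi>: "D \<psi> x v = fst (D \<Psi> (x, 0) (v, 0))" if "x \<in> B0" for x v
    using has_derivative_D[OF d\<psi>[OF that]] by simp
  have c\<psi>: "continuous_on B0 (\<lambda>x. D \<psi> x v)" for v
  proof (rule continuous_on_eq)
    show "continuous_on B0 (\<lambda>x. fst (D \<Psi> (x, 0) (v, 0)))"
      using B0R
      by (intro continuous_on_fst continuous_on_compose2[OF holo_D_continuous[OF _ _ open_ball h\<Psi>]] continuous_intros) auto
  qed (simp add: D\<psi>)
  have D\<psi>': "(\<psi> has_derivative D \<psi> x) (at x)" if "x \<in> B0" for x
    using d\<psi>[OF that] has_derivative_D[OF d\<psi>[OF that]] by simp
  have D\<psi>0: "D \<psi> p0 v = v" for v using D\<psi>[OF B0(2)] D\<Psi>0 by simp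
  obtain U1 V1 h where U1: "open U1" "U1 \<subseteq> B0" "p0 \<in> U1" and V1: "open V1" "\<psi> p0 \<in> V1"
    and hom: "homeomorphism U1 V1 \<psi> h"
    using inverse_function_C1[OF B0(1,2) D\<psi>' c\<psi> D\<psi>0] by metis
  have inv: "x \<in> U1 \<Longrightarrow> h (\<psi> x) = x" "x \<in> U1 \<Longrightarrow> \<psi> x \<in> V1" "y \<in> V1 \<Longrightarrow> \<psi> (h y) = y" "y \<in> V1 \<Longrightarrow> h y \<in> U1" for x y
    using hom by (auto simp: homeomorphism_def)
  have \<psi>p: "\<psi> p0 = 0" using \<Psi>p by (simp add: \<psi>_def)
  \<comment> \<open>A identifies the parameter space with T; AC is its complexification and BC a left inverse
    of AC\<close>
  have "dim (UNIV :: (real ^ 'm) set) = dim ?T" using dimT card by (simp add: dim_UNIV)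
  then obtain A B where A: "linear A" "A ` (UNIV :: (real ^ 'm) set) = ?T" and B: "linear B"
    and "B ` ?T = UNIV" "\<And>x. x \<in> UNIV \<Longrightarrow> norm (A x) = norm x" "\<And>x. x \<in> ?T \<Longrightarrow> norm (B x) = norm x"
    and BA': "\<And>t. t \<in> UNIV \<Longrightarrow> B (A t) = t" and AB: "\<And>x. x \<in> ?T \<Longrightarrow> A (B x) = x"
    by (rule isometries_subspaces[OF subspace_UNIV T]) (rule that)
  have BA: "B (A t) = t" for t by (rule BA') simp
  have AT: "A t \<in> ?T" for t using A(2) by blast
  define AC where "AC = (\<lambda>x :: complex ^ 'm. (A (Revec x), A (Imvec x)))"
  define BC where "BC = (\<lambda>w. rvec (B (fst w)) + \<i> *s rvec (B (snd w)))"
  have linAC: "linear AC"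
    unfolding AC_def
    by (rule linearI) (auto simp: linear_add[OF A(1)] linear_scale[OF A(1)] linear_add[OF linear_Revec]
        linear_add[OF linear_Imvec] linear_scale[OF linear_Revec] linear_scale[OF linear_Imvec])
  have jAC: "AC (\<i> *s x) = jp (AC x)" for x
  proof -
    have "Revec (\<i> *s x) = - Imvec x" "Imvec (\<i> *s x) = Revec x"
      by (auto simp: Revec_def Imvec_def vec_eq_iff)
    then show ?thesis by (simp add: AC_def jp_def linear_neg[OF A(1)])
  qed
  have linBC: "linear BC"
    unfolding BC_def
    by (rule linearI) (auto simp: linear_add[OF B] linear_scale[OF B] linear_add[OF linear_rvec]
        linear_scale[OF linear_rvec] vec_eq_iff algebra_simps complex_eq_iff)
  have jBC: "BC (jp w) = \<i> *s BC w" for w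
    by (simp add: BC_def jp_def linear_neg[OF B] linear_neg[OF linear_rvec] vec_eq_iff algebra_simps complex_eq_iff)
  have BCAC: "BC (AC x) = x" for x by (simp add: BC_def AC_def BA rvec_Re_Im)
  have Re_rvec: "Revec (rvec t) = t" "Imvec (rvec t) = 0" for t :: "real ^ 'm"
    by (simp_all add: Revec_def Imvec_def rvec_def vec_eq_iff)
  have AC_rvec: "AC (rvec t) = (A t, 0)" for t by (simp add: AC_def Re_rvec linear_0[OF A(1)])
  have hAC: "holo jv jp S AC" and hBC: "holo jp jv S' BC" for S S'
    by (rule holo_linear_map; simp add: linAC jAC linBC jBC)+
  have "open (AC -` VC)" "open (A -` V1)"
    using open_vimage[OF VC(1) holo_continuous[OF hAC]] open_vimage[OF V1(1)]
      linear_continuous_on[of A UNIV] A(1) by (auto simp: linear_conv_bounded_linear)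
  moreover have "0 \<in> AC -` VC" "0 \<in> A -` V1"
    using VC(2) V1(2) by (auto simp: \<Psi>p \<psi>p linear_0[OF linAC] linear_0[OF A(1)])
  ultimately obtain ra rb where rab: "ra > 0" "ball 0 ra \<subseteq> AC -` VC" "rb > 0" "ball 0 rb \<subseteq> A -` V1"
    using open_contains_ball by metis
  define r where "r = min ra rb"
  have r: "r > 0" "\<And>x. norm x < r \<Longrightarrow> AC x \<in> VC" "\<And>t. norm t < r \<Longrightarrow> A t \<in> V1"
    using rab by (auto simp: r_def subset_iff)
  have \<Phi>r: "\<Theta> (AC (rvec t)) = (h (A t), 0)" if "norm t < r" for t
  proof -
    have "h (A t) \<in> B0" using inv(4)[OF r(3)[OF that]] U1(2) by blast
    then have UC': "(h (A t), 0) \<in> UC" and "h (A t) \<in> ball p0 R" using B0R unfolding B0_def by auto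
    then have "\<Psi> (h (A t), 0) = AC (rvec t)" by (simp add: \<Psi>r AC_rvec inv(3)[OF r(3)[OF that]])
    then show ?thesis using invC(1)[OF UC'] by simp
  qed
  define U where "U = U1 \<inter> (\<lambda>x. B (\<psi> x)) -` ball 0 r"
  show thesis
  proof (rule that[of r "\<lambda>x. \<Theta> (AC x)" UC "\<lambda>w. BC (\<Psi> w)" U])
    show "0 < r" "open UC" by (rule r UC)+
    show "holo jv jp (ball 0 r) (\<lambda>x. \<Theta> (AC x))"
      by (rule holo_compose[OF hAC h\<Theta>]) (use r(2) in auto)
    show "\<Theta> (AC 0) = (p0, 0)" using invC(1)[OF UC(3)] by (simp add: \<Psi>p linear_0[OF linAC])
    show "snd (\<Theta> (AC (rvec t))) = 0" if "norm t < r" for t using \<Phi>r[OF that] by simp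
    show "holo jp jv UC (\<lambda>w. BC (\<Psi> w))"
      by (rule holo_compose[OF holo_subset[OF h\<Psi> UC(2)] hBC[of UNIV]]) auto
    show "\<Theta> (AC x) \<in> UC \<and> BC (\<Psi> (\<Theta> (AC x))) = x" if "norm x < r" for x
      using invC'[OF r(2)[OF that]] BCAC by simp
    have "continuous_on UNIV B" using B by (simp add: linear_continuous_on linear_conv_bounded_linear)
    moreover have "continuous_on U1 \<psi>" using hom by (simp add: homeomorphism_def)
    ultimately have "continuous_on U1 (\<lambda>x. B (\<psi> x))" by (rule continuous_on_compose2) simp
    then show "open U" unfolding U_def by (rule continuous_open_preimage[OF _ U1(1) open_ball])
    show "U \<subseteq> W" unfolding U_def using U1(2) B0R BU(2) by blast
    show "(X, 0) \<in> UC \<and> (\<exists>t. norm t < r \<and> BC (\<Psi> (X, 0)) = rvec t)" if "X \<in> U" for X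
    proof -
      have X: "X \<in> B0" "X \<in> ball p0 R" "norm (B (\<psi> X)) < r" using that U1(2) B0R by (auto simp: U_def)
      have "BC (\<Psi> (X, 0)) = rvec (B (\<psi> X))"
        unfolding \<Psi>r[OF X(2)] by (simp add: BC_def linear_0[OF B] linear_0[OF linear_rvec])
      then show ?thesis using X unfolding B0_def by blast
    qed
    show "M \<inter> U = (\<lambda>t. fst (\<Theta> (AC (rvec t)))) ` ball 0 r"
    proof (intro equalityI subsetI)
      fix X assume X: "X \<in> M \<inter> U"
      then have X': "X \<in> ball p0 R" "X \<in> U1" "norm (B (\<psi> X)) < r" using U1(2) B0R by (auto simp: U_def)
      have "\<rho> j X = 0" if "j < d" for j using X X'(1) BU(1) MU0 that by blast
      then have "\<psi> X \<in> ?T" using \<mu>\<psi>[OF _ X'(1)] by simp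
      then have "h (A (B (\<psi> X))) = X" using AB inv(1)[OF X'(2)] by simp
      then have "X = fst (\<Theta> (AC (rvec (B (\<psi> X)))))" using \<Phi>r[OF X'(3)] by simp
      then show "X \<in> (\<lambda>t. fst (\<Theta> (AC (rvec t)))) ` ball 0 r" using X'(3) by auto
    next
      fix X assume "X \<in> (\<lambda>t. fst (\<Theta> (AC (rvec t)))) ` ball 0 r"
      then obtain t where t: "norm t < r" "X = h (A t)" using \<Phi>r by auto
      have XU1: "X \<in> U1" and \<psi>X: "\<psi> X = A t" using inv(3,4)[OF r(3)[OF t(1)]] t(2) by auto
      then have XR: "X \<in> ball p0 R" using U1(2) B0R by blast
      have "\<rho> j X = 0" if "j < d" for j using \<mu>\<psi>[OF that XR] AT[of t] that \<psi>X by simp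
      then have "X \<in> M" using MU0 XR BU(1) by blast
      then show "X \<in> M \<inter> U" using XU1 \<psi>X BA t(1) by (simp add: U_def)
    qed
    show "\<exists>c. zmap (D (\<lambda>x. \<Theta> (AC x)) 0 c) = y" for y
    proof -
      have e': "D (\<rho> i) p0 (e j) = (if i = j then 1 else 0)" if "i < d" "j < d" for i j
        using e[OF that] by (simp add: \<mu>_def)
      obtain x x' where x: "x \<in> ?T" "x' \<in> ?T" "x + \<i> *s x' = y"
        using generic_spans[of d \<rho> p0 e y, OF lin\<mu>[unfolded \<mu>_def] e' indC] unfolding \<mu>_def by blast
      have 0: "(0 :: (complex ^ 'n) \<times> (complex ^ 'n)) \<in> VC" using VC(2) \<Psi>p by simp
      have \<Theta>0: "\<Theta> 0 = (p0, 0)" using invC(1)[OF UC(3)] \<Psi>p by simp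
      have D\<Theta>: "D \<Theta> 0 v = v" for v using \<Theta>\<Psi>[OF 0, of v] unfolding \<Theta>0 D\<Psi>0 .
      have AC0: "AC 0 = 0" by (rule linear_0[OF linAC])
      have "D (\<lambda>x. \<Theta> (AC x)) 0 c = D \<Theta> (AC 0) (AC c)" for c
        by (rule D_compose[OF h\<Theta> linear_imp_has_derivative[OF linAC]]) (simp add: AC0 0)
      then have DAC: "D (\<lambda>x. \<Theta> (AC x)) 0 c = AC c" for c by (simp add: AC0 D\<Theta>)
      let ?c = "BC (x, x')"
      have "Revec ?c = B x" "Imvec ?c = B x'"
        by (auto simp: BC_def Revec_def Imvec_def rvec_def vec_eq_iff)
      then have "zmap (AC ?c) = y" using AB x by (simp add: AC_def zmap_def)
      then show ?thesis using DAC by metis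
    qed
  qed
qed

section \<open>CR functions in a chart\<close>

lemma bounded_linear_rvec: "bounded_linear rvec" and bounded_linear_Revec: "bounded_linear Revec"
  using linear_rvec linear_Revec by (simp_all add: linear_conv_bounded_linear)

lemma Revec_rvec [simp]: "Revec (rvec t) = t" and Imvec_rvec [simp]: "Imvec (rvec t) = 0"
  by (simp_all add: Revec_def Imvec_def rvec_def vec_eq_iff)

lemma rvec_axis: "rvec (axis k 1) = axis k 1"
  by (simp add: rvec_def axis_def vec_eq_iff)

lemma ctan_scale_cscale: "ctan_scale c W = cscale jp c W"
  by (cases W) (simp add: ctan_scale_def)

text \<open>The chart of \<open>M\<close> near \<open>p0\<close> is the restriction of \<open>\<Phi>\<close> to the real points; its inverse is
  the restriction of \<open>\<Xi>\<close>.\<close>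

locale cr_chart =
  fixes M W :: "(complex ^ 'n) set" and p0 :: "complex ^ 'n" and r :: real
    and \<Phi> :: "complex ^ 'm::finite \<Rightarrow> (complex ^ 'n) \<times> (complex ^ 'n)"
    and \<Xi> :: "(complex ^ 'n) \<times> (complex ^ 'n) \<Rightarrow> complex ^ 'm"
    and S :: "((complex ^ 'n) \<times> (complex ^ 'n)) set" and U :: "(complex ^ 'n) set"
  assumes r: "0 < r" and h\<Phi>: "holo jv jp (ball 0 r) \<Phi>" and \<Phi>0: "\<Phi> 0 = (p0, 0)"
    and \<Phi>real: "\<And>t. norm t < r \<Longrightarrow> snd (\<Phi> (rvec t)) = 0"
    and S: "open S" and h\<Xi>: "holo jp jv S \<Xi>" and \<Xi>\<Phi>: "\<And>x. norm x < r \<Longrightarrow> \<Phi> x \<in> S \<and> \<Xi> (\<Phi> x) = x"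
    and U: "open U" "U \<subseteq> W" and U\<Xi>: "\<And>X. X \<in> U \<Longrightarrow> (X, 0) \<in> S \<and> (\<exists>t. norm t < r \<and> \<Xi> (X, 0) = rvec t)"
    and MU: "M \<inter> U = (\<lambda>t. fst (\<Phi> (rvec t))) ` ball 0 r"
begin

definition \<phi> where "\<phi> t = fst (\<Phi> (rvec t))"

lemma \<Phi>_rvec: "norm t < r \<Longrightarrow> \<Phi> (rvec t) = (\<phi> t, 0)"
  using \<Phi>real by (simp add: \<phi>_def prod_eq_iff)

lemma MU_eq: "M \<inter> U = \<phi> ` ball 0 r"
  using MU by (simp add: \<phi>_def[abs_def])

lemma \<phi>_in: "norm t < r \<Longrightarrow> \<phi> t \<in> M \<inter> U"
  unfolding MU_eq by simp

lemma smooth_\<Phi>r: "smooth_on (ball 0 r) (\<lambda>t. \<Phi> (rvec t))"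
  by (rule smooth_on_compose[OF smooth_on_linear[OF open_ball bounded_linear_rvec]
        holo_smooth[OF complex_structure_jv complex_structure_jp open_ball h\<Phi>]]) auto

lemma smooth_\<phi>: "smooth_on (ball 0 r) \<phi>"
  unfolding \<phi>_def by (rule smooth_on_linear_compose[OF bounded_linear_fst smooth_\<Phi>r])

lemma D_\<Phi>r: "norm t < r \<Longrightarrow> D (\<lambda>t. \<Phi> (rvec t)) t v = D \<Phi> (rvec t) (rvec v)"
  by (rule D_compose[OF h\<Phi> linear_imp_has_derivative[OF linear_rvec]]) simp

lemma D_\<Phi>:
  assumes t: "norm t < r"
  shows "D \<Phi> (rvec t) c = (D \<phi> t (Revec c), D \<phi> t (Imvec c))"
proof -
  have x: "rvec t \<in> ball 0 r" using t by simp
  have d: "((\<lambda>t. \<Phi> (rvec t)) has_derivative (\<lambda>v. D \<Phi> (rvec t) (rvec v))) (at t)"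
    by (rule has_derivative_compose[OF linear_imp_has_derivative[OF linear_rvec] holo_D[OF h\<Phi> x]])
  have 1: "D \<phi> t v = fst (D \<Phi> (rvec t) (rvec v))" for v
    unfolding \<phi>_def using has_derivative_D[OF has_derivative_fst[OF d]] by simp
  have "D (\<lambda>t. snd (\<Phi> (rvec t))) t v = D (\<lambda>t. 0 :: complex ^ 'n) t v" for v
    by (rule fun_cong[OF D_cong[of "ball 0 r"]]) (use t \<Phi>real in auto)
  then have 2: "snd (D \<Phi> (rvec t) (rvec v)) = 0" for v
    using has_derivative_D[OF has_derivative_snd[OF d]] by (simp add: frechet_derivative_const)
  have r: "D \<Phi> (rvec t) (rvec v) = (D \<phi> t v, 0)" for v using 1 2 by (simp add: prod_eq_iff)
  have "D \<Phi> (rvec t) c = D \<Phi> (rvec t) (rvec (Revec c) + \<i> *s rvec (Imvec c))" by (simp only: rvec_Re_Im)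
  also have "\<dots> = D \<Phi> (rvec t) (rvec (Revec c)) + jp (D \<Phi> (rvec t) (rvec (Imvec c)))"
    by (simp only: linear_add[OF holo_linear[OF h\<Phi> x]] holo_D_commute[OF h\<Phi> x])
  finally show ?thesis unfolding r by (simp add: jp_def)
qed

lemma D_\<Phi>_cpush: "norm t < r \<Longrightarrow> cpush \<phi> t c = D \<Phi> (rvec t) c"
  by (simp add: D_\<Phi> cpush_def Revec_def Imvec_def)

lemma D_\<Xi>_\<Phi>:
  assumes x: "norm x < r" shows "D \<Xi> (\<Phi> x) (D \<Phi> x c) = c"
proof -
  have x': "x \<in> ball 0 r" using x by simp
  have "D (\<lambda>x. \<Xi> (\<Phi> x)) x c = D \<Xi> (\<Phi> x) (D \<Phi> x c)"
    by (rule D_compose[OF h\<Xi> holo_D[OF h\<Phi> x']]) (use \<Xi>\<Phi>[OF x] in simp)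
  moreover have "D (\<lambda>x. \<Xi> (\<Phi> x)) x = D (\<lambda>x. x) x"
    by (rule D_cong[OF open_ball x']) (use \<Xi>\<Phi> in simp)
  ultimately show ?thesis by (simp add: has_derivative_D[OF has_derivative_ident])
qed

text \<open>A curve \<open>\<gamma>\<close> in \<open>M\<close> near the base point satisfies \<open>\<gamma> = \<Phi> \<circ> \<Xi> \<circ> \<gamma>\<close>, so its velocity lies in the image of the
  differential of \<open>\<Phi>\<close>. Conversely the chart maps lines to curves in \<open>M\<close>.\<close>

lemma tangent_space_\<phi>:
  assumes t: "norm t < r"
  shows "tangent_space M (\<phi> t) = range (D \<phi> t)"
proof (intro equalityI subsetI)
  fix X assume "X \<in> tangent_space M (\<phi> t)"
  then obtain \<gamma> e where e: "e > 0" and \<gamma>: "\<gamma> ` {-e<..<e} \<subseteq> M" "\<gamma> 0 = \<phi> t" "(\<gamma> has_vector_derivative X) (at 0)"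
    and sm: "smooth_on {-e<..<e::real} \<gamma>"
    unfolding tangent_space_def by blast
  have "isCont \<gamma> 0" using has_vector_derivative_continuous[OF \<gamma>(3)] .
  moreover have "\<gamma> 0 \<in> U" using \<gamma>(2) \<phi>_in[OF t] by simp
  ultimately obtain \<delta> where \<delta>: "\<delta> > 0" "\<And>s. dist s 0 < \<delta> \<Longrightarrow> \<gamma> s \<in> U"
    using continuous_at_avoid[of 0 \<gamma>] U(1)
    unfolding continuous_at_open by (metis (no_types, lifting) open_dist)
  define d where "d = min \<delta> e"
  have eq: "(\<gamma> s, 0) = \<Phi> (\<Xi> (\<gamma> s, 0))" if s: "s \<in> ball 0 d" for s
  proof -
    have "s \<in> {-e<..<e}" "dist s 0 < \<delta>" using s by (auto simp: d_def)
    then have "\<gamma> s \<in> M \<inter> U" using \<gamma>(1) \<delta>(2) by blast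
    then obtain t' where "norm t' < r" "\<gamma> s = \<phi> t'" unfolding MU_eq by auto
    then show ?thesis using \<Phi>_rvec[of t'] \<Xi>\<Phi>[of "rvec t'"] by simp
  qed
  have d: "((\<lambda>s. (\<gamma> s, 0 :: complex ^ 'n)) has_derivative (\<lambda>h. (h *\<^sub>R X, 0))) (at 0)"
    using \<gamma>(3) unfolding has_vector_derivative_def by (auto intro!: derivative_eq_intros)
  have S0: "(\<gamma> 0, 0) \<in> S" "\<Xi> (\<gamma> 0, 0) = rvec t"
    using \<Xi>\<Phi>[of "rvec t"] \<Phi>_rvec[OF t] t \<gamma>(2) by auto
  have b: "\<Xi> (\<gamma> 0, 0) \<in> ball 0 r" using S0 t by simp
  have "((\<lambda>s. \<Phi> (\<Xi> (\<gamma> s, 0))) has_derivative (\<lambda>h. D \<Phi> (rvec t) (D \<Xi> (\<gamma> 0, 0) (h *\<^sub>R X, 0)))) (at 0)"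
    using has_derivative_compose[OF has_derivative_compose[OF d holo_D[OF h\<Xi> S0(1)]] holo_D[OF h\<Phi> b]] S0(2) by simp
  then have "((\<lambda>s. (\<gamma> s, 0)) has_derivative (\<lambda>h. D \<Phi> (rvec t) (D \<Xi> (\<gamma> 0, 0) (h *\<^sub>R X, 0)))) (at 0)"
    by (rule has_derivative_transform_within_open[of _ _ _ _ "ball 0 d"]) (use eq \<delta> e in \<open>auto simp: d_def\<close>)
  from fun_cong[OF has_derivative_unique[OF d this], of 1]
  have "(X, 0) = D \<Phi> (rvec t) (D \<Xi> (\<gamma> 0, 0) (X, 0))" by simp
  then show "X \<in> range (D \<phi> t)" unfolding D_\<Phi>[OF t] by (metis prod.inject rangeI)
next
  fix X assume "X \<in> range (D \<phi> t)"
  then obtain v where v: "X = D \<phi> t v" by blast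
  define e where "e = (r - norm t) / (norm v + 1)"
  have nv: "norm v + 1 > 0" by (simp add: add_nonneg_pos)
  have e: "e > 0" using t nv by (simp add: e_def)
  have in_ball: "t + s *\<^sub>R v \<in> ball 0 r" if "s \<in> {-e<..<e}" for s
  proof -
    have "norm (t + s *\<^sub>R v) \<le> norm t + \<bar>s\<bar> * norm v" using norm_triangle_ineq[of t "s *\<^sub>R v"] by simp
    also have "\<bar>s\<bar> * norm v \<le> \<bar>s\<bar> * (norm v + 1)" by (intro mult_left_mono) auto
    also have "\<dots> < e * (norm v + 1)" using that nv by (intro mult_strict_right_mono) auto
    also have "norm t + \<dots> = r" using nv by (simp add: e_def)
    finally show ?thesis by simp
  qed
  let ?\<gamma> = "\<lambda>s::real. \<phi> (t + s *\<^sub>R v)"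
  have "smooth_on {-e<..<e} ?\<gamma>"
    by (rule smooth_on_compose[OF smooth_on_affine smooth_\<phi>])
       (use in_ball in \<open>auto intro: bounded_linear_scaleR_left\<close>)
  moreover have "?\<gamma> ` {-e<..<e} \<subseteq> M" using in_ball \<phi>_in by fastforce
  moreover have "(?\<gamma> has_vector_derivative X) (at 0)"
  proof -
    have "((\<lambda>s. t + s *\<^sub>R v) has_derivative (\<lambda>h. h *\<^sub>R v)) (at 0)" by (auto intro!: derivative_eq_intros)
    from has_derivative_compose[OF this smooth_on_D[OF smooth_\<phi>]] t
    have "(?\<gamma> has_derivative (\<lambda>h. D \<phi> t (h *\<^sub>R v))) (at 0)" by simp
    moreover have "linear (D \<phi> t)" by (rule has_derivative_linear[OF smooth_on_D[OF smooth_\<phi>]]) (use t in simp)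
    ultimately show ?thesis by (simp add: has_vector_derivative_def linear_scale v)
  qed
  ultimately show "X \<in> tangent_space M (\<phi> t)"
    unfolding tangent_space_def using e by (intro CollectI exI[of _ ?\<gamma>] exI[of _ e]) auto
qed

lemma complexified_tangent_space_\<phi>:
  assumes t: "norm t < r"
  shows "complexified_tangent_space M (\<phi> t) = range (D \<Phi> (rvec t))"
proof (intro equalityI subsetI)
  fix w assume "w \<in> complexified_tangent_space M (\<phi> t)"
  then obtain x y where "w = (D \<phi> t x, D \<phi> t y)"
    unfolding complexified_tangent_space_def tangent_space_\<phi>[OF t] by auto
  moreover have "Revec (rvec x + \<i> *s rvec y) = x" "Imvec (rvec x + \<i> *s rvec y) = y"
    by (auto simp: Revec_def Imvec_def rvec_def vec_eq_iff)
  ultimately have "w = D \<Phi> (rvec t) (rvec x + \<i> *s rvec y)" by (simp add: D_\<Phi>[OF t])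
  then show "w \<in> range (D \<Phi> (rvec t))" by blast
qed (auto simp: complexified_tangent_space_def tangent_space_\<phi>[OF t] D_\<Phi>[OF t])

lemma local_parametrization_\<phi>: "local_parametrization (M \<inter> U) (ball 0 r) \<phi>"
  unfolding local_parametrization_def
proof (intro conjI ballI)
  show "smooth_on (ball 0 r) \<phi>" by (rule smooth_\<phi>)
  show "openin (top_of_set (M \<inter> U)) (\<phi> ` ball 0 r)" unfolding MU_eq by simp
  fix t :: "real ^ 'm" assume "t \<in> ball 0 r"
  then have t: "norm t < r" by simp
  show "inj (D \<phi> t)"
  proof (rule injI)
    fix x y assume "D \<phi> t x = D \<phi> t y"
    moreover have "D \<phi> t 0 = 0"
      by (rule linear_0[OF has_derivative_linear[OF smooth_on_D[OF smooth_\<phi>]]]) (use t in simp)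
    ultimately have "D \<Phi> (rvec t) (rvec x) = D \<Phi> (rvec t) (rvec y)"
      by (simp add: D_\<Phi>[OF t])
    then have "rvec x = rvec y" using D_\<Xi>_\<Phi>[of "rvec t"] t by (metis norm_rvec)
    then show "x = y" by (metis Revec_rvec)
  qed
next
  have \<Xi>: "\<Xi> (\<phi> t, 0) = rvec t" if "norm t < r" for t
    using \<Xi>\<Phi>[of "rvec t"] \<Phi>_rvec[OF that] that by simp
  have "homeomorphism (ball 0 r) (\<phi> ` ball 0 r) \<phi> (\<lambda>X. Revec (\<Xi> (X, 0)))"
  proof (rule homeomorphismI)
    show "continuous_on (ball 0 r) \<phi>" by (rule smooth_on_continuous[OF smooth_\<phi>])
    show "continuous_on (\<phi> ` ball 0 r) (\<lambda>X. Revec (\<Xi> (X, 0)))"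
      unfolding MU_eq[symmetric]
      by (intro bounded_linear.continuous_on[OF bounded_linear_Revec] continuous_on_compose2[OF holo_continuous[OF h\<Xi>]]
          continuous_intros) (use U\<Xi> in auto)
  qed (auto simp: \<Xi>)
  then show "\<exists>\<psi>. homeomorphism (ball 0 r) (\<phi> ` ball 0 r) \<phi> \<psi>" by blast
qed

text \<open>A holomorphic field \<open>l\<close> of kernel vectors of the differential of \<open>Z \<circ> \<Phi>\<close> gives a CR vector field; it
  is extended to the ambient space along the holomorphic retraction \<open>\<Phi> \<circ> \<Xi>\<close>.\<close>

lemma cr_function_weakly_killed:
  assumes f: "continuous_cr_function TYPE('m) M W f" and l: "holo jv jv (ball 0 r) l"
    and ker: "\<And>x. norm x < r \<Longrightarrow> zmap (D \<Phi> x (l x)) = 0"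
  shows "weak_deriv (ball 0 r) (\<lambda>t. f (\<phi> t)) (\<lambda>t. l (rvec t)) (\<lambda>_. 0)"
proof -
  define K where "K = (\<lambda>x. D \<Phi> x (l x))"
  have hK: "holo jv jp (ball 0 r) K"
  proof (rule holo_transform[OF _ open_ball])
    show "holo jv jp (ball 0 r) (\<lambda>x. \<Sum>k\<in>UNIV. cscale jp (l x $ k) (D \<Phi> x (axis k 1)))"
      by (intro holo_sum linear_jp holo_cscale complex_structure_jp l[unfolded holo_vec_iff, rule_format]
          holo_derivative[OF complex_structure_jv complex_structure_jp open_ball h\<Phi>])
    fix x :: "complex ^ 'm" assume "x \<in> ball 0 r"
    then show "(\<Sum>k\<in>UNIV. cscale jp (l x $ k) (D \<Phi> x (axis k 1))) = K x"
      unfolding K_def by (rule holo_D_vec[OF h\<Phi>, symmetric])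
  qed
  define L where "L = (\<lambda>X. K (\<Xi> (X, 0)))"
  have smK: "smooth_on (ball 0 r) K" by (rule holo_smooth[OF _ _ open_ball hK]) auto
  have sm\<Xi>: "smooth_on U (\<lambda>X. \<Xi> (X, 0))"
  proof -
    have bl: "bounded_linear (\<lambda>X. (X, 0 :: complex ^ 'n))"
      by (intro bounded_linear_Pair bounded_linear_ident bounded_linear_zero)
    have "smooth_on S \<Xi>" by (rule holo_smooth[OF _ _ S h\<Xi>]) auto
    from smooth_on_compose[OF smooth_on_linear[OF U(1) bl] this] U\<Xi> show ?thesis by auto
  qed
  have smL: "smooth_on U L"
    unfolding L_def
  proof (rule smooth_on_compose[OF sm\<Xi> smK])
    show "(\<lambda>X. \<Xi> (X, 0)) ` U \<subseteq> ball 0 r"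
    proof
      fix x assume "x \<in> (\<lambda>X. \<Xi> (X, 0)) ` U"
      then obtain t where "norm t < r" "x = rvec t" using U\<Xi> by blast
      then show "x \<in> ball 0 r" by simp
    qed
  qed
  have L: "L (\<phi> t) = D \<Phi> (rvec t) (l (rvec t))" if "norm t < r" for t
    using \<Xi>\<Phi>[of "rvec t"] \<Phi>_rvec[OF that] that by (simp add: L_def K_def)
  have "cr_vector_field M U L"
    unfolding cr_vector_field_def
  proof (intro conjI ballI smL)
    fix p assume "p \<in> M \<inter> U"
    then obtain t where t: "norm t < r" "p = \<phi> t" unfolding MU_eq by auto
    show "L p \<in> T01 \<inter> complexified_tangent_space M p"
      unfolding t(2) L[OF t(1)] complexified_tangent_space_\<phi>[OF t(1)]
      using ker[of "rvec t"] t(1) by (simp add: T01_iff)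
  qed
  then have "weakly_annihilates TYPE('m) M U L f"
    using f U(2) unfolding continuous_cr_function_def by blast
  then have "(LINT t:ball 0 r|lborel. f (\<phi> t) * div_mult (\<lambda>t. l (rvec t)) \<theta> t) = 0" if "test_function (ball 0 r) \<theta>" for \<theta>
    unfolding weakly_annihilates_def div_mult_def
    using local_parametrization_\<phi> that L D_\<Phi>_cpush by simp
  then show ?thesis by (simp add: weak_deriv_def set_lebesgue_integral_def)
qed

end

section \<open>Vector fields with analytic weak derivatives\<close>

text \<open>Analyticity with a prescribed domain of the holomorphic extension, so that sums, products and
  derivatives do not shrink it.\<close>

definition analytic_ext :: "real \<Rightarrow> (real ^ 'm \<Rightarrow> complex) \<Rightarrow> bool" where
  "analytic_ext r f \<longleftrightarrow> (\<exists>F. holo jv jc (ball 0 r) F \<and> (\<forall>t. norm t < r \<longrightarrow> f t = F (rvec t)))"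

lemma analytic_extI: "holo jv jc (ball 0 r) F \<Longrightarrow> (\<And>t. norm t < r \<Longrightarrow> f t = F (rvec t)) \<Longrightarrow> analytic_ext r f"
  unfolding analytic_ext_def by blast

lemma analytic_extE:
  assumes "analytic_ext r f"
  obtains F where "holo jv jc (ball 0 r) F" "\<And>t. norm t < r \<Longrightarrow> f t = F (rvec t)"
  using assms unfolding analytic_ext_def by blast

lemma analytic_ext_subset: "analytic_ext r f \<Longrightarrow> s \<le> r \<Longrightarrow> analytic_ext s f"
  by (erule analytic_extE, rule analytic_extI, erule holo_subset) auto

lemma analytic_ext_const: "analytic_ext r (\<lambda>_. c)"
  by (rule analytic_extI[of _ "\<lambda>_. c"]) (auto intro: holo_const)

lemma analytic_ext_add: "analytic_ext r f \<Longrightarrow> analytic_ext r g \<Longrightarrow> analytic_ext r (\<lambda>t. f t + g t)"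
  by (elim analytic_extE, rule analytic_extI, erule (1) holo_add[OF linear_jc]) simp

lemma analytic_ext_mult: "analytic_ext r f \<Longrightarrow> analytic_ext r g \<Longrightarrow> analytic_ext r (\<lambda>t. f t * g t)"
  by (elim analytic_extE, rule analytic_extI, erule (1) holo_mult) simp

lemma analytic_ext_minus: "analytic_ext r f \<Longrightarrow> analytic_ext r (\<lambda>t. - f t)"
  using analytic_ext_mult[OF analytic_ext_const[of r "-1"], of f] by simp

lemma analytic_ext_diff: "analytic_ext r f \<Longrightarrow> analytic_ext r g \<Longrightarrow> analytic_ext r (\<lambda>t. f t - g t)"
  using analytic_ext_add[OF _ analytic_ext_minus, of r f g] by simp

lemma analytic_ext_sum: "(\<And>i. i \<in> A \<Longrightarrow> analytic_ext r (f i)) \<Longrightarrow> analytic_ext r (\<lambda>t. \<Sum>i\<in>A. f i t)"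
  by (induction A rule: infinite_finite_induct) (auto intro: analytic_ext_const analytic_ext_add)

lemma analytic_ext_prod: "(\<And>i. i \<in> A \<Longrightarrow> analytic_ext r (f i)) \<Longrightarrow> analytic_ext r (\<lambda>t. \<Prod>i\<in>A. f i t)"
  by (induction A rule: infinite_finite_induct) (auto intro: analytic_ext_const analytic_ext_mult)

lemma partial_holo:
  assumes F: "holo jv jc (ball 0 r) F" and f: "\<And>t. norm t < r \<Longrightarrow> f t = F (rvec t)" and t: "norm t < r"
  shows "partial k f t = D F (rvec t) (axis k 1)"
proof -
  have "partial k f t = partial k (\<lambda>t. F (rvec t)) t" by (rule partial_cong[of "ball 0 r"]) (use t f in auto)
  also have "\<dots> = D F (rvec t) (rvec (axis k 1))"
    by (rule D_compose[OF F linear_imp_has_derivative[OF linear_rvec]]) (use t in simp)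
  finally show ?thesis by (simp only: rvec_axis)
qed

lemma analytic_ext_partial: "analytic_ext r f \<Longrightarrow> analytic_ext r (partial k f)"
proof (elim analytic_extE)
  fix F assume F: "holo jv jc (ball 0 r) F" "\<And>t. norm t < r \<Longrightarrow> f t = F (rvec t)"
  show "analytic_ext r (partial k f)"
    by (rule analytic_extI[OF holo_derivative_scalar[OF complex_structure_jv open_ball F(1)] partial_holo[OF F]])
qed

lemma analytic_ext_smooth: assumes "analytic_ext r f" shows "smooth_on (ball 0 r) f"
proof -
  obtain F where F: "holo jv jc (ball 0 r) F" "\<And>t. norm t < r \<Longrightarrow> f t = F (rvec t)"
    using assms unfolding analytic_ext_def by blast
  have "smooth_on (ball 0 r) (\<lambda>t. F (rvec t))"
    by (rule smooth_on_compose[OF smooth_on_linear[OF open_ball bounded_linear_rvec]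
          holo_smooth[OF complex_structure_jv complex_structure_jc open_ball F(1)]]) auto
  then show ?thesis by (rule smooth_on_cong) (use F(2) in auto)
qed

text \<open>The extension is given by the reflection \<open>x \<mapsto> cnj (F (cnj x))\<close>.\<close>

lemma analytic_ext_cnj: assumes "analytic_ext r f" shows "analytic_ext r (\<lambda>t. cnj (f t))"
proof -
  obtain F where F: "holo jv jc (ball 0 r) F" "\<And>t. norm t < r \<Longrightarrow> f t = F (rvec t)"
    using assms unfolding analytic_ext_def by blast
  define cj :: "complex ^ 'a \<Rightarrow> complex ^ 'a" where "cj = (\<lambda>x. \<chi> j. cnj (x $ j))"
  have lin: "linear cj" by (rule linearI) (auto simp: cj_def vec_eq_iff)
  have norm: "norm (cj x) = norm x" for x by (simp add: cj_def norm_vec_def L2_set_def)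
  show ?thesis
  proof (rule analytic_extI)
    show "holo jv jc (ball 0 r) (\<lambda>x. cnj (F (cj x)))"
    proof (rule holoI)
      fix x v :: "complex ^ 'a" assume "x \<in> ball 0 r"
      then have x: "cj x \<in> ball 0 r" by (simp add: norm)
      show "((\<lambda>x. cnj (F (cj x))) has_derivative (\<lambda>v. cnj (D F (cj x) (cj v)))) (at x)"
        by (rule bounded_linear.has_derivative[OF bounded_linear_cnj
              has_derivative_compose[OF linear_imp_has_derivative[OF lin] holo_D[OF F(1) x]]])
      have "cj (\<i> *s v) = - (\<i> *s cj v)" by (simp add: cj_def vec_eq_iff)
      then show "cnj (D F (cj x) (cj (\<i> *s v))) = \<i> * cnj (D F (cj x) (cj v))"
        by (simp add: linear_neg[OF holo_linear[OF F(1) x]] holo_D_commute[OF F(1) x])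
    qed
    show "cnj (f t) = cnj (F (cj (rvec t)))" if "norm t < r" for t
    proof -
      have "cj (rvec t) = rvec t" by (simp add: cj_def rvec_def vec_eq_iff)
      then show ?thesis using F(2)[OF that] by simp
    qed
  qed
qed

definition analytic_field :: "real \<Rightarrow> (real ^ 'm \<Rightarrow> complex ^ 'm) \<Rightarrow> bool" where
  "analytic_field r a \<longleftrightarrow> (\<forall>j. analytic_ext r (\<lambda>t. a t $ j))"

lemma analytic_field_smooth_field: "analytic_field r a \<Longrightarrow> smooth_field (ball 0 r) a"
  by (simp add: analytic_field_def smooth_field_def analytic_ext_smooth)

lemma analytic_ext_field_deriv: "analytic_field r a \<Longrightarrow> analytic_ext r f \<Longrightarrow> analytic_ext r (field_deriv a f)"
  unfolding field_deriv_def analytic_field_def by (intro analytic_ext_sum analytic_ext_mult analytic_ext_partial) auto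

lemma analytic_field_bracket: "analytic_field r a \<Longrightarrow> analytic_field r b \<Longrightarrow> analytic_field r (bracket a b)"
  unfolding analytic_field_def bracket_def vec_lambda_beta
  by (intro allI analytic_ext_diff analytic_ext_field_deriv) (auto simp: analytic_field_def)

text \<open>For continuous \<open>u\<close> such fields \<open>a\<close> form a Lie algebra and a module over the analytic functions.\<close>

definition analytic_direction :: "real \<Rightarrow> (real ^ 'm \<Rightarrow> complex) \<Rightarrow> (real ^ 'm \<Rightarrow> complex ^ 'm) \<Rightarrow> bool" where
  "analytic_direction r u a \<longleftrightarrow> analytic_field r a \<and> (\<exists>g. analytic_ext r g \<and> weak_deriv (ball 0 r) u a g)"

lemma analytic_ext_continuous: "analytic_ext r f \<Longrightarrow> continuous_on (ball 0 r) f"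
  by (rule smooth_on_continuous[OF analytic_ext_smooth])

lemma analytic_direction_smooth_field: "analytic_direction r u a \<Longrightarrow> smooth_field (ball 0 r) a"
  by (simp add: analytic_direction_def analytic_field_smooth_field)

lemma analytic_direction_mult: "analytic_ext r b \<Longrightarrow> analytic_direction r u a \<Longrightarrow> analytic_direction r u (\<lambda>t. b t *s a t)"
  unfolding analytic_direction_def analytic_field_def
  using weak_deriv_mult[OF open_ball analytic_ext_smooth, of r b u a] by (auto intro: analytic_ext_mult)

lemma analytic_direction_add:
  assumes u: "continuous_on (ball 0 r) u" and a: "analytic_direction r u a" and b: "analytic_direction r u b"
  shows "analytic_direction r u (\<lambda>t. a t + b t)"
proof -
  obtain g h where g: "analytic_ext r g" "weak_deriv (ball 0 r) u a g" and h: "analytic_ext r h" "weak_deriv (ball 0 r) u b h"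
    using a b unfolding analytic_direction_def by blast
  have "weak_deriv (ball 0 r) u (\<lambda>t. a t + b t) (\<lambda>t. g t + h t)"
    by (intro weak_deriv_add open_ball u analytic_direction_smooth_field[OF a] analytic_direction_smooth_field[OF b] analytic_ext_continuous g h)
  then show ?thesis
    using a b analytic_ext_add[OF g(1) h(1)] unfolding analytic_direction_def analytic_field_def by (auto intro: analytic_ext_add)
qed

text \<open>The new derivative \<open>a h - b g\<close> is again analytic.\<close>

lemma analytic_direction_bracket:
  assumes u: "continuous_on (ball 0 r) u" and a: "analytic_direction r u a" and b: "analytic_direction r u b"
  shows "analytic_direction r u (bracket a b)"
proof -
  obtain g h where g: "analytic_ext r g" "weak_deriv (ball 0 r) u a g" and h: "analytic_ext r h" "weak_deriv (ball 0 r) u b h"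
    using a b unfolding analytic_direction_def by blast
  have ab: "analytic_field r a" "analytic_field r b" using a b by (auto simp: analytic_direction_def)
  have "weak_deriv (ball 0 r) u (bracket a b) (\<lambda>t. field_deriv a h t - field_deriv b g t)"
    by (intro weak_deriv_bracket open_ball u analytic_direction_smooth_field[OF a] analytic_direction_smooth_field[OF b] analytic_ext_smooth g h)
  moreover have "analytic_ext r (\<lambda>t. field_deriv a h t - field_deriv b g t)"
    by (intro analytic_ext_diff analytic_ext_field_deriv ab g h)
  ultimately show ?thesis using analytic_field_bracket[OF ab] unfolding analytic_direction_def by blast
qed

lemma analytic_direction_zero: "analytic_direction r u (\<lambda>_. 0)"
proof -
  have "weak_deriv (ball 0 r) u (\<lambda>_. 0) (\<lambda>_. 0)"
    by (simp add: weak_deriv_def div_mult_def frechet_derivative_const set_lebesgue_integral_def)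
  then show ?thesis using analytic_ext_const unfolding analytic_direction_def analytic_field_def by auto
qed

lemma analytic_direction_cong:
  assumes "analytic_direction r u a" "\<And>t. norm t < r \<Longrightarrow> a t = b t"
  shows "analytic_direction r u b"
proof -
  obtain g where g: "analytic_ext r g" "weak_deriv (ball 0 r) u a g" using assms unfolding analytic_direction_def by blast
  have "weak_deriv (ball 0 r) u b g" by (rule weak_deriv_cong[OF open_ball _ _ _ g(2)]) (use assms(2) in auto)
  moreover have "analytic_field r b"
    using assms unfolding analytic_direction_def analytic_field_def analytic_ext_def by metis
  ultimately show ?thesis using g unfolding analytic_direction_def by blast
qed

lemma analytic_direction_sum:
  assumes "continuous_on (ball 0 r) u" "\<And>i. i \<in> A \<Longrightarrow> analytic_direction r u (a i)"
  shows "analytic_direction r u (\<lambda>t. \<Sum>i\<in>A. a i t)"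
  using assms(2)
  by (induction A rule: infinite_finite_induct) (auto intro: analytic_direction_zero analytic_direction_add[OF assms(1)])

text \<open>Combinations of analytic directions with smooth coefficients on \<open>V\<close>. Smooth CR fields belong to this
  module, and it is closed under brackets; at a single point its values are those of the analytic
  directions.\<close>

inductive direction_span :: "real \<Rightarrow> (real ^ 'm \<Rightarrow> complex) \<Rightarrow> (real ^ 'm) set \<Rightarrow> (real ^ 'm \<Rightarrow> complex ^ 'm) \<Rightarrow> bool"
  for r u V where
  zero: "direction_span r u V (\<lambda>_. 0)"
| step: "smooth_on V c \<Longrightarrow> analytic_direction r u a \<Longrightarrow> direction_span r u V s \<Longrightarrow> direction_span r u V (\<lambda>t. c t *s a t + s t)"
| cong: "direction_span r u V s \<Longrightarrow> (\<And>t. t \<in> V \<Longrightarrow> s t = s' t) \<Longrightarrow> direction_span r u V s'"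

lemma field_deriv_mult:
  "smooth_on V f \<Longrightarrow> smooth_on V g \<Longrightarrow> t \<in> V \<Longrightarrow> field_deriv a (\<lambda>s. f s * g s) t = f t * field_deriv a g t + field_deriv a f t * g t"
  by (simp add: field_deriv_def partial_mult sum.distrib sum_distrib_left sum_distrib_right algebra_simps)

lemma field_deriv_add:
  "smooth_on V f \<Longrightarrow> smooth_on V g \<Longrightarrow> t \<in> V \<Longrightarrow> field_deriv a (\<lambda>s. f s + g s) t = field_deriv a f t + field_deriv a g t"
  by (simp add: field_deriv_def partial_add sum.distrib algebra_simps)

lemma field_deriv_field:
  "field_deriv (\<lambda>t. c t *s b t + s t) f t = c t * field_deriv b f t + field_deriv s f t"
  by (simp add: field_deriv_def sum.distrib sum_distrib_left algebra_simps)

lemma bracket_antisym: "bracket a b t = - bracket b a t"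
  by (simp add: bracket_def vec_eq_iff)

text \<open>The Leibniz rule, with the terms ordered as in the definition of \<open>direction_span\<close>.\<close>

lemma bracket_module:
  assumes b: "smooth_field V b" and s': "smooth_field V s'" and c: "smooth_on V c" and t: "t \<in> V"
  shows "bracket s (\<lambda>t. c t *s b t + s' t) t = field_deriv s c t *s b t + (c t *s bracket s b t + bracket s s' t)"
proof (rule vec_eq_iff[THEN iffD2, rule_format])
  fix j
  note bj = smooth_field_smooth[OF b, of j] and sj = smooth_field_smooth[OF s', of j]
  have "field_deriv s (\<lambda>x. c x * b x $ j + s' x $ j) t
      = (c t * field_deriv s (\<lambda>x. b x $ j) t + field_deriv s c t * b t $ j) + field_deriv s (\<lambda>x. s' x $ j) t"
    by (simp only: field_deriv_add[OF smooth_on_mult[OF c bj] sj t] field_deriv_mult[OF c bj t])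
  then show "bracket s (\<lambda>t. c t *s b t + s' t) t $ j = (field_deriv s c t *s b t + (c t *s bracket s b t + bracket s s' t)) $ j"
    unfolding bracket_def vec_lambda_beta field_deriv_field vector_add_component vector_smult_component
    by (simp add: algebra_simps)
qed

lemma field_deriv_cong: "open V \<Longrightarrow> t \<in> V \<Longrightarrow> a t = a' t \<Longrightarrow> (\<And>t. t \<in> V \<Longrightarrow> f t = f' t) \<Longrightarrow> field_deriv a f t = field_deriv a' f' t"
  unfolding field_deriv_def using partial_cong by (metis (mono_tags, lifting))

lemma bracket_cong:
  assumes "open V" "t \<in> V" "\<And>t. t \<in> V \<Longrightarrow> a t = a' t" "\<And>t. t \<in> V \<Longrightarrow> b t = b' t"
  shows "bracket a b t = bracket a' b' t"
  unfolding bracket_def using assms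
  by (intro vec_eq_iff[THEN iffD2] allI) (auto intro!: arg_cong2[where f="(-)"] field_deriv_cong[of V])

context
  fixes r :: real and u :: "real ^ 'm \<Rightarrow> complex" and V :: "(real ^ 'm) set"
  assumes u: "continuous_on (ball 0 r) u" and V: "open V" "V \<subseteq> ball 0 r"
begin

lemma analytic_direction_smooth_field_V: "analytic_direction r u a \<Longrightarrow> smooth_field V a"
  unfolding smooth_field_def
  by (intro allI, rule smooth_on_subset[OF smooth_field_smooth[OF analytic_direction_smooth_field] V], assumption)

lemma direction_span_smooth_field: "direction_span r u V s \<Longrightarrow> smooth_field V s"
proof (induction rule: direction_span.induct)
  case (step c a s)
  then show ?case
    using analytic_direction_smooth_field_V[OF step(2)] unfolding smooth_field_def by (auto intro!: smooth_on_add smooth_on_mult)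
next
  case (cong s s')
  show ?case
    unfolding smooth_field_def
    by (intro allI, rule smooth_on_cong[OF smooth_field_smooth[OF cong.IH]]) (simp add: cong.hyps)
next
  case zero
  show ?case unfolding smooth_field_def by (simp add: smooth_on_const[OF V(1)])
qed

lemma direction_span_add: "direction_span r u V s \<Longrightarrow> direction_span r u V s' \<Longrightarrow> direction_span r u V (\<lambda>t. s t + s' t)"
proof (induction rule: direction_span.induct)
  case (step c a s)
  show ?case
    by (rule direction_span.cong[OF direction_span.step[OF step(1,2) step.IH[OF step.prems]]]) (simp add: add.assoc)
next
  case (cong s s'')
  show ?case by (rule direction_span.cong[OF cong.IH[OF cong.prems]]) (simp add: cong.hyps)
qed simp

lemma direction_span_mult: "direction_span r u V s \<Longrightarrow> smooth_on V c \<Longrightarrow> direction_span r u V (\<lambda>t. c t *s s t)"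
proof (induction rule: direction_span.induct)
  case zero
  show ?case by (rule direction_span.cong[OF direction_span.zero]) simp
next
  case (step c' a s)
  show ?case
    by (rule direction_span.cong[OF direction_span.step[OF smooth_on_mult[OF step.prems step(1)] step(2) step.IH[OF step.prems]]])
       (simp add: vec_eq_iff algebra_simps)
next
  case (cong s s'')
  show ?case by (rule direction_span.cong[OF cong.IH[OF cong.prems]]) (simp add: cong.hyps)
qed

lemma direction_span_analytic_direction_mult:
  "smooth_on V c \<Longrightarrow> analytic_direction r u a \<Longrightarrow> direction_span r u V (\<lambda>t. c t *s a t)"
  by (rule direction_span.cong[OF direction_span.step[OF _ _ direction_span.zero]]) auto

lemma direction_span_sum:
  "(\<And>i. i \<in> A \<Longrightarrow> direction_span r u V (s i)) \<Longrightarrow> direction_span r u V (\<lambda>t. \<Sum>i\<in>A. s i t)"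
  by (induction A rule: infinite_finite_induct) (auto intro: direction_span.zero direction_span_add)

text \<open>The Leibniz rule for the second argument, made available for the first by antisymmetry.\<close>

lemma direction_span_bracket_analytic_direction:
  assumes b: "analytic_direction r u b" shows "direction_span r u V s \<Longrightarrow> direction_span r u V (bracket s b)"
proof (induction rule: direction_span.induct)
  case zero
  show ?case
    by (rule direction_span.cong[OF direction_span.zero]) (simp add: bracket_def field_deriv_def frechet_derivative_const vec_eq_iff)
next
  case (step c a s)
  have c': "smooth_on V (\<lambda>t. - field_deriv b c t)"
    using smooth_on_linear_compose[OF bounded_linear_minus[OF bounded_linear_ident]
        smooth_field_deriv[OF V(1) analytic_direction_smooth_field_V[OF b] step(1)]] by simp
  show ?case
  proof (rule direction_span.cong)
    show "direction_span r u V (\<lambda>t. - field_deriv b c t *s a t + (c t *s bracket a b t + bracket s b t))"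
      by (intro direction_span.step[OF c' step(2)] direction_span.step[OF step(1) analytic_direction_bracket[OF u step(2) b]] step.IH)
    show "- field_deriv b c t *s a t + (c t *s bracket a b t + bracket s b t) = bracket (\<lambda>t. c t *s a t + s t) b t" if "t \<in> V" for t
      unfolding bracket_antisym[of "\<lambda>t. c t *s a t + s t"] bracket_antisym[of a b] bracket_antisym[of s b]
        bracket_module[OF analytic_direction_smooth_field_V[OF step(2)] direction_span_smooth_field[OF step(3)] step(1) that]
      by (simp add: vec_eq_iff)
  qed
next
  case (cong s s')
  show ?case by (rule direction_span.cong[OF cong.IH]) (auto intro!: bracket_cong[OF V(1)] cong.hyps)
qed

text \<open>The bracket with a single analytic field provides the terms \<open>[s, b]\<close> of the Leibniz rule.\<close>

lemma direction_span_bracket: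
  assumes s: "direction_span r u V s" shows "direction_span r u V s' \<Longrightarrow> direction_span r u V (bracket s s')"
proof (induction rule: direction_span.induct)
  case zero
  show ?case
    by (rule direction_span.cong[OF direction_span.zero]) (simp add: bracket_def field_deriv_def frechet_derivative_const vec_eq_iff)
next
  case (step c b s')
  show ?case
  proof (rule direction_span.cong)
    show "direction_span r u V (\<lambda>t. field_deriv s c t *s b t + (c t *s bracket s b t + bracket s s' t))"
      by (intro direction_span.step[OF smooth_field_deriv[OF V(1) direction_span_smooth_field[OF s] step(1)] step(2)] direction_span_add
          direction_span_mult[OF direction_span_bracket_analytic_direction[OF step(2) s] step(1)] step.IH)
    show "field_deriv s c t *s b t + (c t *s bracket s b t + bracket s s' t) = bracket s (\<lambda>t. c t *s b t + s' t) t" if "t \<in> V" for t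
      by (rule bracket_module[OF analytic_direction_smooth_field_V[OF step(2)] direction_span_smooth_field[OF step(3)] step(1) that, symmetric])
  qed
next
  case (cong s' s'')
  show ?case by (rule direction_span.cong[OF cong.IH]) (auto intro!: bracket_cong[OF V(1)] cong.hyps)
qed

text \<open>Smooth coefficients can be frozen at the point \<open>t\<close>.\<close>

lemma direction_span_value: "direction_span r u V s \<Longrightarrow> t \<in> V \<Longrightarrow> \<exists>a. analytic_direction r u a \<and> a t = s t"
proof (induction rule: direction_span.induct)
  case zero
  show ?case using analytic_direction_zero by fast
next
  case (step c a s)
  then obtain b where b: "analytic_direction r u b" "b t = s t" by blast
  have "analytic_direction r u (\<lambda>x. c t *s a x + b x)" by (intro analytic_direction_add u analytic_direction_mult analytic_ext_const step b)
  with b show ?case by fastforce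
next
  case (cong s s')
  then show ?case by simp
qed

end

context cr_chart
begin

abbreviation E :: "'m \<Rightarrow> real ^ 'm \<Rightarrow> (complex ^ 'n) \<times> (complex ^ 'n)" where
  "E k t \<equiv> D \<Phi> (rvec t) (axis k 1)"

lemma smooth_E: "smooth_on (ball 0 r) (E k)"
  by (rule smooth_on_cong[OF smooth_on_derivative[OF smooth_\<Phi>r, of "axis k 1"]])
     (simp add: D_\<Phi>r rvec_axis)

lemma partial_E_symmetric: assumes t: "norm t < r" shows "partial j (E k) t = partial k (E j) t"
proof -
  have e: "partial j (E k) t = partial j (partial k (\<lambda>t. \<Phi> (rvec t))) t" for j k
    by (rule partial_cong[of "ball 0 r"]) (use t in \<open>auto simp: D_\<Phi>r rvec_axis\<close>)
  show ?thesis unfolding e by (rule second_derivative_symmetric[OF smooth_\<Phi>r]) (use t in simp)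
qed

lemma D_\<Phi>_E: "norm t < r \<Longrightarrow> D \<Phi> (rvec t) c = (\<Sum>k\<in>UNIV. cscale jp (c $ k) (E k t))"
  by (rule holo_D_vec[OF h\<Phi>]) simp

text \<open>The chain rule along the chart. The first sum, which contains the second derivatives of the chart, is
  symmetric in the two fields and cancels in brackets.\<close>

lemma ctan_deriv_chart:
  assumes V: "open V" "V \<subseteq> ball 0 r" and K: "smooth_on N K" "\<phi> ` V \<subseteq> N"
    and b: "smooth_field V b" and Kb: "\<And>t. t \<in> V \<Longrightarrow> K (\<phi> t) = D \<Phi> (rvec t) (b t)" and t: "t \<in> V"
  shows "ctan_deriv K (\<phi> t) (D \<Phi> (rvec t) c)
     = (\<Sum>j\<in>UNIV. \<Sum>k\<in>UNIV. cscale jp (c $ j * b t $ k) (partial j (E k) t))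
       + (\<Sum>k\<in>UNIV. cscale jp (\<Sum>j\<in>UNIV. c $ j * partial j (\<lambda>s. b s $ k) t) (E k t))"
proof -
  interpret cscale: bounded_bilinear "cscale (jp :: (complex ^ 'n) \<times> (complex ^ 'n) \<Rightarrow> _)"
    by (rule bounded_bilinear_cscale) simp
  have tr: "norm t < r" using t V by auto
  have smE: "smooth_on V (E k)" for k by (rule smooth_on_subset[OF smooth_E V])
  define Q where "Q = (\<lambda>j. \<Sum>k\<in>UNIV. cscale jp (b t $ k) (partial j (E k) t) + cscale jp (partial j (\<lambda>s. b s $ k) t) (E k t))"
  have linK: "linear (D K (\<phi> t))"
    by (rule has_derivative_linear[OF smooth_on_D[OF K(1)]]) (use K(2) t in blast)
  have d\<phi>: "(\<phi> has_derivative D \<phi> t) (at t)" by (rule smooth_on_D[OF smooth_\<phi>]) (use tr in simp)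
  have Q: "D K (\<phi> t) (D \<phi> t (axis j 1)) = Q j" for j
  proof -
    have "((\<lambda>s. K (\<phi> s)) has_derivative (\<lambda>v. D K (\<phi> t) (D \<phi> t v))) (at t)"
      by (rule has_derivative_compose[OF d\<phi> smooth_on_D[OF K(1)]]) (use K(2) t in blast)
    from has_derivative_D[OF this] have "D K (\<phi> t) (D \<phi> t (axis j 1)) = partial j (\<lambda>s. K (\<phi> s)) t" by simp
    also have "\<dots> = partial j (\<lambda>s. \<Sum>k\<in>UNIV. cscale jp (b s $ k) (E k s)) t"
    proof (rule partial_cong[OF V(1) t])
      fix s assume "s \<in> V"
      then show "K (\<phi> s) = (\<Sum>k\<in>UNIV. cscale jp (b s $ k) (E k s))"
        unfolding Kb[OF \<open>s \<in> V\<close>] using V(2) by (intro D_\<Phi>_E) auto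
    qed
    also have "\<dots> = Q j"
    proof -
      have "((\<lambda>s. \<Sum>k\<in>UNIV. cscale jp (b s $ k) (E k s)) has_derivative
         (\<lambda>v. \<Sum>k\<in>UNIV. cscale jp (b t $ k) (D (E k) t v) + cscale jp (D (\<lambda>s. b s $ k) t v) (E k t))) (at t)"
        by (intro has_derivative_sum cscale.FDERIV smooth_on_D[OF smE t] smooth_on_D[OF smooth_field_smooth[OF b] t])
      from has_derivative_D[OF this] show ?thesis by (simp add: Q_def)
    qed
    finally show ?thesis .
  qed
  have real: "D K (\<phi> t) (D \<phi> t v) = (\<Sum>j\<in>UNIV. (v $ j) *\<^sub>R Q j)" for v
  proof -
    have e: "v = (\<Sum>j\<in>UNIV. v $ j *\<^sub>R axis j 1)" by (simp add: vec_eq_iff axis_def if_distrib cong: if_cong)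
    have lin: "linear (\<lambda>v. D K (\<phi> t) (D \<phi> t v))"
      using linear_compose[OF has_derivative_linear[OF d\<phi>] linK] by (simp only: o_def)
    have "D K (\<phi> t) (D \<phi> t v) = D K (\<phi> t) (D \<phi> t (\<Sum>j\<in>UNIV. v $ j *\<^sub>R axis j 1))"
      by (rule arg_cong[OF e])
    also have "\<dots> = (\<Sum>j\<in>UNIV. (v $ j) *\<^sub>R Q j)"
      by (simp add: linear_sum[OF lin] linear_scale[OF lin] Q)
    finally show ?thesis .
  qed
  have "ctan_deriv K (\<phi> t) (D \<Phi> (rvec t) c)
      = (\<Sum>j\<in>UNIV. Re (c $ j) *\<^sub>R Q j) + jp (\<Sum>j\<in>UNIV. Im (c $ j) *\<^sub>R Q j)"
    unfolding ctan_deriv_def D_\<Phi>[OF tr] ctan_scale_cscale fst_conv snd_conv real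
    by (simp add: Revec_def Imvec_def)
  also have "\<dots> = (\<Sum>j\<in>UNIV. cscale jp (c $ j) (Q j))"
    by (simp add: cscale_def linear_sum[OF linear_jp] linear_scale[OF linear_jp] sum.distrib)
  also have "\<dots> = (\<Sum>j\<in>UNIV. \<Sum>k\<in>UNIV. cscale jp (c $ j * b t $ k) (partial j (E k) t))
      + (\<Sum>j\<in>UNIV. \<Sum>k\<in>UNIV. cscale jp (c $ j * partial j (\<lambda>s. b s $ k) t) (E k t))"
    unfolding Q_def cscale.sum_right cscale.add_right sum.distrib
    by (simp only: cscale_mult[OF complex_structure_jp])
  also have "(\<Sum>j\<in>UNIV. \<Sum>k\<in>UNIV. cscale jp (c $ j * partial j (\<lambda>s. b s $ k) t) (E k t))
      = (\<Sum>k\<in>UNIV. cscale jp (\<Sum>j\<in>UNIV. c $ j * partial j (\<lambda>s. b s $ k) t) (E k t))"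
    unfolding cscale.sum_left by (rule sum.swap)
  finally show ?thesis .
qed

lemma lie_bracket_chart:
  assumes V: "open V" "V \<subseteq> ball 0 r" and N: "\<phi> ` V \<subseteq> N" and L: "smooth_on N L" and K: "smooth_on N K"
    and a: "smooth_field V a" and b: "smooth_field V b"
    and La: "\<And>t. t \<in> V \<Longrightarrow> L (\<phi> t) = D \<Phi> (rvec t) (a t)"
    and Kb: "\<And>t. t \<in> V \<Longrightarrow> K (\<phi> t) = D \<Phi> (rvec t) (b t)" and t: "t \<in> V"
  shows "lie_bracket L K (\<phi> t) = D \<Phi> (rvec t) (bracket a b t)"
proof -
  interpret cscale: bounded_bilinear "cscale (jp :: (complex ^ 'n) \<times> (complex ^ 'n) \<Rightarrow> _)"
    by (rule bounded_bilinear_cscale) simp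
  have tr: "norm t < r" using t V by auto
  have sym: "(\<Sum>j\<in>UNIV. \<Sum>k\<in>UNIV. cscale jp (a t $ j * b t $ k) (partial j (E k) t))
      = (\<Sum>j\<in>UNIV. \<Sum>k\<in>UNIV. cscale jp (b t $ j * a t $ k) (partial j (E k) t))"
    by (subst sum.swap) (simp only: partial_E_symmetric[OF tr, of _ _] mult.commute)
  have 1: "ctan_deriv K (\<phi> t) (D \<Phi> (rvec t) (a t))
     = (\<Sum>j\<in>UNIV. \<Sum>k\<in>UNIV. cscale jp (a t $ j * b t $ k) (partial j (E k) t))
       + (\<Sum>k\<in>UNIV. cscale jp (\<Sum>j\<in>UNIV. a t $ j * partial j (\<lambda>s. b s $ k) t) (E k t))"
    by (rule ctan_deriv_chart[OF V K N b Kb t])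
  have 2: "ctan_deriv L (\<phi> t) (D \<Phi> (rvec t) (b t))
     = (\<Sum>j\<in>UNIV. \<Sum>k\<in>UNIV. cscale jp (b t $ j * a t $ k) (partial j (E k) t))
       + (\<Sum>k\<in>UNIV. cscale jp (\<Sum>j\<in>UNIV. b t $ j * partial j (\<lambda>s. a s $ k) t) (E k t))"
    by (rule ctan_deriv_chart[OF V L N a La t])
  have "lie_bracket L K (\<phi> t)
      = (\<Sum>k\<in>UNIV. cscale jp (\<Sum>j\<in>UNIV. a t $ j * partial j (\<lambda>s. b s $ k) t) (E k t))
      - (\<Sum>k\<in>UNIV. cscale jp (\<Sum>j\<in>UNIV. b t $ j * partial j (\<lambda>s. a s $ k) t) (E k t))"
    unfolding lie_bracket_def La[OF t] Kb[OF t] 1 2 sym by simp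
  also have "\<dots> = (\<Sum>k\<in>UNIV. cscale jp (bracket a b t $ k) (E k t))"
    by (simp add: bracket_def field_deriv_def cscale.diff_left sum_subtractf)
  also have "\<dots> = D \<Phi> (rvec t) (bracket a b t)" by (rule D_\<Phi>_E[OF tr, symmetric])
  finally show ?thesis .
qed

text \<open>Smooth CR fields are smooth combinations of the analytic spanning fields \<open>l\<close>, so the fields of the Lie algebra that
  they and their conjugates generate have, in the chart, components in the module over the analytic
  fields along which \<open>u\<close> has analytic derivatives.\<close>

lemma cr_lie_algebra_direction_span:
  assumes u: "continuous_on (ball 0 r) u" and N: "open N"
    and l: "\<And>j. analytic_direction r u (\<lambda>t. l j (rvec t))" and l': "\<And>j. analytic_direction r u (\<lambda>t. \<chi> i. cnj (l j (rvec t) $ i))"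
    and frame: "\<And>x c. norm x < r \<Longrightarrow> zmap (D \<Phi> x c) = 0 \<Longrightarrow> c = (\<Sum>j\<in>UNIV. c $ j *s l j x)"
    and V: "V = {t \<in> ball 0 r. \<phi> t \<in> N}" and L: "L \<in> cr_lie_algebra M N"
  shows "smooth_on N L \<and> (\<exists>a. direction_span r u V a \<and> (\<forall>t\<in>V. L (\<phi> t) = D \<Phi> (rvec t) (a t)))"
proof -
  have oV: "open V"
    using continuous_open_preimage[OF smooth_on_continuous[OF smooth_\<phi>] open_ball N]
    by (simp add: V vimage_def Int_def)
  have Vr: "V \<subseteq> ball 0 r" and VO: "\<phi> ` V \<subseteq> N" by (auto simp: V)
  note ctx = u oV Vr
  have cr_field: "smooth_on N L \<and> (\<exists>a. (\<forall>j. smooth_on V (\<lambda>t. a t $ j)) \<and>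
      (\<forall>t\<in>V. L (\<phi> t) = D \<Phi> (rvec t) (a t) \<and> a t = (\<Sum>j\<in>UNIV. a t $ j *s l j (rvec t))))"
    if L: "cr_vector_field M N L" for L
  proof -
    have smL: "smooth_on N L" using L by (simp add: cr_vector_field_def)
    define a where "a = (\<lambda>t. D \<Xi> (\<Phi> (rvec t)) (L (\<phi> t)))"
    have main: "L (\<phi> t) = D \<Phi> (rvec t) (a t) \<and> a t = (\<Sum>j\<in>UNIV. a t $ j *s l j (rvec t))" if "t \<in> V" for t
    proof -
      have t: "norm t < r" "\<phi> t \<in> N" using that by (auto simp: V)
      then have Lt: "L (\<phi> t) \<in> T01 \<inter> complexified_tangent_space M (\<phi> t)"
        using L \<phi>_in[of t] unfolding cr_vector_field_def by blast
      then obtain c where c: "L (\<phi> t) = D \<Phi> (rvec t) c"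
        unfolding complexified_tangent_space_\<phi>[OF t(1)] by blast
      have "a t = c" using D_\<Xi>_\<Phi>[of "rvec t" c] t by (simp add: a_def c)
      moreover have "zmap (D \<Phi> (rvec t) c) = 0" using Lt c by (simp add: T01_iff)
      ultimately show ?thesis using frame[of "rvec t" c] t c by simp
    qed
    have sa: "smooth_on V (\<lambda>t. a t $ j)" for j
    proof -
      have smLV: "smooth_on V (\<lambda>t. L (\<phi> t))"
        by (rule smooth_on_compose[OF smooth_on_subset[OF smooth_\<phi> oV Vr] smL VO])
      have smD: "smooth_on V (\<lambda>t. D \<Xi> (\<Phi> (rvec t)) b)" for b
      proof (rule smooth_on_compose[OF smooth_on_subset[OF smooth_\<Phi>r oV Vr]])
        show "smooth_on S (\<lambda>w. D \<Xi> w b)"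
          by (rule smooth_on_derivative[OF holo_smooth[OF complex_structure_jp complex_structure_jv S h\<Xi>]])
        show "(\<lambda>t. \<Phi> (rvec t)) ` V \<subseteq> S" using \<Xi>\<Phi> Vr by auto
      qed
      have "smooth_on V (\<lambda>t. \<Sum>b\<in>Basis. (L (\<phi> t) \<bullet> b) *\<^sub>R D \<Xi> (\<Phi> (rvec t)) b)"
        by (intro smooth_on_sum oV smooth_on_scaleR smooth_on_linear_compose[OF bounded_linear_inner_left] smLV smD)
      then have "smooth_on V a"
      proof (rule smooth_on_cong)
        fix t assume "t \<in> V"
        then have "\<Phi> (rvec t) \<in> S" using \<Xi>\<Phi>[of "rvec t"] Vr by auto
        then show "(\<Sum>b\<in>Basis. (L (\<phi> t) \<bullet> b) *\<^sub>R D \<Xi> (\<Phi> (rvec t)) b) = a t"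
          unfolding a_def by (rule linear_Basis_expansion[OF holo_linear[OF h\<Xi>], symmetric])
      qed
      then show ?thesis by (rule smooth_on_linear_compose[OF bounded_linear_vec_nth])
    qed
    show ?thesis
    proof (intro conjI exI[of _ a] allI ballI)
      show "smooth_on N L" by (rule smL)
      show "smooth_on V (\<lambda>t. a t $ j)" for j by (rule sa)
      show "L (\<phi> t) = D \<Phi> (rvec t) (a t)" "a t = (\<Sum>j\<in>UNIV. a t $ j *s l j (rvec t))" if "t \<in> V" for t
        using main[OF that] by auto
    qed
  qed
  show ?thesis
    using L
  proof (induction rule: cr_lie_algebra.induct)
    case (cr L)
    obtain a :: "real ^ 'm \<Rightarrow> complex ^ 'm" where a: "\<And>j. smooth_on V (\<lambda>t. a t $ j)"
      "\<And>t. t \<in> V \<Longrightarrow> L (\<phi> t) = D \<Phi> (rvec t) (a t) \<and> a t = (\<Sum>j\<in>UNIV. a t $ j *s l j (rvec t))"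
      and sm: "smooth_on N L"
      using cr_field[OF cr] by blast
    have "direction_span r u V (\<lambda>t. \<Sum>j\<in>UNIV. a t $ j *s l j (rvec t))"
      by (intro direction_span_sum[OF ctx] direction_span_analytic_direction_mult[OF ctx] a l)
    moreover have "L (\<phi> t) = D \<Phi> (rvec t) (\<Sum>j\<in>UNIV. a t $ j *s l j (rvec t))" if "t \<in> V" for t
      using a(2)[OF that] by metis
    ultimately show ?case using sm by blast
  next
    case (cr_cnj L)
    obtain a :: "real ^ 'm \<Rightarrow> complex ^ 'm" where a: "\<And>j. smooth_on V (\<lambda>t. a t $ j)"
      "\<And>t. t \<in> V \<Longrightarrow> L (\<phi> t) = D \<Phi> (rvec t) (a t) \<and> a t = (\<Sum>j\<in>UNIV. a t $ j *s l j (rvec t))"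
      and sm: "smooth_on N L"
      using cr_field[OF cr_cnj] by blast
    define a' where "a' = (\<lambda>t. \<Sum>j\<in>UNIV. cnj (a t $ j) *s (\<chi> i. cnj (l j (rvec t) $ i)))"
    have "direction_span r u V a'"
      unfolding a'_def
      by (intro direction_span_sum[OF ctx] direction_span_analytic_direction_mult[OF ctx] smooth_on_linear_compose[OF bounded_linear_cnj] a l')
    moreover have "ctan_cnj (L (\<phi> t)) = D \<Phi> (rvec t) (a' t)" if t: "t \<in> V" for t
    proof -
      have tr: "norm t < r" using t Vr by auto
      have "a' t = (\<chi> i. cnj (a t $ i))"
      proof (rule vec_eq_iff[THEN iffD2, rule_format])
        fix i
        have "a t $ i = (\<Sum>j\<in>UNIV. a t $ j *s l j (rvec t)) $ i" using a(2)[OF t] by metis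
        then have "cnj (a t $ i) = (\<Sum>j\<in>UNIV. cnj (a t $ j) * cnj (l j (rvec t) $ i))" by simp
        then show "a' t $ i = (\<chi> i. cnj (a t $ i)) $ i" by (simp add: a'_def)
      qed
      then have "Revec (a' t) = Revec (a t)" "Imvec (a' t) = - Imvec (a t)"
        by (simp_all add: Revec_def Imvec_def vec_eq_iff)
      moreover have "D \<phi> t (- x) = - D \<phi> t x" for x
        by (rule linear_neg[OF has_derivative_linear[OF smooth_on_D[OF smooth_\<phi>]]]) (use tr in simp)
      ultimately show ?thesis using a(2)[OF t] by (simp add: ctan_cnj_def D_\<Phi>[OF tr])
    qed
    moreover have "smooth_on N (\<lambda>p. ctan_cnj (L p))"
    proof -
      have "bounded_linear (\<lambda>w :: (complex ^ 'n) \<times> (complex ^ 'n). (fst w, - snd w))"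
        by (intro bounded_linear_Pair bounded_linear_minus bounded_linear_fst bounded_linear_snd)
      from smooth_on_linear_compose[OF this sm] show ?thesis by (simp add: ctan_cnj_def)
    qed
    ultimately show ?case by blast
  next
    case (add L K)
    then obtain a b where a: "direction_span r u V a" "\<And>t. t \<in> V \<Longrightarrow> L (\<phi> t) = D \<Phi> (rvec t) (a t)"
      and b: "direction_span r u V b" "\<And>t. t \<in> V \<Longrightarrow> K (\<phi> t) = D \<Phi> (rvec t) (b t)" by blast
    have "L (\<phi> t) + K (\<phi> t) = D \<Phi> (rvec t) (a t + b t)" if "t \<in> V" for t
      using a(2)[OF that] b(2)[OF that] linear_add[OF holo_linear[OF h\<Phi>, of "rvec t"]] that Vr by auto
    then show ?case using add.IH direction_span_add[OF ctx a(1) b(1)] smooth_on_add by blast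
  next
    case (scale L c)
    then obtain a where a: "direction_span r u V a" "\<And>t. t \<in> V \<Longrightarrow> L (\<phi> t) = D \<Phi> (rvec t) (a t)" by blast
    have "cscale jp c (L (\<phi> t)) = D \<Phi> (rvec t) (c *s a t)" if "t \<in> V" for t
      using a(2)[OF that] holo_D_cscale[OF h\<Phi>, of "rvec t" c "a t"] that Vr by auto
    moreover have "smooth_on N (\<lambda>p. cscale jp c (L p))"
      using scale.IH
      by (intro smooth_on_linear_compose[OF bounded_bilinear.bounded_linear_right[OF bounded_bilinear_cscale]]) auto
    ultimately show ?case
      unfolding ctan_scale_cscale using direction_span_mult[OF ctx a(1) smooth_on_const[OF oV, of c]] by blast
  next
    case (bracket L K)
    then obtain a b where a: "direction_span r u V a" "\<And>t. t \<in> V \<Longrightarrow> L (\<phi> t) = D \<Phi> (rvec t) (a t)"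
      and b: "direction_span r u V b" "\<And>t. t \<in> V \<Longrightarrow> K (\<phi> t) = D \<Phi> (rvec t) (b t)"
      and sL: "smooth_on N L" and sK: "smooth_on N K" by blast
    have sc: "smooth_on N (\<lambda>p. ctan_deriv K p (L p))" if "smooth_on N K" "smooth_on N L"
      for K L :: "complex ^ 'n \<Rightarrow> (complex ^ 'n) \<times> (complex ^ 'n)"
      unfolding ctan_deriv_def ctan_scale_cscale
      by (intro smooth_on_add smooth_on_derivative_along that
          smooth_on_linear_compose[OF bounded_bilinear.bounded_linear_right[OF bounded_bilinear_cscale]]
          smooth_on_linear_compose[OF bounded_linear_fst] smooth_on_linear_compose[OF bounded_linear_snd]) simp
    have "smooth_on N (lie_bracket L K)"
      unfolding lie_bracket_def[abs_def] by (intro smooth_on_diff sc sL sK)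
    moreover have "lie_bracket L K (\<phi> t) = D \<Phi> (rvec t) (bracket a b t)" if "t \<in> V" for t
      by (rule lie_bracket_chart[OF oV Vr VO sL sK direction_span_smooth_field[OF ctx a(1)] direction_span_smooth_field[OF ctx b(1)] a(2) b(2) that])
    ultimately show ?case using direction_span_bracket[OF ctx a(1) b(1)] by blast
  qed
qed

end

section \<open>Analyticity and holomorphic extension\<close>

lemma (in cr_chart) cr_chart_shrink:
  assumes s: "0 < s" "s \<le> r"
  shows "cr_chart M W p0 s \<Phi> \<Xi> S {X \<in> U. norm (\<Xi> (X, 0)) < s}"
proof
  let ?U = "{X \<in> U. norm (\<Xi> (X, 0)) < s}"
  show "0 < s" "open S" "holo jp jv S \<Xi>" "\<Phi> 0 = (p0, 0)" by (rule s S h\<Xi> \<Phi>0)+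
  show "holo jv jp (ball 0 s) \<Phi>" by (rule holo_subset[OF h\<Phi>]) (use s in auto)
  show "snd (\<Phi> (rvec t)) = 0" if "norm t < s" for t using \<Phi>real that s by simp
  show "\<Phi> x \<in> S \<and> \<Xi> (\<Phi> x) = x" if "norm x < s" for x using \<Xi>\<Phi> that s by simp
  have "continuous_on U (\<lambda>X. \<Xi> (X, 0))"
    by (intro continuous_on_compose2[OF holo_continuous[OF h\<Xi>]] continuous_intros) (use U\<Xi> in auto)
  from continuous_open_preimage[OF this U(1) open_ball, of 0 s]
  show "open ?U" by (simp add: vimage_def Int_def)
  show "?U \<subseteq> W" using U(2) by blast
  show "(X, 0) \<in> S \<and> (\<exists>t. norm t < s \<and> \<Xi> (X, 0) = rvec t)" if "X \<in> ?U" for X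
    using U\<Xi>[of X] that by auto
  show "M \<inter> ?U = (\<lambda>t. fst (\<Phi> (rvec t))) ` ball 0 s"
  proof (intro equalityI subsetI)
    fix X assume X: "X \<in> M \<inter> ?U"
    then have "X \<in> \<phi> ` ball 0 r" using MU_eq by blast
    then obtain t where t: "norm t < r" "X = \<phi> t" by auto
    then have "\<Xi> (X, 0) = rvec t" using \<Xi>\<Phi>[of "rvec t"] \<Phi>_rvec[OF t(1)] by simp
    then show "X \<in> (\<lambda>t. fst (\<Phi> (rvec t))) ` ball 0 s" using X t by (auto simp: \<phi>_def)
  next
    fix X assume "X \<in> (\<lambda>t. fst (\<Phi> (rvec t))) ` ball 0 s"
    then obtain t where t: "norm t < s" "X = \<phi> t" by (auto simp: \<phi>_def)
    then have tr: "norm t < r" using s by simp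
    then have "\<Xi> (X, 0) = rvec t" using \<Xi>\<Phi>[of "rvec t"] \<Phi>_rvec[OF tr] t by simp
    then show "X \<in> M \<inter> ?U" using \<phi>_in[OF tr] t by simp
  qed
qed

text \<open>Differentiation under the integral sign; such averages of the components
  of a gradient build up its potential.\<close>

lemma holo_ray_average:
  fixes g :: "complex ^ 'm \<Rightarrow> complex"
  assumes g: "holo jv jc (ball 0 r) g"
  shows "holo jv jc (ball 0 r) (\<lambda>x. integral {0..1} (\<lambda>s. g (s *\<^sub>R x)))"
  unfolding holo_def
proof
  fix x0 :: "complex ^ 'm" assume x0: "x0 \<in> ball 0 r"
  have sub: "s *\<^sub>R x \<in> ball 0 r" if "x \<in> ball 0 r" "s \<in> {0..1}" for x :: "complex ^ 'm" and s
  proof -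
    have "\<bar>s\<bar> * norm x \<le> 1 * norm x" using that by (intro mult_right_mono) auto
    then show ?thesis using that by simp
  qed
  define g' where "g' = (\<lambda>x s. Blinfun (\<lambda>h. D g (s *\<^sub>R x) (s *\<^sub>R h)))"
  have g': "blinfun_apply (g' x s) = (\<lambda>h. D g (s *\<^sub>R x) (s *\<^sub>R h))" if "x \<in> ball 0 r" "s \<in> {0..1}" for x s
    unfolding g'_def
    by (rule bounded_linear_Blinfun_apply
        bounded_linear_compose[OF holo_bounded_linear[OF g sub[OF that]] bounded_linear_scaleR_right])+
  have dg: "continuous_on (ball 0 r) (\<lambda>x. D g x b)" for b
    by (rule holo_D_continuous[OF _ _ open_ball g]) auto
  have contg': "continuous_on (ball 0 r \<times> cbox 0 1) (\<lambda>(x, s). g' x s)"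
  proof (rule continuous_on_blinfun_componentwise)
    fix b :: "complex ^ 'm"
    have c: "continuous_on (ball 0 r \<times> cbox 0 1) (\<lambda>z. snd z *\<^sub>R D g (snd z *\<^sub>R fst z) b)"
      by (intro continuous_intros continuous_on_compose2[OF dg]) (use sub in auto)
    show "continuous_on (ball 0 r \<times> cbox 0 1) (\<lambda>z. blinfun_apply (case z of (x, s) \<Rightarrow> g' x s) b)"
    proof (rule continuous_on_eq[OF c])
      fix z :: "(complex ^ 'm) \<times> real" assume z: "z \<in> ball 0 r \<times> cbox 0 1"
      then have "snd z *\<^sub>R fst z \<in> ball 0 r" using sub[of "fst z" "snd z"] by auto
      from linear_scale[OF holo_linear[OF g this]]
      show "snd z *\<^sub>R D g (snd z *\<^sub>R fst z) b = blinfun_apply (case z of (x, s) \<Rightarrow> g' x s) b"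
        using z g'[of "fst z" "snd z"] by (auto simp: split_beta)
    qed
  qed
  have "((\<lambda>x. integral (cbox 0 1) (\<lambda>s. g (s *\<^sub>R x))) has_derivative integral (cbox 0 1) (g' x0)) (at x0 within ball 0 r)"
  proof (rule leibniz_rule[OF _ _ contg' x0 convex_ball])
    fix x :: "complex ^ 'm" and s :: real assume x: "x \<in> ball 0 r" and "s \<in> cbox 0 1"
    then have s: "s \<in> {0..1}" by simp
    have "((\<lambda>x. s *\<^sub>R x) has_derivative (\<lambda>h. s *\<^sub>R h)) (at x within ball 0 r)"
      by (rule bounded_linear_imp_has_derivative[OF bounded_linear_scaleR_right])
    from has_derivative_compose[OF this holo_D[OF g sub[OF x s]]]
    show "((\<lambda>x. g (s *\<^sub>R x)) has_derivative blinfun_apply (g' x s)) (at x within ball 0 r)"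
      unfolding g'[OF x s] .
  next
    fix x :: "complex ^ 'm" assume "x \<in> ball 0 r"
    then show "(\<lambda>s. g (s *\<^sub>R x)) integrable_on cbox 0 1"
      by (intro integrable_continuous continuous_on_compose2[OF holo_continuous[OF g]] continuous_intros)
         (use sub in auto)
  qed
  then have d: "((\<lambda>x. integral (cbox 0 1) (\<lambda>s. g (s *\<^sub>R x))) has_derivative integral (cbox 0 1) (g' x0)) (at x0)"
    unfolding at_within_open[OF x0 open_ball] .
  have "continuous_on (cbox 0 1) (\<lambda>s::real. (x0, s))" by (intro continuous_intros)
  from continuous_on_compose2[OF contg' this] x0
  have "continuous_on (cbox 0 1) (g' x0)" by (auto simp: image_subset_iff)
  then have int: "g' x0 integrable_on cbox 0 1" by (rule integrable_continuous)
  have "integral (cbox 0 1) (g' x0) (\<i> *s h) = \<i> * integral (cbox 0 1) (g' x0) h" for h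
  proof -
    have "integral (cbox 0 1) (g' x0) (\<i> *s h) = integral (cbox 0 1) (\<lambda>s. g' x0 s (\<i> *s h))"
      by (rule blinfun_apply_integral[OF int])
    also have "\<dots> = integral (cbox 0 1) (\<lambda>s. \<i> * g' x0 s h)"
    proof (rule integral_cong)
      fix s :: real assume "s \<in> cbox 0 1"
      then have s: "s \<in> {0..1}" by simp
      have "s *\<^sub>R (\<i> *s h) = \<i> *s (s *\<^sub>R h)" by (simp add: jv_scaleR)
      then show "g' x0 s (\<i> *s h) = \<i> * g' x0 s h"
        unfolding g'[OF x0 s] using holo_D_commute[OF g sub[OF x0 s], of "s *\<^sub>R h"] by simp
    qed
    also have "\<dots> = \<i> * integral (cbox 0 1) (\<lambda>s. g' x0 s h)" by (rule integral_mult_right)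
    also have "integral (cbox 0 1) (\<lambda>s. g' x0 s h) = integral (cbox 0 1) (g' x0) h"
      by (rule blinfun_apply_integral[OF int, symmetric])
    finally show ?thesis .
  qed
  with d show "\<exists>f'. ((\<lambda>x. integral {0..1} (\<lambda>s. g (s *\<^sub>R x))) has_derivative f') (at x0) \<and> (\<forall>v. f' (\<i> *s v) = \<i> * f' v)"
    unfolding cbox_interval by (intro exI[of _ "blinfun_apply (integral {0..1} (g' x0))"] conjI allI)
qed

lemma analytic_direction_subset: "analytic_direction r u a \<Longrightarrow> s \<le> r \<Longrightarrow> analytic_direction s u a"
  unfolding analytic_direction_def analytic_field_def using weak_deriv_subset[of "ball 0 r" u a _ "ball 0 s"] analytic_ext_subset subset_ball by metis

lemma analytic_ext_det:
  fixes B :: "real ^ 'm \<Rightarrow> complex ^ 'k ^ 'k"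
  assumes "\<And>i j. analytic_ext r (\<lambda>t. B t $ i $ j)"
  shows "analytic_ext r (\<lambda>t. det (B t))"
  unfolding det_def by (intro analytic_ext_sum analytic_ext_mult analytic_ext_const analytic_ext_prod assms)

lemma analytic_ext_inverse:
  assumes f: "analytic_ext r f" and r: "r > 0" and 0: "f 0 \<noteq> 0"
  obtains s where "0 < s" "s \<le> r" "analytic_ext s (\<lambda>t. inverse (f t))" "\<And>t. norm t < s \<Longrightarrow> f t \<noteq> 0"
proof -
  obtain F where F: "holo jv jc (ball 0 r) F" "\<And>t. norm t < r \<Longrightarrow> f t = F (rvec t)"
    using analytic_extE[OF f] by metis
  have F0: "F 0 \<noteq> 0" using F(2)[of 0] r 0 by (simp add: linear_0[OF linear_rvec])
  have "isCont F 0" using holo_continuous[OF F(1)] r by (simp add: continuous_on_eq_continuous_at)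
  from continuous_at_avoid[OF this F0]
  obtain e where e: "e > 0" "\<And>y. dist 0 y < e \<Longrightarrow> F y \<noteq> 0" by blast
  define s where "s = min e r"
  show thesis
  proof (rule that)
    show "0 < s" "s \<le> r" using e r by (auto simp: s_def)
    show "f t \<noteq> 0" if "norm t < s" for t using F(2)[of t] e(2)[of "rvec t"] that by (simp add: s_def)
    have "holo jv jc (ball 0 s) (\<lambda>x. inverse (F x))"
      by (rule holo_inverse[OF holo_subset[OF F(1)]]) (use e(2) in \<open>auto simp: s_def\<close>)
    then show "analytic_ext s (\<lambda>t. inverse (f t))" by (rule analytic_extI) (use F(2) in \<open>simp add: s_def\<close>)
  qed
qed

text \<open>If the analytic fields along which \<open>u\<close> has analytic derivatives span at a point then, by Cramer's
  rule, they contain the coordinate fields near that point.\<close>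

lemma analytic_direction_coordinate_fields:
  fixes A :: "'m::finite \<Rightarrow> real ^ 'm \<Rightarrow> complex ^ 'm"
  assumes u: "continuous_on (ball 0 r) u" and r: "r > 0"
    and A: "\<And>k. analytic_direction r u (A k)" "\<And>k. A k 0 = axis k 1"
  obtains s where "0 < s" "s \<le> r" "\<And>k. analytic_direction s u (\<lambda>_. axis k 1)"
proof -
  define B where "B = (\<lambda>t. \<chi> i j. A j t $ i)"
  have rA: "analytic_ext r (\<lambda>t. A j t $ i)" for i j using A(1) by (simp add: analytic_direction_def analytic_field_def)
  have rB: "analytic_ext r (\<lambda>t. det (B t))" by (rule analytic_ext_det) (simp add: B_def rA)
  have "B 0 = mat 1" by (simp add: B_def A(2) mat_def axis_def vec_eq_iff)
  then have "det (B 0) \<noteq> 0" by (simp add: det_I)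
  then obtain s where s: "0 < s" "s \<le> r" "analytic_ext s (\<lambda>t. inverse (det (B t)))" "\<And>t. norm t < s \<Longrightarrow> det (B t) \<noteq> 0"
    using analytic_ext_inverse[OF rB r] by metis
  have us: "continuous_on (ball 0 s) u" using u s by (auto intro: continuous_on_subset)
  have "analytic_direction s u (\<lambda>_. axis k 1)" for k
  proof -
    \<comment> \<open>the solution of B x = axis k 1 by the formula of Cramer\<close>
    define x where "x = (\<lambda>t. \<chi> j. det (\<chi> i l. if l = j then axis k 1 $ i else B t $ i $ l) / det (B t))"
    have rx: "analytic_ext s (\<lambda>t. x t $ j)" for j
    proof -
      have "analytic_ext s (\<lambda>t. det (\<chi> i l. if l = j then axis k 1 $ i else B t $ i $ l))"
      proof (rule analytic_ext_det)
        show "analytic_ext s (\<lambda>t. (\<chi> i l. if l = j then axis k 1 $ i else B t $ i $ l) $ i $ l)" for i l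
          using analytic_ext_const[of s "axis k 1 $ i"] analytic_ext_subset[OF rA s(2)] by (cases "l = j") (simp_all add: B_def)
      qed
      from analytic_ext_mult[OF this s(3)] show ?thesis by (simp add: x_def divide_inverse)
    qed
    have "analytic_direction s u (\<lambda>t. \<Sum>j\<in>UNIV. x t $ j *s A j t)"
      by (intro analytic_direction_sum us analytic_direction_mult rx analytic_direction_subset[OF A(1) s(2)])
    moreover have "(\<Sum>j\<in>UNIV. x t $ j *s A j t) = axis k 1" if "norm t < s" for t
    proof -
      have "B t *v x t = axis k 1"
        using cramer[OF s(4)[OF that], of "x t" "axis k 1"] by (simp add: x_def)
      then show ?thesis
        by (simp add: vec_eq_iff matrix_vector_mult_def B_def mult.commute)
    qed
    ultimately show ?thesis by (rule analytic_direction_cong)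
  qed
  with s that show thesis by blast
qed

text \<open>By \<open>weak_gradient_has_derivative\<close> the weak gradient is a gradient, so \<open>u t = u 0 + \<Sum>\<^sub>k t\<^sub>k \<integral> g\<^sub>k (s t) ds\<close>,
  and this formula makes sense for complex \<open>t\<close>.\<close>

lemma analytic_ext_of_analytic_direction_coordinates:
  fixes u :: "real ^ 'm \<Rightarrow> complex"
  assumes u: "continuous_on (ball 0 r) u" and r: "r > 0" and analytic_direction: "\<And>k. analytic_direction r u (\<lambda>_. axis k 1)"
  shows "analytic_ext r u"
proof -
  have "\<forall>k. \<exists>g. analytic_ext r g \<and> weak_deriv (ball 0 r) u (\<lambda>_. axis k 1) g" using analytic_direction unfolding analytic_direction_def by blast
  from choice[OF this] obtain g where g: "\<And>k. analytic_ext r (g k)" "\<And>k. weak_deriv (ball 0 r) u (\<lambda>_. axis k 1) (g k)" by blast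
  have "\<forall>k. \<exists>F. holo jv jc (ball 0 r) F \<and> (\<forall>t. norm t < r \<longrightarrow> g k t = F (rvec t))"
    using g(1) unfolding analytic_ext_def by blast
  from choice[OF this] obtain F where F: "\<And>k. holo jv jc (ball 0 r) (F k)"
      "\<And>k t. norm t < r \<Longrightarrow> g k t = F k (rvec t)" by blast
  have du: "(u has_derivative (\<lambda>X. \<Sum>k\<in>UNIV. of_real (X $ k) * g k x)) (at x)" if "x \<in> ball 0 r" for x
    by (rule weak_gradient_has_derivative[OF open_ball u analytic_ext_continuous[OF g(1)] g(2) that])
  show ?thesis
  proof (rule analytic_extI)
    have vn: "holo jv jc (ball 0 r) (\<lambda>x :: complex ^ 'm. x $ k)" for k
      using holo_ident[of jv "ball 0 r"] unfolding holo_vec_iff by blast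
    show "holo jv jc (ball 0 r) (\<lambda>x. u 0 + (\<Sum>k\<in>UNIV. x $ k * integral {0..1} (\<lambda>s. F k (s *\<^sub>R x))))"
      by (intro holo_add holo_const linear_jc holo_sum holo_mult vn holo_ray_average F)
    fix t :: "real ^ 'm" assume t: "norm t < r"
    have st: "s *\<^sub>R t \<in> ball 0 r" if "s \<in> {0..1}" for s
    proof -
      have "\<bar>s\<bar> * norm t \<le> 1 * norm t" using that by (intro mult_right_mono) auto
      then show ?thesis using t by simp
    qed
    have "((\<lambda>s. \<Sum>k\<in>UNIV. of_real (t $ k) * g k (s *\<^sub>R t)) has_integral u (1 *\<^sub>R t) - u (0 *\<^sub>R t)) {0..1}"
    proof (rule fundamental_theorem_of_calculus)
      fix s :: real assume s: "s \<in> {0..1}"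
      have "((\<lambda>s. s *\<^sub>R t) has_derivative (\<lambda>h. h *\<^sub>R t)) (at s within {0..1})"
        by (rule bounded_linear_imp_has_derivative[OF bounded_linear_scaleR_left])
      from has_derivative_compose[OF this du[OF st[OF s]]]
      show "((\<lambda>s. u (s *\<^sub>R t)) has_vector_derivative (\<Sum>k\<in>UNIV. of_real (t $ k) * g k (s *\<^sub>R t))) (at s within {0..1})"
        unfolding has_vector_derivative_def
        by (rule has_derivative_eq_rhs)
           (simp only: fun_eq_iff vector_scaleR_component scaleR_sum_right, simp add: complex_eq_iff mult.assoc)
    qed simp
    then have "u t = u 0 + integral {0..1} (\<lambda>s. \<Sum>k\<in>UNIV. of_real (t $ k) * g k (s *\<^sub>R t))"
      by (simp add: has_integral_iff)
    also have "integral {0..1} (\<lambda>s. \<Sum>k\<in>UNIV. of_real (t $ k) * g k (s *\<^sub>R t))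
        = (\<Sum>k\<in>UNIV. integral {0..1} (\<lambda>s. of_real (t $ k) * g k (s *\<^sub>R t)))"
    proof (rule integral_sum)
      fix k
      have "continuous_on {0..1} (\<lambda>s. of_real (t $ k) * g k (s *\<^sub>R t))"
        by (intro continuous_intros continuous_on_compose2[OF analytic_ext_continuous[OF g(1)]]) (use st in auto)
      then show "(\<lambda>s. of_real (t $ k) * g k (s *\<^sub>R t)) integrable_on {0..1}" by (rule integrable_continuous_interval)
    qed simp
    also have "\<dots> = (\<Sum>k\<in>UNIV. rvec t $ k * integral {0..1} (\<lambda>s. F k (s *\<^sub>R rvec t)))"
    proof (intro sum.cong refl)
      fix k
      have "integral {0..1} (\<lambda>s. of_real (t $ k) * g k (s *\<^sub>R t)) = of_real (t $ k) * integral {0..1} (\<lambda>s. g k (s *\<^sub>R t))"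
        by (rule integral_mult_right)
      also have "integral {0..1} (\<lambda>s. g k (s *\<^sub>R t)) = integral {0..1} (\<lambda>s. F k (s *\<^sub>R rvec t))"
      proof (rule integral_cong)
        fix s :: real assume "s \<in> {0..1}"
        then show "g k (s *\<^sub>R t) = F k (s *\<^sub>R rvec t)"
          using F(2)[of "s *\<^sub>R t" k] st[of s] linear_scale[OF linear_rvec, of s t] by simp
      qed
      finally show "integral {0..1} (\<lambda>s. of_real (t $ k) * g k (s *\<^sub>R t)) = rvec t $ k * integral {0..1} (\<lambda>s. F k (s *\<^sub>R rvec t))"
        by (simp add: rvec_def)
    qed
    finally show "u t = u 0 + (\<Sum>k\<in>UNIV. rvec t $ k * integral {0..1} (\<lambda>s. F k (s *\<^sub>R rvec t)))" .
  qed
qed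

theorem corollary2p9:
  fixes M W :: "(complex ^ 'n) set"
    and d :: nat
    and p0 :: "complex ^ 'n"
    and f :: "complex ^ 'n \<Rightarrow> complex"
  assumes "real_analytic_submanifold d M"
    and "generic d M"
    and "CARD('m::finite) + d = 2 * CARD('n)"
    and "p0 \<in> M"
    and "finite_type_at M p0"
    and "open W" and "p0 \<in> W"
    and "continuous_cr_function TYPE('m) M W f"
    and "real_analytic_along M W (\<lambda>Z. Im (f Z))"
  shows "(\<exists>U F. open U \<and> p0 \<in> U \<and> U \<subseteq> W \<and> holomorphic_on_Cn U F \<and> (\<forall>Z\<in>M \<inter> U. F Z = f Z))
       \<and> (\<exists>U. open U \<and> p0 \<in> U \<and> U \<subseteq> W \<and> real_analytic_along M U (\<lambda>Z. Re (f Z)))"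
proof -
  obtain r0 and \<Phi> :: "complex ^ 'm \<Rightarrow> (complex ^ 'n) \<times> (complex ^ 'n)" and \<Xi> S U0
    where ch: "0 < r0" "holo jv jp (ball 0 r0) \<Phi>" "\<Phi> 0 = (p0, 0)"
      "\<And>t. norm t < r0 \<Longrightarrow> snd (\<Phi> (rvec t)) = 0"
      "open S" "holo jp jv S \<Xi>" "\<And>x. norm x < r0 \<Longrightarrow> \<Phi> x \<in> S \<and> \<Xi> (\<Phi> x) = x"
      "open U0" "U0 \<subseteq> W" "\<And>X. X \<in> U0 \<Longrightarrow> (X, 0) \<in> S \<and> (\<exists>t. norm t < r0 \<and> \<Xi> (X, 0) = rvec t)"
      "M \<inter> U0 = (\<lambda>t. fst (\<Phi> (rvec t))) ` ball 0 r0"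
      "\<And>y. \<exists>c. zmap (D \<Phi> 0 c) = y"
    by (rule generic_chart[OF assms(2,3,4,6,7)]) (rule that)
  interpret c0: cr_chart M W p0 r0 \<Phi> \<Xi> S U0
    by unfold_locales (rule ch; assumption?)+
  \<comment> \<open>the coordinates Z, continued to complex parameters\<close>
  define H where "H = (\<lambda>x. zmap (\<Phi> x))"
  have hH: "holo jv jv (ball 0 r0) H"
    unfolding H_def by (rule holo_compose[OF ch(2) zmap_holo[of UNIV]]) simp
  have D_zmap: "D zmap w v = zmap v" for w v :: "(complex ^ 'n) \<times> (complex ^ 'n)"
    using has_derivative_D[OF linear_imp_has_derivative[OF linear_zmap]] by metis
  have DH: "D H x c = zmap (D \<Phi> x c)" if "norm x < r0" for x c
  proof -
    have "D (\<lambda>x. zmap (\<Phi> x)) x c = D zmap (\<Phi> x) (D \<Phi> x c)"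
      by (rule D_compose[OF zmap_holo[of UNIV] holo_D[OF ch(2)]]) (use that in auto)
    then show ?thesis by (simp only: D_zmap H_def)
  qed
  have H0: "H 0 = p0" by (simp add: H_def zmap_def ch(3))
  have surj: "\<exists>x. D H 0 x = y" for y using ch(12)[of y] DH[of 0] ch(1) by simp
  obtain r1 and l :: "'m \<Rightarrow> complex ^ 'm \<Rightarrow> complex ^ 'm" where r1: "0 < r1" "r1 \<le> r0"
    and hl: "\<And>j. holo jv jv (ball 0 r1) (l j)"
    and ker: "\<And>x j. norm x < r1 \<Longrightarrow> D H x (l j x) = 0"
    and frame: "\<And>x c. norm x < r1 \<Longrightarrow> D H x c = 0 \<Longrightarrow> c = (\<Sum>j\<in>UNIV. c $ j *s l j x)"
    and descent: "\<And>f r. 0 < r \<Longrightarrow> r \<le> r1 \<Longrightarrow> holo jv jc (ball 0 r) f \<Longrightarrow>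
        (\<And>x c. norm x < r \<Longrightarrow> D H x c = 0 \<Longrightarrow> D f x c = 0) \<Longrightarrow>
        \<exists>U F r2. open U \<and> H 0 \<in> U \<and> holo jv jc U F \<and> 0 < r2 \<and> r2 \<le> r \<and>
            (\<forall>x. norm x < r2 \<longrightarrow> H x \<in> U \<and> F (H x) = f x)"
  proof (rule holo_submersion[OF hH ch(1) surj], goal_cases)
    case (1 r1 l)
    show thesis by (rule 1(1)[OF 1(2-)])
  qed

  \<comment> \<open>on a smaller chart the imaginary part extends holomorphically to complex parameters\<close>
  obtain Uv Gv where Uv: "p0 \<in> Uv" "real_analytic_on Uv Gv" "\<And>q. q \<in> M \<inter> Uv \<Longrightarrow> Gv q = Im (f q)"
  proof -
    have "p0 \<in> M \<inter> W" using assms(4,7) by simp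
    from assms(9)[unfolded real_analytic_along_def, rule_format, OF this] show thesis
      using that by auto
  qed
  obtain rv Gt where rv: "rv > 0" "holo jp jc (ball (p0, 0) rv) Gt"
    and Gt: "\<And>x. x \<in> ball p0 rv \<Longrightarrow> Gt (x, 0) = of_real (Gv x)"
    by (rule real_analytic_holo_extension[OF Uv(2,1)]) (rule that)
  have "open Uv" using Uv(2) by (simp add: real_analytic_on_def)
  then obtain rv' where rv': "rv' > 0" "ball p0 rv' \<subseteq> Uv" using Uv(1) open_contains_ball by blast
  have "isCont \<Phi> 0" using holo_continuous[OF ch(2)] ch(1) by (simp add: continuous_on_eq_continuous_at)
  moreover have "min rv rv' > 0" using rv rv' by simp
  ultimately obtain r2 where r2: "r2 > 0" "\<And>x. dist x 0 < r2 \<Longrightarrow> dist (\<Phi> x) (\<Phi> 0) < min rv rv'"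
    unfolding continuous_at_eps_delta by blast
  define r where "r = min r1 r2"
  have r: "0 < r" "r \<le> r1" "r \<le> r0" "\<And>x. norm x < r \<Longrightarrow> dist (p0, 0) (\<Phi> x) < min rv rv'"
    using r1 r2 by (auto simp: r_def ch(3) dist_commute)
  define U1 where "U1 = {X \<in> U0. norm (\<Xi> (X, 0)) < r}"
  interpret c: cr_chart M W p0 r \<Phi> \<Xi> S U1
    unfolding U1_def by (rule c0.cr_chart_shrink[OF r(1,3)])
  have \<phi>0: "c.\<phi> 0 = p0" unfolding c.\<phi>_def using ch(3) by (simp add: linear_0[OF linear_rvec])
  have \<phi>W: "c.\<phi> t \<in> M \<inter> W" if "norm t < r" for t using c.\<phi>_in[OF that] c.U(2) by blast
  define F0 where "F0 = (\<lambda>t. f (c.\<phi> t))"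
  define u where "u = (\<lambda>t. complex_of_real (Re (F0 t)))"
  define v where "v = (\<lambda>t. complex_of_real (Im (F0 t)))"
  have uv: "u = (\<lambda>t. F0 t + (- \<i>) * v t)"
    by (simp add: u_def v_def fun_eq_iff complex_eq_iff)
  have "continuous_on (M \<inter> W) f" using assms(8) by (simp add: continuous_cr_function_def)
  then have cF0: "continuous_on (ball 0 r) F0"
    unfolding F0_def
    by (rule continuous_on_compose2[OF _ smooth_on_continuous[OF c.smooth_\<phi>]]) (use \<phi>W in auto)
  have cu: "continuous_on (ball 0 r) u" unfolding u_def by (intro continuous_intros cF0)
  have ranv: "analytic_ext r v"
  proof (rule analytic_extI)
    show "holo jv jc (ball 0 r) (\<lambda>x. Gt (\<Phi> x))"
      by (rule holo_compose[OF c.h\<Phi> rv(2)]) (use r(4) in auto)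
    show "v t = Gt (\<Phi> (rvec t))" if t: "norm t < r" for t
    proof -
      have "dist p0 (c.\<phi> t) < min rv rv'" using r(4)[of "rvec t"] t c.\<Phi>_rvec[OF t] by simp
      then have "Gt (c.\<phi> t, 0) = of_real (Gv (c.\<phi> t))" "c.\<phi> t \<in> Uv" using Gt rv'(2) by auto
      then show ?thesis using Uv(3)[of "c.\<phi> t"] \<phi>W[OF t] c.\<Phi>_rvec[OF t] by (simp add: v_def F0_def)
    qed
  qed

  \<comment> \<open>the CR equation expresses the derivatives of u along the CR fields l by those of v\<close>
  have hlr: "holo jv jv (ball 0 r) (l j)" for j by (rule holo_subset[OF hl]) (use r in auto)
  have fl: "analytic_field r (\<lambda>t. l j (rvec t))" for j
    unfolding analytic_field_def using hlr[of j] unfolding holo_vec_iff by (auto intro: analytic_extI)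
  have wkF: "weak_deriv (ball 0 r) F0 (\<lambda>t. l j (rvec t)) (\<lambda>_. 0)" for j
    unfolding F0_def
  proof (rule c.cr_function_weakly_killed[OF assms(8) hlr])
    show "zmap (D \<Phi> x (l j x)) = 0" if "norm x < r" for x
      using ker[of x j] DH[of x "l j x"] that r(2,3) by simp
  qed
  \<comment> \<open>the derivative of f - \<i>v, where f contributes 0\<close>
  define g where "g = (\<lambda>j t. 0 + (- \<i>) * field_deriv (\<lambda>t. l j (rvec t)) v t)"
  have rg: "analytic_ext r (g j)" for j
    unfolding g_def by (intro analytic_ext_add analytic_ext_mult analytic_ext_const analytic_ext_field_deriv fl ranv)
  have wku: "weak_deriv (ball 0 r) u (\<lambda>t. l j (rvec t)) (g j)" for j
    unfolding uv g_def
    by (intro weak_deriv_lincomb open_ball cF0 analytic_ext_continuous[OF ranv] analytic_field_smooth_field[OF fl] continuous_on_const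
        analytic_ext_continuous[OF analytic_ext_field_deriv[OF fl ranv]] wkF weak_deriv_smooth analytic_ext_smooth[OF ranv])
  have l: "analytic_direction r u (\<lambda>t. l j (rvec t))" for j
    unfolding analytic_direction_def using fl rg wku by blast
  have l': "analytic_direction r u (\<lambda>t. \<chi> i. cnj (l j (rvec t) $ i))" for j
    unfolding analytic_direction_def
  proof (intro conjI exI)
    show "analytic_field r (\<lambda>t. \<chi> i. cnj (l j (rvec t) $ i))"
      using fl[of j] unfolding analytic_field_def by (auto intro: analytic_ext_cnj)
    show "analytic_ext r (\<lambda>t. cnj (g j t))" by (rule analytic_ext_cnj[OF rg])
    show "weak_deriv (ball 0 r) u (\<lambda>t. \<chi> i. cnj (l j (rvec t) $ i)) (\<lambda>t. cnj (g j t))"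
      by (rule weak_deriv_cnj[OF open_ball analytic_field_smooth_field[OF fl] wku]) (simp add: u_def)
  qed
  have frame': "c = (\<Sum>j\<in>UNIV. c $ j *s l j x)" if "norm x < r" "zmap (D \<Phi> x c) = 0" for x c
    by (rule frame) (use that DH r in auto)

  \<comment> \<open>by finite type the fields along which u is analytic take all values at the base point\<close>
  obtain N where N: "open N" "p0 \<in> N" "{L p0 | L. L \<in> cr_lie_algebra M N} = complexified_tangent_space M p0"
    using assms(5) unfolding finite_type_at_def by blast
  have r0': "norm (0 :: real ^ 'm) < r" using r by simp
  have rvec0: "rvec (0 :: real ^ 'm) = 0" by (rule linear_0[OF linear_rvec])
  have "\<exists>A. analytic_direction r u A \<and> A 0 = axis k 1" for k
  proof -
    have "D \<Phi> 0 (axis k 1) \<in> complexified_tangent_space M p0"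
      using c.complexified_tangent_space_\<phi>[OF r0'] unfolding \<phi>0 rvec0 by simp
    then have "\<exists>L. D \<Phi> 0 (axis k 1) = L p0 \<and> L \<in> cr_lie_algebra M N" unfolding N(3)[symmetric] mem_Collect_eq .
    then obtain L where L: "L \<in> cr_lie_algebra M N" "L p0 = D \<Phi> 0 (axis k 1)" by metis
    define V where "V = {t \<in> ball 0 r. c.\<phi> t \<in> N}"
    have "smooth_on N L \<and> (\<exists>a. direction_span r u V a \<and> (\<forall>t\<in>V. L (c.\<phi> t) = D \<Phi> (rvec t) (a t)))"
      by (rule c.cr_lie_algebra_direction_span[OF cu N(1) l l' _ V_def L(1)]) (rule frame')
    then obtain a where a: "direction_span r u V a" "\<forall>t\<in>V. L (c.\<phi> t) = D \<Phi> (rvec t) (a t)"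
      by blast
    have V0: "0 \<in> V" using r0' N(2) \<phi>0 by (simp add: V_def)
    have "open V"
      using continuous_open_preimage[OF smooth_on_continuous[OF c.smooth_\<phi>] open_ball N(1)]
      by (simp add: V_def vimage_def Int_def)
    moreover have "V \<subseteq> ball 0 r" by (auto simp: V_def)
    ultimately obtain A where A: "analytic_direction r u A" "A 0 = a 0" using direction_span_value[OF cu _ _ a(1) V0] by blast
    have "D \<Phi> 0 (axis k 1) = D \<Phi> 0 (a 0)" using a(2) V0 L(2) \<phi>0 rvec0 by metis
    then have "axis k 1 = a 0" using c.D_\<Xi>_\<Phi>[of 0] r(1) by (metis norm_zero)
    with A show ?thesis by auto
  qed
  then obtain A where A: "\<And>k. analytic_direction r u (A k)" "\<And>k. A k 0 = axis k 1" by metis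
  obtain s where s: "0 < s" "s \<le> r" "\<And>k. analytic_direction s u (\<lambda>_. axis k 1)"
    using analytic_direction_coordinate_fields[OF cu r(1) A] by metis
  have "continuous_on (ball 0 s) u" using cu s(2) by (auto intro: continuous_on_subset)
  then have ru: "analytic_ext s u" by (rule analytic_ext_of_analytic_direction_coordinates[OF _ s(1,3)])
  have F0: "F0 = (\<lambda>t. u t + \<i> * v t)" by (simp add: u_def v_def fun_eq_iff complex_eq_iff)
  have rF: "analytic_ext s F0" unfolding F0 by (intro analytic_ext_add analytic_ext_mult analytic_ext_const ru analytic_ext_subset[OF ranv s(2)])
  then obtain ft where ft: "holo jv jc (ball 0 s) ft" "\<And>t. norm t < s \<Longrightarrow> F0 t = ft (rvec t)"
    using analytic_extE by metis

  \<comment> \<open>the CR equations hold at the real points and therefore at all complex parameters\<close>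
  have kill: "D ft x (l j x) = 0" if x: "norm x < s" for x j
  proof -
    let ?K = "\<lambda>x. \<Sum>k\<in>UNIV. l j x $ k * D ft x (axis k 1)"
    have hls: "holo jv jv (ball 0 s) (l j)" by (rule holo_subset[OF hlr]) (use s in auto)
    have hK: "holo jv jc (ball 0 s) ?K"
      by (intro holo_sum linear_jc holo_mult hls[unfolded holo_vec_iff, rule_format]
          holo_derivative_scalar complex_structure_jv open_ball ft)
    have fls: "analytic_field s (\<lambda>t. l j (rvec t))"
      using fl[of j] analytic_ext_subset[OF _ s(2)] unfolding analytic_field_def by blast
    have w1: "weak_deriv (ball 0 s) F0 (\<lambda>t. l j (rvec t)) (\<lambda>_. 0)" by (rule weak_deriv_subset[OF wkF]) (use s in auto)
    have w2: "weak_deriv (ball 0 s) F0 (\<lambda>t. l j (rvec t)) (field_deriv (\<lambda>t. l j (rvec t)) F0)"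
      by (rule weak_deriv_smooth[OF open_ball analytic_field_smooth_field[OF fls] analytic_ext_smooth[OF rF]])
    have "?K (rvec t) = 0" if t: "norm t < s" for t
    proof -
      have "0 = field_deriv (\<lambda>t. l j (rvec t)) F0 t"
        by (rule weak_deriv_unique[OF open_ball continuous_on_const analytic_ext_continuous[OF analytic_ext_field_deriv[OF fls rF]] w1 w2])
           (use t in simp)
      also have "\<dots> = ?K (rvec t)" unfolding field_deriv_def by (simp only: partial_holo[OF ft t])
      finally show ?thesis by simp
    qed
    from holo_identity[OF hK this x] have "?K x = 0" .
    moreover have "D ft x (l j x) = (\<Sum>k\<in>UNIV. cscale jc (l j x $ k) (D ft x (axis k 1)))"
      by (rule holo_D_vec[OF ft(1)]) (use x in simp)
    ultimately show ?thesis by simp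
  qed
  have killc: "D ft x c = 0" if x: "norm x < s" and c: "D H x c = 0" for x c
  proof -
    have x': "x \<in> ball 0 s" using x by simp
    have "D ft x c = D ft x (\<Sum>j\<in>UNIV. c $ j *s l j x)"
      by (rule arg_cong[OF frame]) (use x c s r in auto)
    also have "\<dots> = (\<Sum>j\<in>UNIV. D ft x (cscale jv (c $ j) (l j x)))"
      by (simp add: linear_sum[OF holo_linear[OF ft(1) x']])
    also have "\<dots> = 0" by (simp only: holo_D_cscale[OF ft(1) x'] kill[OF x] cscale_jc mult_zero_right sum.neutral_const)
    finally show ?thesis .
  qed
  have "\<exists>U F r2. open U \<and> H 0 \<in> U \<and> holo jv jc U F \<and> 0 < r2 \<and> r2 \<le> s \<and>
            (\<forall>x. norm x < r2 \<longrightarrow> H x \<in> U \<and> F (H x) = ft x)"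
    by (rule descent[OF s(1) order_trans[OF s(2) r(2)] ft(1)]) (rule killc)
  then obtain UF F r3 where UF: "open UF" "H 0 \<in> UF" and hF: "holo jv jc UF F" and r3: "0 < r3" "r3 \<le> s"
    and FH: "\<And>x. norm x < r3 \<Longrightarrow> H x \<in> UF \<and> F (H x) = ft x"
    by blast
  have "r3 \<le> r" using r3 s by simp
  interpret c3: cr_chart M W p0 r3 \<Phi> \<Xi> S "{X \<in> U1. norm (\<Xi> (X, 0)) < r3}"
    by (rule c.cr_chart_shrink[OF r3(1) \<open>r3 \<le> r\<close>])
  define U where "U = UF \<inter> {X \<in> U1. norm (\<Xi> (X, 0)) < r3}"
  have U: "open U" "U \<subseteq> W" "U \<subseteq> UF" using UF(1) c3.U unfolding U_def by auto
  have p0U: "p0 \<in> U"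
    using UF(2) H0 c3.\<phi>_in[of 0] r3(1) \<phi>0 by (simp add: U_def c3.\<phi>_def c.\<phi>_def)
  have Ff: "F Z = f Z" if "Z \<in> M \<inter> U" for Z
  proof -
    have "Z \<in> c3.\<phi> ` ball 0 r3" using that c3.MU_eq unfolding U_def by blast
    then obtain t where t: "norm t < r3" "Z = c3.\<phi> t" by auto
    have "H (rvec t) = Z" using c3.\<Phi>_rvec[OF t(1)] t(2) by (simp add: H_def zmap_def)
    moreover have "ft (rvec t) = f Z" using ft(2)[of t] t r3 by (simp add: F0_def c.\<phi>_def c3.\<phi>_def)
    ultimately show ?thesis using FH[of "rvec t"] t(1) by simp
  qed
  have "holomorphic_on_Cn U F"
    unfolding holomorphic_on_Cn_def
  proof (intro conjI ballI exI allI)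
    fix Z assume "Z \<in> U"
    then have Z: "Z \<in> UF" using U(3) by blast
    show "(F has_derivative D F Z) (at Z)" by (rule holo_D[OF hF Z])
    show "D F Z (c *s X) = c * D F Z X" for c X using holo_D_cscale[OF hF Z, of c X] by simp
  qed (rule U)
  moreover have "real_analytic_on U (\<lambda>Z. Re (F Z))"
  proof -
    have zc: "continuous_on UNIV (zmap :: (complex ^ 'n) \<times> (complex ^ 'n) \<Rightarrow> complex ^ 'n)"
      by (rule holo_continuous[OF zmap_holo])
    have "holo jp jc (zmap -` UF) (\<lambda>w. F (zmap w))"
      by (rule holo_compose[OF zmap_holo hF]) auto
    from real_analytic_holo_restriction[OF U(1) open_vimage[OF UF(1) zc] this]
    have "real_analytic_on U (\<lambda>x. Re (F (zmap (x, 0))))" using U(3) by (auto simp: zmap_def)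
    then show ?thesis by (simp add: zmap_def)
  qed
  then have "real_analytic_along M U (\<lambda>Z. Re (f Z))"
    unfolding real_analytic_along_def using Ff
    by (intro ballI exI[of _ U] exI[of _ "\<lambda>Z. Re (F Z)"]) auto
  ultimately show ?thesis using U(1,2) p0U Ff by blast
qed

end
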